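(* Let $A$ be a formula of $\mathcal{L}^\omega_*$ with free variables $\underline{a}$, and let $T_{\not\exists}$ be a set of $\exists$-free formulas. If $$\mathrm{IL}^{\omega}_*+\mathrm{AC}^{\omega}_*+\mathrm{IP}^*_{\not\exists}+T_{\not\exists}\vdash A(\underline{a}),$$ then there exist closed terms $\underline{t}$ such that $$\mathrm{IL}^{\omega}_*+T_{\not\exists}\vdash A_{HR}(\underline{a},\underline{t}\underline{a}),$$ where $A^{HR}\equiv\exists\underline{x}\,A_{HR}(\underline{a},\underline{x})$.
   Context: Fix a first-order language $\mathcal{L}$ with at least one constant symbol. Types: $G$; $\sigma\to\tau$; $\sigma^*$. Constants: function symbols of $\mathcal{L}$ (type $G\to\cdots\to G$); $\Pi_{\sigma,\tau}:\sigma\to\tau\to\sigma$; $\Sigma_{\rho,\sigma,\tau}:(\rho\to\sigma\to\tau)\to(\rho\to\sigma)\to\rho\to\tau$; $\mathfrak{s}_\sigma:\sigma\to\sigma^*$; $\cup_\sigma:\sigma^*\to\sigma^*\to\sigma^*$; $\bigcup_{\sigma,\tau}:\sigma^*\to(\sigma\to\tau^* )\to\tau^*$. Terms: constants, typed variables, applications. Atomic formulas: $\bot$, $t=_\rho q$, $t\in_\rho q$ ($q:\rho^*$), $R(t_1,\dots,t_n)$ with $R$ a relation symbol of $\mathcal{L}$. Formulas of $\mathcal{L}^\omega_*$: closed under $\lor,\land,\to,\forall x,\exists x$ and bounded quantifiers $\forall x\in t,\exists x\in t$ ($t:\rho^*$ not containing $x:\rho$). A formula is $\exists$-free if it contains no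 unbounded $\exists x$. $\mathrm{IL}^{\omega}_*$ is intuitionistic predicate logic in all finite types with: $x=x$; $x=y\land A\to A'$ for atomic $A$ ($A'$ replacing some $x$ by $y$); $\forall x\in t\,A\leftrightarrow\forall x(x\in t\to A)$; $\exists x\in t\,A\leftrightarrow\exists x(x\in t\land A)$; $\Sigma xyz=xz(yz)$; $\Pi xy=x$; $w\in\mathfrak{s}x\leftrightarrow w=x$; $w\in\cup xy\leftrightarrow w\in x\lor w\in y$; $z\in x\land w\in yz\to w\in\bigcup xy$; $\bigcup(\mathfrak{s}x)y=yx$; $\bigcup(\cup xy)z=\cup(\bigcup xz)(\bigcup yz)$. $\mathrm{AC}^{\omega}_*$ is the scheme $\forall x^\rho\exists y^\sigma A(x,y)\to\exists f^{\rho\to\sigma^*}\forall x\exists y\in fx\,A(x,y)$; $\mathrm{IP}^*_{\not\exists}$ is the scheme $(B(x)\to\exists y\,A(y))\to\exists w(B(x)\to\exists y\in w\,A(y))$ for $\exists$-free $B$. The herbrandized modified realizability assigns to each formula $A$ a formula $A^{HR}\equiv\exists\underline{x}\,A_{HR}(\underline{x})$ with the same free variables and $A_{HR}$ $\exists$-free: for atomic $A$, $A^{HR}:\equiv A_{HR}:\equiv A$; if $A^{HR}\equiv\exists\underline{x}A_{HR}(\underline{x})$, $B^{HR}\equiv\exists\underline{u}B_{HR}(\underline{u})$: $(A\lor B)^{HR}:\equiv\exists\underline{x},\underline{u}(A_{HR}(\underline{x})\lor B_{HR}(\underline{u}))$; $(A\land B)^{HR}:\equiv\exists\underline{x},\underline{u}(A_{HR}(\underline{x})\land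 B_{HR}(\underline{u}))$; $(A\to B)^{HR}:\equiv\exists\underline{U}\forall\underline{x}(A_{HR}(\underline{x})\to B_{HR}(\underline{U}\underline{x}))$; $(\exists zA(z))^{HR}:\equiv\exists Z,\underline{x}\,\exists z\in Z\,A_{HR}(z,\underline{x})$; $(\forall zA(z))^{HR}:\equiv\exists\underline{X}\forall z\,A_{HR}(z,\underline{X}z)$; $(\exists z\in t\,A(z))^{HR}:\equiv\exists\underline{x}\exists z\in t\,A_{HR}(z,\underline{x})$; $(\forall z\in t\,A(z))^{HR}:\equiv\exists\underline{x}\forall z\in t\,A_{HR}(z,\underline{x})$. $\underline{U}\underline{x}$, $\underline{t}\underline{a}$ denote tuples of applications of each component to all listed arguments. *)

theory Defs
  imports Main
begin

section \<open>Types, terms and formulas\<close>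

record ('f, 'r) language =
  funs :: "'f set"
  rels :: "'r set"
  fun_arity :: "'f \<Rightarrow> nat"
  rel_arity :: "'r \<Rightarrow> nat"

datatype ty = G | Arr ty ty (infixr \<open>\<rightarrow>\<^sub>t\<close> 65) | Star ty

fun arrs :: "ty list \<Rightarrow> ty \<Rightarrow> ty" where
  "arrs [] \<tau> = \<tau>"
| "arrs (\<sigma> # \<sigma>s) \<tau> = \<sigma> \<rightarrow>\<^sub>t arrs \<sigma>s \<tau>"

datatype 'f const =
    CFun 'f
  | CPi ty ty
  | CSigma ty ty ty
  | CSing ty
  | CUn ty
  | CBigUn ty ty

primrec const_type :: "('f, 'r) language \<Rightarrow> 'f const \<Rightarrow> ty" where
  "const_type L (CFun f) = arrs (replicate (fun_arity L f) G) G"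
| "const_type L (CPi \<sigma> \<tau>) = \<sigma> \<rightarrow>\<^sub>t \<tau> \<rightarrow>\<^sub>t \<sigma>"
| "const_type L (CSigma \<rho> \<sigma> \<tau>) = (\<rho> \<rightarrow>\<^sub>t \<sigma> \<rightarrow>\<^sub>t \<tau>) \<rightarrow>\<^sub>t (\<rho> \<rightarrow>\<^sub>t \<sigma>) \<rightarrow>\<^sub>t \<rho> \<rightarrow>\<^sub>t \<tau>"
| "const_type L (CSing \<sigma>) = \<sigma> \<rightarrow>\<^sub>t Star \<sigma>"
| "const_type L (CUn \<sigma>) = Star \<sigma> \<rightarrow>\<^sub>t Star \<sigma> \<rightarrow>\<^sub>t Star \<sigma>"
| "const_type L (CBigUn \<sigma> \<tau>) = Star \<sigma> \<rightarrow>\<^sub>t (\<sigma> \<rightarrow>\<^sub>t Star \<tau>) \<rightarrow>\<^sub>t Star \<tau>"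

primrec const_in :: "('f, 'r) language \<Rightarrow> 'f const \<Rightarrow> bool" where
  "const_in L (CFun f) \<longleftrightarrow> f \<in> funs L"
| "const_in L (CPi \<sigma> \<tau>) \<longleftrightarrow> True"
| "const_in L (CSigma \<rho> \<sigma> \<tau>) \<longleftrightarrow> True"
| "const_in L (CSing \<sigma>) \<longleftrightarrow> True"
| "const_in L (CUn \<sigma>) \<longleftrightarrow> True"
| "const_in L (CBigUn \<sigma> \<tau>) \<longleftrightarrow> True"

text \<open>
  De Bruijn representation with a separate index space for each type: \<open>Var \<sigma> n\<close> is the \<open>n\<close>-th
  variable of type \<open>\<sigma>\<close>, and a quantifier over type \<open>\<rho>\<close> binds \<open>Var \<rho> 0\<close>, shifting the indices of
  the variables of type \<open>\<rho>\<close> only. Every type thus has infinitely many variables and no typing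
  context is needed.
\<close>

datatype 'f tm =
    Con "'f const"
  | Var ty nat
  | App "'f tm" "'f tm" (infixl \<open>\<cdot>\<close> 75)

definition apps :: "'f tm \<Rightarrow> 'f tm list \<Rightarrow> 'f tm" where
  "apps t qs = foldl App t qs"

inductive has_type :: "('f, 'r) language \<Rightarrow> 'f tm \<Rightarrow> ty \<Rightarrow> bool" for L where
  Con: "const_in L c \<Longrightarrow> has_type L (Con c) (const_type L c)"
| Var: "has_type L (Var \<sigma> n) \<sigma>"
| App: "has_type L t (\<sigma> \<rightarrow>\<^sub>t \<tau>) \<Longrightarrow> has_type L q \<sigma> \<Longrightarrow> has_type L (t \<cdot> q) \<tau>"

text \<open>
  In the bounded quantifiers \<open>BAll \<rho> t A\<close> and \<open>BEx \<rho> t A\<close> the bound \<open>t\<close> lies outside the scope of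
  the bound variable, so the proviso that \<open>t\<close> does not contain it holds by construction.
\<close>

datatype ('f, 'r) fm =
    Bot
  | Eq ty "'f tm" "'f tm"
  | In ty "'f tm" "'f tm"
  | Rel 'r "'f tm list"
  | Or "('f, 'r) fm" "('f, 'r) fm"
  | And "('f, 'r) fm" "('f, 'r) fm"
  | Imp "('f, 'r) fm" "('f, 'r) fm"
  | All ty "('f, 'r) fm"
  | Ex ty "('f, 'r) fm"
  | BAll ty "'f tm" "('f, 'r) fm"
  | BEx ty "'f tm" "('f, 'r) fm"

abbreviation Iff :: "('f, 'r) fm \<Rightarrow> ('f, 'r) fm \<Rightarrow> ('f, 'r) fm" where
  "Iff A B \<equiv> And (Imp A B) (Imp B A)"

primrec wf_fm :: "('f, 'r) language \<Rightarrow> ('f, 'r) fm \<Rightarrow> bool" where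
  "wf_fm L Bot \<longleftrightarrow> True"
| "wf_fm L (Eq \<rho> t q) \<longleftrightarrow> has_type L t \<rho> \<and> has_type L q \<rho>"
| "wf_fm L (In \<rho> t q) \<longleftrightarrow> has_type L t \<rho> \<and> has_type L q (Star \<rho>)"
| "wf_fm L (Rel R ts) \<longleftrightarrow>
     R \<in> rels L \<and> length ts = rel_arity L R \<and> (\<forall>t\<in>set ts. has_type L t G)"
| "wf_fm L (Or A B) \<longleftrightarrow> wf_fm L A \<and> wf_fm L B"
| "wf_fm L (And A B) \<longleftrightarrow> wf_fm L A \<and> wf_fm L B"
| "wf_fm L (Imp A B) \<longleftrightarrow> wf_fm L A \<and> wf_fm L B"
| "wf_fm L (All \<rho> A) \<longleftrightarrow> wf_fm L A"
| "wf_fm L (Ex \<rho> A) \<longleftrightarrow> wf_fm L A"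
| "wf_fm L (BAll \<rho> t A) \<longleftrightarrow> has_type L t (Star \<rho>) \<and> wf_fm L A"
| "wf_fm L (BEx \<rho> t A) \<longleftrightarrow> has_type L t (Star \<rho>) \<and> wf_fm L A"

primrec ex_free :: "('f, 'r) fm \<Rightarrow> bool" where
  "ex_free Bot \<longleftrightarrow> True"
| "ex_free (Eq \<rho> t q) \<longleftrightarrow> True"
| "ex_free (In \<rho> t q) \<longleftrightarrow> True"
| "ex_free (Rel R ts) \<longleftrightarrow> True"
| "ex_free (Or A B) \<longleftrightarrow> ex_free A \<and> ex_free B"
| "ex_free (And A B) \<longleftrightarrow> ex_free A \<and> ex_free B"
| "ex_free (Imp A B) \<longleftrightarrow> ex_free A \<and> ex_free B"
| "ex_free (All \<rho> A) \<longleftrightarrow> ex_free A"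
| "ex_free (Ex \<rho> A) \<longleftrightarrow> False"
| "ex_free (BAll \<rho> t A) \<longleftrightarrow> ex_free A"
| "ex_free (BEx \<rho> t A) \<longleftrightarrow> ex_free A"


section \<open>Renaming, substitution and free variables\<close>

type_synonym ren = "ty \<Rightarrow> nat \<Rightarrow> nat"
type_synonym 'f sub = "ty \<Rightarrow> nat \<Rightarrow> 'f tm"

definition shift :: "ty \<Rightarrow> ren" where
  "shift \<rho> = (\<lambda>\<sigma> n. if \<sigma> = \<rho> then Suc n else n)"

definition up_ren :: "ty \<Rightarrow> ren \<Rightarrow> ren" where
  "up_ren \<rho> r = r(\<rho> := case_nat 0 (\<lambda>n. Suc (r \<rho> n)))"

primrec ren_tm :: "ren \<Rightarrow> 'f tm \<Rightarrow> 'f tm" where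
  "ren_tm r (Con c) = Con c"
| "ren_tm r (Var \<sigma> n) = Var \<sigma> (r \<sigma> n)"
| "ren_tm r (t \<cdot> q) = ren_tm r t \<cdot> ren_tm r q"

primrec ren_fm :: "ren \<Rightarrow> ('f, 'r) fm \<Rightarrow> ('f, 'r) fm" where
  "ren_fm r Bot = Bot"
| "ren_fm r (Eq \<rho> t q) = Eq \<rho> (ren_tm r t) (ren_tm r q)"
| "ren_fm r (In \<rho> t q) = In \<rho> (ren_tm r t) (ren_tm r q)"
| "ren_fm r (Rel R ts) = Rel R (map (ren_tm r) ts)"
| "ren_fm r (Or A B) = Or (ren_fm r A) (ren_fm r B)"
| "ren_fm r (And A B) = And (ren_fm r A) (ren_fm r B)"
| "ren_fm r (Imp A B) = Imp (ren_fm r A) (ren_fm r B)"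
| "ren_fm r (All \<rho> A) = All \<rho> (ren_fm (up_ren \<rho> r) A)"
| "ren_fm r (Ex \<rho> A) = Ex \<rho> (ren_fm (up_ren \<rho> r) A)"
| "ren_fm r (BAll \<rho> t A) = BAll \<rho> (ren_tm r t) (ren_fm (up_ren \<rho> r) A)"
| "ren_fm r (BEx \<rho> t A) = BEx \<rho> (ren_tm r t) (ren_fm (up_ren \<rho> r) A)"

abbreviation lift_tm :: "ty \<Rightarrow> 'f tm \<Rightarrow> 'f tm" where
  "lift_tm \<rho> \<equiv> ren_tm (shift \<rho>)"

abbreviation lift_fm :: "ty \<Rightarrow> ('f, 'r) fm \<Rightarrow> ('f, 'r) fm" where
  "lift_fm \<rho> \<equiv> ren_fm (shift \<rho>)"

definition up_sub :: "ty \<Rightarrow> 'f sub \<Rightarrow> 'f sub" where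
  "up_sub \<rho> s = (\<lambda>\<sigma> n. if \<sigma> = \<rho>
     then (case n of 0 \<Rightarrow> Var \<rho> 0 | Suc m \<Rightarrow> lift_tm \<rho> (s \<rho> m))
     else lift_tm \<rho> (s \<sigma> n))"

primrec sub_tm :: "'f sub \<Rightarrow> 'f tm \<Rightarrow> 'f tm" where
  "sub_tm s (Con c) = Con c"
| "sub_tm s (Var \<sigma> n) = s \<sigma> n"
| "sub_tm s (t \<cdot> q) = sub_tm s t \<cdot> sub_tm s q"

primrec sub_fm :: "'f sub \<Rightarrow> ('f, 'r) fm \<Rightarrow> ('f, 'r) fm" where
  "sub_fm s Bot = Bot"
| "sub_fm s (Eq \<rho> t q) = Eq \<rho> (sub_tm s t) (sub_tm s q)"
| "sub_fm s (In \<rho> t q) = In \<rho> (sub_tm s t) (sub_tm s q)"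
| "sub_fm s (Rel R ts) = Rel R (map (sub_tm s) ts)"
| "sub_fm s (Or A B) = Or (sub_fm s A) (sub_fm s B)"
| "sub_fm s (And A B) = And (sub_fm s A) (sub_fm s B)"
| "sub_fm s (Imp A B) = Imp (sub_fm s A) (sub_fm s B)"
| "sub_fm s (All \<rho> A) = All \<rho> (sub_fm (up_sub \<rho> s) A)"
| "sub_fm s (Ex \<rho> A) = Ex \<rho> (sub_fm (up_sub \<rho> s) A)"
| "sub_fm s (BAll \<rho> t A) = BAll \<rho> (sub_tm s t) (sub_fm (up_sub \<rho> s) A)"
| "sub_fm s (BEx \<rho> t A) = BEx \<rho> (sub_tm s t) (sub_fm (up_sub \<rho> s) A)"

text \<open>
  \<open>inst \<rho> t A\<close> is the body \<open>A\<close> of a quantifier over type \<open>\<rho>\<close> with the bound variable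
  replaced by \<open>t\<close>.
\<close>

definition inst :: "ty \<Rightarrow> 'f tm \<Rightarrow> ('f, 'r) fm \<Rightarrow> ('f, 'r) fm" where
  "inst \<rho> t = sub_fm (Var(\<rho> := case_nat t (Var \<rho>)))"

primrec fv_tm :: "'f tm \<Rightarrow> (ty \<times> nat) set" where
  "fv_tm (Con c) = {}"
| "fv_tm (Var \<sigma> n) = {(\<sigma>, n)}"
| "fv_tm (t \<cdot> q) = fv_tm t \<union> fv_tm q"

definition unbind :: "ty \<Rightarrow> (ty \<times> nat) set \<Rightarrow> (ty \<times> nat) set" where
  "unbind \<rho> V = {(\<sigma>, n). (\<sigma>, shift \<rho> \<sigma> n) \<in> V}"

primrec fv_fm :: "('f, 'r) fm \<Rightarrow> (ty \<times> nat) set" where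
  "fv_fm Bot = {}"
| "fv_fm (Eq \<rho> t q) = fv_tm t \<union> fv_tm q"
| "fv_fm (In \<rho> t q) = fv_tm t \<union> fv_tm q"
| "fv_fm (Rel R ts) = (\<Union>t\<in>set ts. fv_tm t)"
| "fv_fm (Or A B) = fv_fm A \<union> fv_fm B"
| "fv_fm (And A B) = fv_fm A \<union> fv_fm B"
| "fv_fm (Imp A B) = fv_fm A \<union> fv_fm B"
| "fv_fm (All \<rho> A) = unbind \<rho> (fv_fm A)"
| "fv_fm (Ex \<rho> A) = unbind \<rho> (fv_fm A)"
| "fv_fm (BAll \<rho> t A) = fv_tm t \<union> unbind \<rho> (fv_fm A)"
| "fv_fm (BEx \<rho> t A) = fv_tm t \<union> unbind \<rho> (fv_fm A)"


section \<open>The calculus\<close>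

text \<open>\<open>repl_fm x y A A'\<close>: \<open>A\<close> is atomic and \<open>A'\<close> results from it by replacing some \<open>x\<close> by \<open>y\<close>.\<close>

inductive repl_tm :: "'f tm \<Rightarrow> 'f tm \<Rightarrow> 'f tm \<Rightarrow> 'f tm \<Rightarrow> bool" for x y where
  keep: "repl_tm x y t t"
| here: "repl_tm x y x y"
| App: "repl_tm x y t t' \<Longrightarrow> repl_tm x y q q' \<Longrightarrow> repl_tm x y (t \<cdot> q) (t' \<cdot> q')"

inductive repl_fm :: "'f tm \<Rightarrow> 'f tm \<Rightarrow> ('f, 'r) fm \<Rightarrow> ('f, 'r) fm \<Rightarrow> bool" for x y where
  Bot: "repl_fm x y Bot Bot"
| Eq: "repl_tm x y t t' \<Longrightarrow> repl_tm x y q q' \<Longrightarrow> repl_fm x y (Eq \<rho> t q) (Eq \<rho> t' q')"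
| In: "repl_tm x y t t' \<Longrightarrow> repl_tm x y q q' \<Longrightarrow> repl_fm x y (In \<rho> t q) (In \<rho> t' q')"
| Rel: "list_all2 (repl_tm x y) ts ts' \<Longrightarrow> repl_fm x y (Rel R ts) (Rel R ts')"

inductive il_axiom :: "('f, 'r) language \<Rightarrow> ('f, 'r) fm \<Rightarrow> bool" for L where
  K: "il_axiom L (Imp A (Imp B A))"
| S: "il_axiom L (Imp (Imp A (Imp B C)) (Imp (Imp A B) (Imp A C)))"
| AndI: "il_axiom L (Imp A (Imp B (And A B)))"
| AndE1: "il_axiom L (Imp (And A B) A)"
| AndE2: "il_axiom L (Imp (And A B) B)"
| OrI1: "il_axiom L (Imp A (Or A B))"
| OrI2: "il_axiom L (Imp B (Or A B))"
| OrE: "il_axiom L (Imp (Imp A C) (Imp (Imp B C) (Imp (Or A B) C)))"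
| BotE: "il_axiom L (Imp Bot A)"
| AllE: "has_type L t \<rho> \<Longrightarrow> il_axiom L (Imp (All \<rho> A) (inst \<rho> t A))"
| ExI: "has_type L t \<rho> \<Longrightarrow> il_axiom L (Imp (inst \<rho> t A) (Ex \<rho> A))"
| eq_refl: "x = Var \<rho> i \<Longrightarrow> il_axiom L (Eq \<rho> x x)"
| eq_repl: "x = Var \<rho> i \<Longrightarrow> y = Var \<rho> j \<Longrightarrow> repl_fm x y A A' \<Longrightarrow>
    il_axiom L (Imp (And (Eq \<rho> x y) A) A')"
| BAll: "il_axiom L (Iff (BAll \<rho> t A) (All \<rho> (Imp (In \<rho> (Var \<rho> 0) (lift_tm \<rho> t)) A)))"
| BEx: "il_axiom L (Iff (BEx \<rho> t A) (Ex \<rho> (And (In \<rho> (Var \<rho> 0) (lift_tm \<rho> t)) A)))"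
| Sigma: "x = Var (\<rho> \<rightarrow>\<^sub>t \<sigma> \<rightarrow>\<^sub>t \<tau>) i \<Longrightarrow> y = Var (\<rho> \<rightarrow>\<^sub>t \<sigma>) j \<Longrightarrow> z = Var \<rho> k \<Longrightarrow>
    il_axiom L (Eq \<tau> (Con (CSigma \<rho> \<sigma> \<tau>) \<cdot> x \<cdot> y \<cdot> z) (x \<cdot> z \<cdot> (y \<cdot> z)))"
| Pi: "x = Var \<sigma> i \<Longrightarrow> y = Var \<tau> j \<Longrightarrow>
    il_axiom L (Eq \<sigma> (Con (CPi \<sigma> \<tau>) \<cdot> x \<cdot> y) x)"
| in_sing: "w = Var \<sigma> i \<Longrightarrow> x = Var \<sigma> j \<Longrightarrow>
    il_axiom L (Iff (In \<sigma> w (Con (CSing \<sigma>) \<cdot> x)) (Eq \<sigma> w x))"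
| in_un: "w = Var \<sigma> i \<Longrightarrow> x = Var (Star \<sigma>) j \<Longrightarrow> y = Var (Star \<sigma>) k \<Longrightarrow>
    il_axiom L (Iff (In \<sigma> w (Con (CUn \<sigma>) \<cdot> x \<cdot> y)) (Or (In \<sigma> w x) (In \<sigma> w y)))"
| in_bigun: "x = Var (Star \<sigma>) i \<Longrightarrow> y = Var (\<sigma> \<rightarrow>\<^sub>t Star \<tau>) j \<Longrightarrow> z = Var \<sigma> k \<Longrightarrow> w = Var \<tau> l \<Longrightarrow>
    il_axiom L (Imp (And (In \<sigma> z x) (In \<tau> w (y \<cdot> z))) (In \<tau> w (Con (CBigUn \<sigma> \<tau>) \<cdot> x \<cdot> y)))"
| bigun_sing: "x = Var \<sigma> i \<Longrightarrow> y = Var (\<sigma> \<rightarrow>\<^sub>t Star \<tau>) j \<Longrightarrow>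
    il_axiom L (Eq (Star \<tau>) (Con (CBigUn \<sigma> \<tau>) \<cdot> (Con (CSing \<sigma>) \<cdot> x) \<cdot> y) (y \<cdot> x))"
| bigun_un: "x = Var (Star \<sigma>) i \<Longrightarrow> y = Var (Star \<sigma>) j \<Longrightarrow> z = Var (\<sigma> \<rightarrow>\<^sub>t Star \<tau>) k \<Longrightarrow>
    il_axiom L (Eq (Star \<tau>)
      (Con (CBigUn \<sigma> \<tau>) \<cdot> (Con (CUn \<sigma>) \<cdot> x \<cdot> y) \<cdot> z)
      (Con (CUn \<tau>) \<cdot> (Con (CBigUn \<sigma> \<tau>) \<cdot> x \<cdot> z) \<cdot> (Con (CBigUn \<sigma> \<tau>) \<cdot> y \<cdot> z)))"

text \<open>
  \<open>provable L \<Delta> A\<close>: derivability of \<open>A\<close> when the formulas of \<open>\<Delta>\<close> are added as axioms. As usual for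
  the axioms of a theory, the free variables of members of \<open>\<Delta>\<close> may be generalized. In \<open>AllI\<close> and
  \<open>ExE\<close> the lifting of \<open>B\<close> expresses that the quantified variable is not free in \<open>B\<close>.
\<close>

inductive provable :: "('f, 'r) language \<Rightarrow> ('f, 'r) fm set \<Rightarrow> ('f, 'r) fm \<Rightarrow> bool" for L \<Delta> where
  logical: "il_axiom L A \<Longrightarrow> wf_fm L A \<Longrightarrow> provable L \<Delta> A"
| nonlogical: "A \<in> \<Delta> \<Longrightarrow> wf_fm L A \<Longrightarrow> provable L \<Delta> A"
| MP: "provable L \<Delta> (Imp A B) \<Longrightarrow> provable L \<Delta> A \<Longrightarrow> provable L \<Delta> B"
| AllI: "provable L \<Delta> (Imp (lift_fm \<rho> B) A) \<Longrightarrow> provable L \<Delta> (Imp B (All \<rho> A))"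
| ExE: "provable L \<Delta> (Imp A (lift_fm \<rho> B)) \<Longrightarrow> provable L \<Delta> (Imp (Ex \<rho> A) B)"

text \<open>
  In the two schemes below, the body \<open>A\<close> is moved under the new quantifier over \<open>f\<close>, respectively
  \<open>w\<close>; the renamings shift its parameters past that quantifier and fix the variables bound inside.
\<close>

definition AC :: "('f, 'r) fm set" where
  "AC = {Imp (All \<rho> (Ex \<sigma> A))
             (Ex (\<rho> \<rightarrow>\<^sub>t Star \<sigma>) (All \<rho>
               (BEx \<sigma> (lift_tm \<rho> (Var (\<rho> \<rightarrow>\<^sub>t Star \<sigma>) 0) \<cdot> Var \<rho> 0)
                 (ren_fm (up_ren \<sigma> (up_ren \<rho> (shift (\<rho> \<rightarrow>\<^sub>t Star \<sigma>)))) A))))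
         | \<rho> \<sigma> A. True}"

definition IP :: "('f, 'r) fm set" where
  "IP = {Imp (Imp B (Ex \<sigma> A))
             (Ex (Star \<sigma>) (Imp (lift_fm (Star \<sigma>) B)
               (BEx \<sigma> (Var (Star \<sigma>) 0) (ren_fm (up_ren \<sigma> (shift (Star \<sigma>))) A))))
         | B \<sigma> A. ex_free B}"


section \<open>Herbrandized modified realizability\<close>

primrec hr_types :: "('f, 'r) fm \<Rightarrow> ty list" where
  "hr_types Bot = []"
| "hr_types (Eq \<rho> t q) = []"
| "hr_types (In \<rho> t q) = []"
| "hr_types (Rel R ts) = []"
| "hr_types (Or A B) = hr_types A @ hr_types B"
| "hr_types (And A B) = hr_types A @ hr_types B"
| "hr_types (Imp A B) = map (arrs (hr_types A)) (hr_types B)"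
| "hr_types (All \<rho> A) = map (Arr \<rho>) (hr_types A)"
| "hr_types (Ex \<rho> A) = Star \<rho> # hr_types A"
| "hr_types (BAll \<rho> t A) = hr_types A"
| "hr_types (BEx \<rho> t A) = hr_types A"

text \<open>
  Blocks of quantifiers: under a block over \<open>\<rho>s\<close>, the block's own variables are \<open>block_vars \<rho>s\<close>,
  and anything from outside is lifted by \<open>lifts_tm \<rho>s\<close> or \<open>lifts_fm \<rho>s\<close>.
\<close>

abbreviation Alls :: "ty list \<Rightarrow> ('f, 'r) fm \<Rightarrow> ('f, 'r) fm" where
  "Alls \<rho>s A \<equiv> foldr All \<rho>s A"

abbreviation Exs :: "ty list \<Rightarrow> ('f, 'r) fm \<Rightarrow> ('f, 'r) fm" where
  "Exs \<rho>s A \<equiv> foldr Ex \<rho>s A"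

abbreviation lifts_tm :: "ty list \<Rightarrow> 'f tm \<Rightarrow> 'f tm" where
  "lifts_tm \<rho>s t \<equiv> fold lift_tm \<rho>s t"

abbreviation lifts_fm :: "ty list \<Rightarrow> ('f, 'r) fm \<Rightarrow> ('f, 'r) fm" where
  "lifts_fm \<rho>s A \<equiv> fold lift_fm \<rho>s A"

fun block_vars :: "ty list \<Rightarrow> 'f tm list" where
  "block_vars [] = []"
| "block_vars (\<rho> # \<rho>s) = lifts_tm \<rho>s (Var \<rho> 0) # block_vars \<rho>s"

primrec height :: "('f, 'r) fm \<Rightarrow> nat" where
  "height Bot = 0"
| "height (Eq \<rho> t q) = 0"
| "height (In \<rho> t q) = 0"
| "height (Rel R ts) = 0"
| "height (Or A B) = Suc (max (height A) (height B))"
| "height (And A B) = Suc (max (height A) (height B))"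
| "height (Imp A B) = Suc (max (height A) (height B))"
| "height (All \<rho> A) = Suc (height A)"
| "height (Ex \<rho> A) = Suc (height A)"
| "height (BAll \<rho> t A) = Suc (height A)"
| "height (BEx \<rho> t A) = Suc (height A)"

lemma height_ren_fm [simp]: "height (ren_fm r A) = height A"
  by (induction A arbitrary: r) auto

lemma height_lifts_fm [simp]: "height (lifts_fm \<rho>s A) = height A"
  by (induction \<rho>s arbitrary: A) auto

text \<open>
  \<open>hr_matrix A xs\<close> is the matrix $A_{HR}(\underline{x})$ taken at a tuple of terms \<open>xs\<close>, which has to
  be of types \<open>hr_types A\<close>; the tuple is lifted whenever it is moved under a quantifier.
\<close>

function hr_matrix :: "('f, 'r) fm \<Rightarrow> 'f tm list \<Rightarrow> ('f, 'r) fm" where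
  "hr_matrix Bot xs = Bot"
| "hr_matrix (Eq \<rho> t q) xs = Eq \<rho> t q"
| "hr_matrix (In \<rho> t q) xs = In \<rho> t q"
| "hr_matrix (Rel R ts) xs = Rel R ts"
| "hr_matrix (Or A B) xs =
     Or (hr_matrix A (take (length (hr_types A)) xs)) (hr_matrix B (drop (length (hr_types A)) xs))"
| "hr_matrix (And A B) xs =
     And (hr_matrix A (take (length (hr_types A)) xs)) (hr_matrix B (drop (length (hr_types A)) xs))"
| "hr_matrix (Imp A B) us =
     (let \<rho>s = hr_types A; xs = block_vars \<rho>s in
      Alls \<rho>s (Imp (hr_matrix (lifts_fm \<rho>s A) xs)
                   (hr_matrix (lifts_fm \<rho>s B) (map (\<lambda>u. apps (lifts_tm \<rho>s u) xs) us))))"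
| "hr_matrix (All \<rho> A) xs = All \<rho> (hr_matrix A (map (\<lambda>x. lift_tm \<rho> x \<cdot> Var \<rho> 0) xs))"
| "hr_matrix (Ex \<rho> A) xs = BEx \<rho> (hd xs) (hr_matrix A (map (lift_tm \<rho>) (tl xs)))"
| "hr_matrix (BAll \<rho> t A) xs = BAll \<rho> t (hr_matrix A (map (lift_tm \<rho>) xs))"
| "hr_matrix (BEx \<rho> t A) xs = BEx \<rho> t (hr_matrix A (map (lift_tm \<rho>) xs))"
  by pat_completeness auto
termination
  by (relation "measure (\<lambda>(A, xs). height A)") auto

definition HR :: "('f, 'r) fm \<Rightarrow> ('f, 'r) fm" where
  "HR A = Exs (hr_types A) (hr_matrix (lifts_fm (hr_types A) A) (block_vars (hr_types A)))"

lemma ex_free_Alls [simp]: "ex_free (Alls \<rho>s A) = ex_free A"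
  by (induction \<rho>s) auto

lemma ex_free_hr_matrix: "ex_free (hr_matrix A xs)"
  by (induction A xs rule: hr_matrix.induct) (simp_all add: Let_def)

lemma hr_types_ex_free: "ex_free A \<Longrightarrow> hr_types A = []"
  by (induction A) auto

lemma hr_matrix_ex_free: "ex_free A \<Longrightarrow> hr_matrix A [] = A"
  by (induction A) (auto simp: hr_types_ex_free)

lemma has_type_ren_tm: "has_type L t \<tau> \<Longrightarrow> has_type L (ren_tm r t) \<tau>"
  by (induction rule: has_type.induct) (auto intro: has_type.intros)

lemma wf_fm_ren_fm: "wf_fm L A \<Longrightarrow> wf_fm L (ren_fm r A)"
  by (induction A arbitrary: r) (auto intro: has_type_ren_tm)

lemma hr_types_ren_fm [simp]: "hr_types (ren_fm r A) = hr_types A"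
  by (induction A arbitrary: r) auto

lemma hr_types_lifts_fm [simp]: "hr_types (lifts_fm \<rho>s A) = hr_types A"
  by (induction \<rho>s arbitrary: A) auto

lemma has_type_lifts_tm: "has_type L t \<tau> \<Longrightarrow> has_type L (lifts_tm \<rho>s t) \<tau>"
  by (induction \<rho>s arbitrary: t) (auto intro: has_type_ren_tm)

lemma wf_fm_lifts_fm: "wf_fm L A \<Longrightarrow> wf_fm L (lifts_fm \<rho>s A)"
  by (induction \<rho>s arbitrary: A) (auto intro: wf_fm_ren_fm)

lemma wf_fm_Alls [simp]: "wf_fm L (Alls \<rho>s A) = wf_fm L A"
  by (induction \<rho>s) auto

lemma has_type_block_vars: "list_all2 (has_type L) (block_vars \<rho>s) \<rho>s"
  by (induction \<rho>s) (auto intro: has_type_lifts_tm has_type.Var)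

lemma has_type_apps:
  "has_type L t (arrs \<rho>s \<tau>) \<Longrightarrow> list_all2 (has_type L) qs \<rho>s \<Longrightarrow> has_type L (apps t qs) \<tau>"
  unfolding apps_def
proof (induction \<rho>s arbitrary: t qs)
  case (Cons \<rho> \<rho>s)
  from Cons.prems(2) obtain q qs' where qs: "qs = q # qs'" "has_type L q \<rho>"
    "list_all2 (has_type L) qs' \<rho>s"
    by (auto simp: list_all2_Cons2)
  from Cons.prems(1) qs(2) have "has_type L (t \<cdot> q) (arrs \<rho>s \<tau>)"
    by (auto intro: has_type.App)
  with Cons.IH qs show ?case
    by simp
qed simp

lemma has_type_map_ren_tm:
  "list_all2 (has_type L) ts \<tau>s \<Longrightarrow> list_all2 (has_type L) (map (ren_tm r) ts) \<tau>s"
  by (auto simp: list_all2_conv_all_nth intro: has_type_ren_tm)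

lemma wf_fm_hr_matrix:
  "wf_fm L A \<Longrightarrow> list_all2 (has_type L) xs (hr_types A) \<Longrightarrow> wf_fm L (hr_matrix A xs)"
proof (induction A xs rule: hr_matrix.induct)
  case (7 A B us)
  let ?\<rho>s = "hr_types A"
  have "list_all2 (has_type L) (map (\<lambda>u. apps (lifts_tm ?\<rho>s u) (block_vars ?\<rho>s)) us) (hr_types B)"
    using 7(4)
    by (auto simp: list_all2_conv_all_nth
        intro!: has_type_apps[OF has_type_lifts_tm has_type_block_vars])
  then show ?case
    using 7 by (auto simp: Let_def wf_fm_lifts_fm has_type_block_vars)
next
  case (8 \<rho> A xs)
  have "list_all2 (has_type L) (map (\<lambda>x. lift_tm \<rho> x \<cdot> Var \<rho> 0) xs) (hr_types A)"
    using 8(3)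
    by (auto simp: list_all2_conv_all_nth
        intro!: has_type.App[OF has_type_ren_tm has_type.Var])
  with 8 show ?case
    by simp
next
  case (9 \<rho> A xs)
  then show ?case
    by (auto simp: list_all2_Cons2 has_type_map_ren_tm)
qed (auto simp: list_all2_append2 list_all2_lengthD has_type_map_ren_tm)

end

theory Submission
  imports Defs
begin

text \<open>
  Every realizer has a type ending in some \<open>\<sigma>\<^sup>*\<close>, so realizers are ordered by pointwise inclusion,
  and the matrix $A_{HR}(\underline{x})$ is monotone in $\underline{x}$ for this order. Pointwise unions,
  available as closed combinators built from \<open>\<union>\<close> and \<open>\<Union>\<close>, therefore merge the realizers coming from
  the two branches of a disjunction elimination, or from all the elements of a bounding set in the
  elimination of \<open>\<exists>z\<close> and in the introduction of \<open>\<forall>z\<in>t\<close>.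

  Say that \<open>A\<close> is valid in a context \<open>\<Gamma>\<close> if \<open>\<Gamma>\<close> derives $A_{HR}(\underline{t})$ for some terms
  $\underline{t}$. With contexts as worlds and typed substitutions as the accessibility relation, validity
  satisfies the Kripke clauses for \<open>\<and>\<close>, \<open>\<rightarrow>\<close> and \<open>\<forall>\<close>: a realizer of an implication is obtained by
  abstracting over the variables of a generic realizer of the premise. This makes the soundness of
  intuitionistic logic routine. Both \<open>AC\<close> and \<open>IP\<close> hold because the realizers of premise and conclusion
  agree except that the witness \<open>Z\<close> becomes the singleton \<open>{Z}\<close>. At the end, variables that are not
  free in \<open>A\<close> are replaced by closed terms and the others are abstracted.
\<close>

section \<open>Substitution calculus\<close>

text \<open>Generalizes \<open>inst\<close>, which is the case \<open>s = Var\<close>. Passing below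
  a quantifier with \<open>up_sub\<close> and then instantiating it becomes a single substitution of
  this form, see \<open>inst_up_sub\<close>.\<close>

definition sub_cons :: "ty \<Rightarrow> 'f tm \<Rightarrow> 'f sub \<Rightarrow> 'f sub" where
  "sub_cons \<rho> t s = s(\<rho> := case_nat t (s \<rho>))"

definition shift_sub :: "ty \<Rightarrow> 'f sub" where
  "shift_sub \<rho> = (\<lambda>\<sigma> n. Var \<sigma> (shift \<rho> \<sigma> n))"

lemma inst_eq_sub_cons: "inst \<rho> t = sub_fm (sub_cons \<rho> t Var)"
  by (simp add: inst_def sub_cons_def)

lemma up_ren_simps [simp]:
  "up_ren \<rho> r \<rho> 0 = 0"
  "up_ren \<rho> r \<sigma> (shift \<rho> \<sigma> n) = shift \<rho> \<sigma> (r \<sigma> n)"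
  by (auto simp: up_ren_def shift_def)

lemma up_sub_simps [simp]:
  "up_sub \<rho> s \<rho> 0 = Var \<rho> 0"
  "up_sub \<rho> s \<sigma> (shift \<rho> \<sigma> n) = lift_tm \<rho> (s \<sigma> n)"
  by (auto simp: up_sub_def shift_def)

lemma sub_cons_simps [simp]:
  "sub_cons \<rho> t s \<rho> 0 = t"
  "sub_cons \<rho> t s \<sigma> (shift \<rho> \<sigma> n) = s \<sigma> n"
  by (auto simp: sub_cons_def shift_def)

lemma shift_cases:
  obtains "\<sigma> = \<rho>" "n = 0" | m where "n = shift \<rho> \<sigma> m"
  by (cases "\<sigma> = \<rho>"; cases n) (auto simp: shift_def)

text \<open>Below a binder each variable is either the bound one or a shifted one. Comparing maps on
  these two kinds lets the rewrite rules for \<open>up_ren\<close>, \<open>up_sub\<close> and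
  \<open>sub_cons\<close> replace case distinctions on types and indices.\<close>

lemma shift_ext:
  assumes "f \<rho> 0 = g \<rho> 0" and "\<And>\<sigma> n. f \<sigma> (shift \<rho> \<sigma> n) = g \<sigma> (shift \<rho> \<sigma> n)"
  shows "f = g"
proof (intro ext)
  fix \<sigma> n
  show "f \<sigma> n = g \<sigma> n"
    using assms by (cases \<sigma> \<rho> n rule: shift_cases) auto
qed

lemma ren_tm_eq_sub: "ren_tm r t = sub_tm (\<lambda>\<sigma> n. Var \<sigma> (r \<sigma> n)) t"
  by (induction t) auto

lemma up_sub_ren: "up_sub \<rho> (\<lambda>\<sigma> n. Var \<sigma> (r \<sigma> n)) = (\<lambda>\<sigma> n. Var \<sigma> (up_ren \<rho> r \<sigma> n))"
  by (rule shift_ext[of _ \<rho>]) auto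

text \<open>Lets liftings be treated as substitutions, so that the composition law
  \<open>sub_fm_sub_fm\<close> and preservation of derivability cover them too.\<close>

lemma ren_fm_eq_sub: "ren_fm r A = sub_fm (\<lambda>\<sigma> n. Var \<sigma> (r \<sigma> n)) A"
  by (induction A arbitrary: r) (auto simp: ren_tm_eq_sub up_sub_ren)

lemma lift_tm_eq_sub: "lift_tm \<rho> t = sub_tm (shift_sub \<rho>) t"
  by (simp add: ren_tm_eq_sub shift_sub_def)

lemma lift_fm_eq_sub: "lift_fm \<rho> A = sub_fm (shift_sub \<rho>) A"
  by (simp add: ren_fm_eq_sub shift_sub_def)

lemma sub_tm_ren_tm: "sub_tm s (ren_tm r t) = sub_tm (\<lambda>\<sigma> n. s \<sigma> (r \<sigma> n)) t"
  by (induction t) auto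

lemma up_sub_up_ren: "(\<lambda>\<sigma> n. up_sub \<rho> s \<sigma> (up_ren \<rho> r \<sigma> n)) = up_sub \<rho> (\<lambda>\<sigma> n. s \<sigma> (r \<sigma> n))"
  by (rule shift_ext[of _ \<rho>]) auto

lemma sub_fm_ren_fm: "sub_fm s (ren_fm r A) = sub_fm (\<lambda>\<sigma> n. s \<sigma> (r \<sigma> n)) A"
  by (induction A arbitrary: r s) (auto simp: sub_tm_ren_tm up_sub_up_ren)

lemma sub_tm_sub_tm: "sub_tm s (sub_tm s' t) = sub_tm (\<lambda>\<sigma> n. sub_tm s (s' \<sigma> n)) t"
  by (induction t) auto

lemma sub_tm_up_lift: "sub_tm (up_sub \<rho> s) (lift_tm \<rho> t) = lift_tm \<rho> (sub_tm s t)"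
  by (induction t) auto

lemma up_sub_comp:
  "(\<lambda>\<sigma> n. sub_tm (up_sub \<rho> s) (up_sub \<rho> s' \<sigma> n)) = up_sub \<rho> (\<lambda>\<sigma> n. sub_tm s (s' \<sigma> n))"
  by (rule shift_ext[of _ \<rho>]) (auto simp: sub_tm_up_lift)

lemma sub_fm_sub_fm: "sub_fm s (sub_fm s' A) = sub_fm (\<lambda>\<sigma> n. sub_tm s (s' \<sigma> n)) A"
  by (induction A arbitrary: s s') (auto simp: sub_tm_sub_tm up_sub_comp)

lemma sub_tm_Var [simp]: "sub_tm Var t = t"
  by (induction t) auto

lemma up_sub_Var [simp]: "up_sub \<rho> Var = Var"
  by (rule shift_ext[of _ \<rho>]) auto

lemma sub_fm_Var [simp]: "sub_fm Var A = A"
  by (induction A) (auto simp: map_idI)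

lemma sub_fm_up_lift: "sub_fm (up_sub \<rho> s) (lift_fm \<rho> A) = lift_fm \<rho> (sub_fm s A)"
  by (simp add: sub_fm_ren_fm lift_fm_eq_sub[of \<rho> "sub_fm s A"] sub_fm_sub_fm lift_tm_eq_sub)

lemma sub_tm_cons_lift [simp]: "sub_tm (sub_cons \<rho> t s) (lift_tm \<rho> u) = sub_tm s u"
  by (simp add: sub_tm_ren_tm)

lemma sub_fm_cons_lift [simp]: "sub_fm (sub_cons \<rho> t s) (lift_fm \<rho> A) = sub_fm s A"
  by (simp add: sub_fm_ren_fm)

lemma sub_cons_up:
  "(\<lambda>\<sigma> n. sub_tm (sub_cons \<rho> t s') (up_sub \<rho> s \<sigma> n)) = sub_cons \<rho> t (\<lambda>\<sigma> n. sub_tm s' (s \<sigma> n))"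
  by (rule shift_ext[of _ \<rho>]) auto

lemma inst_up_sub: "inst \<rho> t (sub_fm (up_sub \<rho> s) A) = sub_fm (sub_cons \<rho> t s) A"
  by (simp add: inst_eq_sub_cons sub_fm_sub_fm sub_cons_up)

lemma sub_inst: "sub_fm s (inst \<rho> t A) = sub_fm (sub_cons \<rho> (sub_tm s t) s) A"
proof -
  have "(\<lambda>\<sigma> n. sub_tm s (sub_cons \<rho> t Var \<sigma> n)) = sub_cons \<rho> (sub_tm s t) s"
    by (rule shift_ext[of _ \<rho>]) auto
  then show ?thesis
    by (simp add: inst_eq_sub_cons sub_fm_sub_fm)
qed

lemma sub_inst_up: "sub_fm s (inst \<rho> t A) = inst \<rho> (sub_tm s t) (sub_fm (up_sub \<rho> s) A)"
  by (simp add: sub_inst inst_up_sub)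

lemma sub_cons_shift_Var [simp]: "sub_cons \<rho> (Var \<rho> 0) (shift_sub \<rho>) = Var"
  by (rule shift_ext[of _ \<rho>]) (auto simp: shift_sub_def)

text \<open>Used to strip a lifted quantifier: the bound variable 0 is the generic element at which
  it is instantiated, which gives back the original body.\<close>

lemma inst_Var_up_lift [simp]: "inst \<rho> (Var \<rho> 0) (ren_fm (up_ren \<rho> (shift \<rho>)) A) = A"
proof -
  have "ren_fm (up_ren \<rho> (shift \<rho>)) A = sub_fm (up_sub \<rho> (shift_sub \<rho>)) A"
    by (simp add: ren_fm_eq_sub shift_sub_def up_sub_ren)
  then show ?thesis
    by (simp add: inst_up_sub)
qed

section \<open>Dependence of substitution on the free variables, and their finiteness\<close>

lemma sub_tm_cong:
  "(\<And>\<sigma> n. (\<sigma>, n) \<in> fv_tm t \<Longrightarrow> s \<sigma> n = s' \<sigma> n) \<Longrightarrow> sub_tm s t = sub_tm s' t"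
  by (induction t) auto

lemma up_sub_cong:
  assumes "\<And>\<sigma> n. (\<sigma>, n) \<in> unbind \<rho> V \<Longrightarrow> s \<sigma> n = s' \<sigma> n" and "(\<sigma>, n) \<in> V"
  shows "up_sub \<rho> s \<sigma> n = up_sub \<rho> s' \<sigma> n"
  using assms by (cases \<sigma> \<rho> n rule: shift_cases) (auto simp: unbind_def)

lemma sub_fm_cong:
  "(\<And>\<sigma> n. (\<sigma>, n) \<in> fv_fm A \<Longrightarrow> s \<sigma> n = s' \<sigma> n) \<Longrightarrow> sub_fm s A = sub_fm s' A"
proof (induction A arbitrary: s s')
  case (All \<rho> A)
  have "sub_fm (up_sub \<rho> s) A = sub_fm (up_sub \<rho> s') A"
    by (rule All.IH, rule up_sub_cong[of \<rho> "fv_fm A"]) (use All.prems in auto)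
  then show ?case using All.prems by simp
next
  case (Ex \<rho> A)
  have "sub_fm (up_sub \<rho> s) A = sub_fm (up_sub \<rho> s') A"
    by (rule Ex.IH, rule up_sub_cong[of \<rho> "fv_fm A"]) (use Ex.prems in auto)
  then show ?case using Ex.prems by simp
next
  case (BAll \<rho> t A)
  have "sub_fm (up_sub \<rho> s) A = sub_fm (up_sub \<rho> s') A"
    by (rule BAll.IH, rule up_sub_cong[of \<rho> "fv_fm A"]) (use BAll.prems in auto)
  then show ?case using BAll.prems by (auto intro: sub_tm_cong)
next
  case (BEx \<rho> t A)
  have "sub_fm (up_sub \<rho> s) A = sub_fm (up_sub \<rho> s') A"
    by (rule BEx.IH, rule up_sub_cong[of \<rho> "fv_fm A"]) (use BEx.prems in auto)
  then show ?case using BEx.prems by (auto intro: sub_tm_cong)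
next
  case (Eq \<rho> t q)
  then show ?case by (auto intro: sub_tm_cong)
next
  case (In \<rho> t q)
  then show ?case by (auto intro: sub_tm_cong)
next
  case (Rel R ts)
  then show ?case by (auto intro: sub_tm_cong)
next
  case (Or A B)
  then show ?case by (metis fv_fm.simps(5) UnCI sub_fm.simps(5))
next
  case (And A B)
  then show ?case by (metis fv_fm.simps(6) UnCI sub_fm.simps(6))
next
  case (Imp A B)
  then show ?case by (metis fv_fm.simps(7) UnCI sub_fm.simps(7))
qed auto

lemma finite_fv_tm: "finite (fv_tm t)"
  by (induction t) auto

lemma finite_unbind:
  assumes "finite V" shows "finite (unbind \<rho> V)"
proof (rule finite_subset)
  \<comment> \<open>Decrementing undoes the shift. The entry of type \<open>\<rho>\<close> with
    index 0, which \<open>unbind\<close> drops, can only enlarge the image.\<close>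
  show "unbind \<rho> V \<subseteq> (\<lambda>(\<sigma>, n). (\<sigma>, if \<sigma> = \<rho> then n - 1 else n)) ` V"
    by (force simp: unbind_def shift_def image_iff split: if_splits)
qed (use assms in simp)

lemma finite_fv_fm: "finite (fv_fm A)"
  by (induction A) (auto simp: finite_fv_tm finite_unbind)

lemma sub_tm_closed: "fv_tm t = {} \<Longrightarrow> sub_tm s t = t"
  using sub_tm_cong[of t s Var] by simp

lemma fv_sub_tm: "fv_tm (sub_tm s t) = (\<Union>(\<sigma>, n)\<in>fv_tm t. fv_tm (s \<sigma> n))"
  by (induction t) auto

lemma ex_lift_tm:
  assumes "(\<rho>, 0) \<notin> fv_tm t"
  obtains u where "t = lift_tm \<rho> u"
proof -
  \<comment> \<open>Decrementing and shifting back moves only index 0 of type \<open>\<rho>\<close>,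
    which is excluded by assumption.\<close>
  have "sub_tm (\<lambda>\<sigma> n. Var \<sigma> (shift \<rho> \<sigma> (if \<sigma> = \<rho> then n - 1 else n))) t = sub_tm Var t"
    using assms by (intro sub_tm_cong) (auto simp: shift_def Suc_pred gr0_conv_Suc intro!: Suc_pred gr0I)
  then have "t = lift_tm \<rho> (sub_tm (\<lambda>\<sigma> n. Var \<sigma> (if \<sigma> = \<rho> then n - 1 else n)) t)"
    by (simp add: lift_tm_eq_sub sub_tm_sub_tm shift_sub_def)
  then show thesis ..
qed

lemma sub_tm_apps [simp]: "sub_tm s (apps t qs) = apps (sub_tm s t) (map (sub_tm s) qs)"
  unfolding apps_def by (induction qs arbitrary: t) auto

lemma apps_Nil [simp]: "apps t [] = t"
  and apps_Cons [simp]: "apps t (q # qs) = apps (t \<cdot> q) qs"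
  by (simp_all add: apps_def)

subsection \<open>Blocks of quantifiers\<close>

definition lifts_sub :: "ty list \<Rightarrow> 'f sub" where
  "lifts_sub \<rho>s = (\<lambda>\<sigma> n. lifts_tm \<rho>s (Var \<sigma> n))"

lemma lifts_tm_eq_sub: "lifts_tm \<rho>s t = sub_tm (lifts_sub \<rho>s) t"
proof (induction \<rho>s arbitrary: t)
  case (Cons \<rho> \<rho>s)
  show ?case
    unfolding fold_Cons o_def
    by (subst Cons.IH) (simp add: sub_tm_ren_tm lifts_sub_def)
qed (simp add: lifts_sub_def)

lemma lifts_sub_Cons: "lifts_sub (\<rho> # \<rho>s) = (\<lambda>\<sigma> n. sub_tm (lifts_sub \<rho>s) (shift_sub \<rho> \<sigma> n))"
  by (simp add: lifts_sub_def shift_sub_def)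

lemma lifts_fm_eq_sub: "lifts_fm \<rho>s A = sub_fm (lifts_sub \<rho>s) A"
proof (induction \<rho>s arbitrary: A)
  case (Cons \<rho> \<rho>s)
  then show ?case
    by (simp add: lift_fm_eq_sub sub_fm_sub_fm lifts_sub_Cons)
qed (simp add: lifts_sub_def)

abbreviation up_subs :: "ty list \<Rightarrow> 'f sub \<Rightarrow> 'f sub" where
  "up_subs \<equiv> fold up_sub"

lemma sub_fm_Alls: "sub_fm s (Alls \<rho>s A) = Alls \<rho>s (sub_fm (up_subs \<rho>s s) A)"
  by (induction \<rho>s arbitrary: s) auto

lemma sub_tm_ups_lifts: "sub_tm (up_subs \<rho>s s) (lifts_tm \<rho>s t) = lifts_tm \<rho>s (sub_tm s t)"
  by (induction \<rho>s arbitrary: s t) (auto simp: sub_tm_up_lift)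

lemma sub_fm_ups_lifts: "sub_fm (up_subs \<rho>s s) (lifts_fm \<rho>s A) = lifts_fm \<rho>s (sub_fm s A)"
  by (induction \<rho>s arbitrary: s A) (auto simp: sub_fm_up_lift)

lemma sub_block_vars: "map (sub_tm (up_subs \<rho>s s)) (block_vars \<rho>s) = block_vars \<rho>s"
  by (induction \<rho>s arbitrary: s) (auto simp: sub_tm_ups_lifts)

text \<open>Simultaneous instantiation of a block, from the outermost quantifier inwards, so that
  later entries push earlier ones of the same type to higher indices. If the lengths differ, the
  excess is ignored.\<close>

fun sub_conss :: "ty list \<Rightarrow> 'f tm list \<Rightarrow> 'f sub \<Rightarrow> 'f sub" where
  "sub_conss (\<rho> # \<rho>s) (t # ts) s = sub_conss \<rho>s ts (sub_cons \<rho> t s)"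
| "sub_conss _ _ s = s"

lemma sub_tm_conss_lifts:
  "length ts = length \<rho>s \<Longrightarrow> sub_tm (sub_conss \<rho>s ts s) (lifts_tm \<rho>s t) = sub_tm s t"
  by (induction \<rho>s ts arbitrary: s t rule: list_induct2') auto

lemma sub_fm_conss_lifts:
  "length ts = length \<rho>s \<Longrightarrow> sub_fm (sub_conss \<rho>s ts s) (lifts_fm \<rho>s A) = sub_fm s A"
  by (induction \<rho>s ts arbitrary: s A rule: list_induct2') auto

lemma sub_conss_block_vars:
  "length ts = length \<rho>s \<Longrightarrow> map (sub_tm (sub_conss \<rho>s ts s)) (block_vars \<rho>s) = ts"
  by (induction \<rho>s ts arbitrary: s rule: list_induct2') (auto simp: sub_tm_conss_lifts)

lemma length_block_vars [simp]: "length (block_vars \<rho>s) = length \<rho>s"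
  by (induction \<rho>s) auto


subsection \<open>The realizability matrix\<close>

lemma hr_types_sub_fm [simp]: "hr_types (sub_fm s A) = hr_types A"
  by (induction A arbitrary: s) auto

text \<open>Holds because the tuple is lifted exactly where the formula passes below a binder. The
  length hypothesis guarantees that \<open>hd\<close> in the \<open>Ex\<close> clause is taken of a
  nonempty list.\<close>

lemma hr_matrix_sub_fm:
  "length xs = length (hr_types A) \<Longrightarrow>
   sub_fm s (hr_matrix A xs) = hr_matrix (sub_fm s A) (map (sub_tm s) xs)"
proof (induction A xs arbitrary: s rule: hr_matrix.induct)
  case (7 A B us)
  let ?\<rho>s = "hr_types A"
  have 1: "sub_fm s' (hr_matrix (lifts_fm ?\<rho>s A) (block_vars ?\<rho>s)) =
      hr_matrix (sub_fm s' (lifts_fm ?\<rho>s A)) (map (sub_tm s') (block_vars ?\<rho>s))" for s'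
    using 7 by simp
  have 2: "sub_fm s' (hr_matrix (lifts_fm ?\<rho>s B)
        (map (\<lambda>u. apps (lifts_tm ?\<rho>s u) (block_vars ?\<rho>s)) us)) =
      hr_matrix (sub_fm s' (lifts_fm ?\<rho>s B))
        (map (sub_tm s') (map (\<lambda>u. apps (lifts_tm ?\<rho>s u) (block_vars ?\<rho>s)) us))" for s'
    using 7 by simp
  show ?case
    by (simp add: Let_def sub_fm_Alls 1 2 sub_fm_ups_lifts sub_block_vars sub_tm_ups_lifts o_def)
next
  case (9 \<rho> A xs)
  then show ?case
    by (cases xs) (auto simp: o_def sub_tm_up_lift)
qed (auto simp: o_def sub_tm_up_lift take_map drop_map)

section \<open>Derivability from a list of hypotheses\<close>

inductive_cases has_type_ConE: "has_type L (Con c) \<tau>"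
inductive_cases has_type_VarE: "has_type L (Var \<sigma> n) \<tau>"
inductive_cases has_type_AppE: "has_type L (t \<cdot> q) \<tau>"

lemma has_type_ren_tmD: "has_type L (ren_tm r t) \<tau> \<Longrightarrow> has_type L t \<tau>"
  by (induction t arbitrary: \<tau>)
    (auto elim!: has_type_ConE has_type_VarE has_type_AppE intro: has_type.intros)

lemma wf_fm_ren_fmD: "wf_fm L (ren_fm r A) \<Longrightarrow> wf_fm L A"
  by (induction A arbitrary: r) (auto intro: has_type_ren_tmD)

lemma provable_wf: "provable L \<Delta> A \<Longrightarrow> wf_fm L A"
  by (induction rule: provable.induct) (auto intro: wf_fm_ren_fmD)

definition typed_sub :: "('f, 'r) language \<Rightarrow> 'f sub \<Rightarrow> bool" where
  "typed_sub L s \<longleftrightarrow> (\<forall>\<sigma> n. has_type L (s \<sigma> n) \<sigma>)"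

lemma typed_subD: "typed_sub L s \<Longrightarrow> has_type L (s \<sigma> n) \<sigma>"
  by (simp add: typed_sub_def)

lemma typed_sub_Var [simp]: "typed_sub L Var"
  by (simp add: typed_sub_def has_type.Var)

lemma typed_sub_shift [simp]: "typed_sub L (shift_sub \<rho>)"
  by (simp add: typed_sub_def shift_sub_def has_type.Var)

lemma typed_sub_lifts [simp]: "typed_sub L (lifts_sub \<rho>s)"
  by (simp add: typed_sub_def lifts_sub_def has_type_lifts_tm has_type.Var)

lemma typed_sub_up: "typed_sub L s \<Longrightarrow> typed_sub L (up_sub \<rho> s)"
  by (auto simp: typed_sub_def up_sub_def intro: has_type.Var has_type_ren_tm split: nat.split)

lemma typed_sub_cons: "typed_sub L s \<Longrightarrow> has_type L t \<rho> \<Longrightarrow> typed_sub L (sub_cons \<rho> t s)"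
  by (auto simp: typed_sub_def sub_cons_def split: nat.split)

lemma has_type_sub_tm: "has_type L t \<tau> \<Longrightarrow> typed_sub L s \<Longrightarrow> has_type L (sub_tm s t) \<tau>"
  by (induction rule: has_type.induct) (auto intro: has_type.intros typed_subD)

lemma typed_sub_comp:
  "typed_sub L s \<Longrightarrow> typed_sub L s' \<Longrightarrow> typed_sub L (\<lambda>\<sigma> n. sub_tm s' (s \<sigma> n))"
  unfolding typed_sub_def using has_type_sub_tm typed_sub_def by blast

lemma wf_fm_sub_fm: "wf_fm L A \<Longrightarrow> typed_sub L s \<Longrightarrow> wf_fm L (sub_fm s A)"
  by (induction A arbitrary: s) (auto intro: has_type_sub_tm typed_sub_up)

lemma wf_fm_inst: "wf_fm L A \<Longrightarrow> has_type L t \<rho> \<Longrightarrow> wf_fm L (inst \<rho> t A)"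
  by (simp add: inst_eq_sub_cons wf_fm_sub_fm typed_sub_cons)

locale theory_ctxt =
  fixes L :: "('f, 'r) language" and T :: "('f, 'r) fm set"
begin

abbreviation "typ \<equiv> has_type L"
abbreviation "prov \<equiv> provable L T"

text \<open>Hypotheses are encoded as nested implications, so the deduction theorem holds by
  definition. Unlike the axioms in \<open>T\<close>, hypotheses have variables that are fixed and
  must be lifted below a quantifier.\<close>

fun ent :: "('f, 'r) fm list \<Rightarrow> ('f, 'r) fm \<Rightarrow> bool" where
  "ent [] B = prov B"
| "ent (A # \<Gamma>) B = ent \<Gamma> (Imp A B)"

abbreviation wfs :: "('f, 'r) fm list \<Rightarrow> bool" where
  "wfs \<Gamma> \<equiv> (\<forall>A\<in>set \<Gamma>. wf_fm L A)"

lemma ent_wf: "ent \<Gamma> B \<Longrightarrow> wfs \<Gamma> \<and> wf_fm L B"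
  by (induction \<Gamma> arbitrary: B) (fastforce dest: provable_wf)+

lemma prov_K: "wf_fm L A \<Longrightarrow> prov B \<Longrightarrow> prov (Imp A B)"
  by (rule provable.MP[OF provable.logical[OF il_axiom.K]]) (auto dest: provable_wf)

lemma ent_prov: "prov B \<Longrightarrow> wfs \<Gamma> \<Longrightarrow> ent \<Gamma> B"
  by (induction \<Gamma> arbitrary: B) (auto intro: prov_K)

lemma ent_axiom: "il_axiom L B \<Longrightarrow> wf_fm L B \<Longrightarrow> wfs \<Gamma> \<Longrightarrow> ent \<Gamma> B"
  by (intro ent_prov provable.logical)

text \<open>The axiom \<open>S\<close> carries modus ponens past one hypothesis at a time.\<close>

lemma ent_MP: "ent \<Gamma> (Imp A B) \<Longrightarrow> ent \<Gamma> A \<Longrightarrow> ent \<Gamma> B"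
proof (induction \<Gamma> arbitrary: A B)
  case (Cons C \<Gamma>)
  from Cons.prems have "ent \<Gamma> (Imp C (Imp A B))" "ent \<Gamma> (Imp C A)" by auto
  moreover from this have "ent \<Gamma> (Imp (Imp C (Imp A B)) (Imp (Imp C A) (Imp C B)))"
    by (intro ent_axiom il_axiom.S) (auto dest: ent_wf)
  ultimately show ?case
    using Cons.IH by auto
qed (auto intro: provable.MP)

lemma ent_K: "ent \<Gamma> B \<Longrightarrow> wf_fm L A \<Longrightarrow> ent \<Gamma> (Imp A B)"
  by (rule ent_MP[OF ent_axiom[OF il_axiom.K]]) (auto dest: ent_wf)

lemma ent_assm: "wfs \<Gamma> \<Longrightarrow> A \<in> set \<Gamma> \<Longrightarrow> ent \<Gamma> A"
proof (induction \<Gamma>)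
  case (Cons C \<Gamma>)
  have "ent \<Gamma> (Imp C C)" if "wf_fm L C" "wfs \<Gamma>"
  proof -
    \<comment> \<open>The usual derivation of \<open>Imp C C\<close> from one instance of
      \<open>S\<close> and two of \<open>K\<close>.\<close>
    have "ent \<Gamma> (Imp (Imp C (Imp (Imp C C) C)) (Imp (Imp C (Imp C C)) (Imp C C)))"
      using that by (intro ent_axiom il_axiom.S) auto
    moreover have "ent \<Gamma> (Imp C (Imp (Imp C C) C))" "ent \<Gamma> (Imp C (Imp C C))"
      using that by (auto intro!: ent_axiom il_axiom.K)
    ultimately show ?thesis
      by (blast intro: ent_MP)
  qed
  with Cons show ?case
    by (auto intro: ent_K)
qed simp

text \<open>Includes exchange and contraction, as only the sets are compared: each old hypothesis is
  discharged into an implication and then supplied from the new list.\<close>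

lemma ent_weaken: "ent \<Gamma> B \<Longrightarrow> set \<Gamma> \<subseteq> set \<Gamma>' \<Longrightarrow> wfs \<Gamma>' \<Longrightarrow> ent \<Gamma>' B"
proof (induction \<Gamma> arbitrary: B)
  case (Cons A \<Gamma>)
  then have "ent \<Gamma>' (Imp A B)" "ent \<Gamma>' A" by (auto intro: ent_assm)
  then show ?case by (rule ent_MP)
qed (auto intro: ent_prov)

lemma ent_axMP: "il_axiom L (Imp A B) \<Longrightarrow> wf_fm L B \<Longrightarrow> ent \<Gamma> A \<Longrightarrow> ent \<Gamma> B"
  by (rule ent_MP[OF ent_axiom]) (auto dest: ent_wf)

lemma ent_andI: "ent \<Gamma> A \<Longrightarrow> ent \<Gamma> B \<Longrightarrow> ent \<Gamma> (And A B)"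
  by (rule ent_MP[OF ent_axMP[OF il_axiom.AndI]]) (auto dest: ent_wf)

lemma ent_andE1: "ent \<Gamma> (And A B) \<Longrightarrow> ent \<Gamma> A"
  by (rule ent_axMP[OF il_axiom.AndE1]) (auto dest: ent_wf)

lemma ent_andE2: "ent \<Gamma> (And A B) \<Longrightarrow> ent \<Gamma> B"
  by (rule ent_axMP[OF il_axiom.AndE2]) (auto dest: ent_wf)

lemma ent_orI1: "ent \<Gamma> A \<Longrightarrow> wf_fm L B \<Longrightarrow> ent \<Gamma> (Or A B)"
  by (rule ent_axMP[OF il_axiom.OrI1]) (auto dest: ent_wf)

lemma ent_orI2: "ent \<Gamma> B \<Longrightarrow> wf_fm L A \<Longrightarrow> ent \<Gamma> (Or A B)"
  by (rule ent_axMP[OF il_axiom.OrI2]) (auto dest: ent_wf)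

lemma ent_orE:
  assumes "ent \<Gamma> (Or A B)" "ent (A # \<Gamma>) C" "ent (B # \<Gamma>) C"
  shows "ent \<Gamma> C"
proof -
  have "ent \<Gamma> (Imp (Imp A C) (Imp (Imp B C) (Imp (Or A B) C)))"
    using assms by (intro ent_axiom il_axiom.OrE) (auto dest: ent_wf)
  then show ?thesis
    using assms by (metis ent_MP ent.simps(2))
qed

lemma ent_botE: "ent \<Gamma> Bot \<Longrightarrow> wf_fm L A \<Longrightarrow> ent \<Gamma> A"
  by (rule ent_axMP[OF il_axiom.BotE])

lemma ent_allE: "ent \<Gamma> (All \<rho> A) \<Longrightarrow> typ t \<rho> \<Longrightarrow> ent \<Gamma> (inst \<rho> t A)"
  by (rule ent_axMP[OF il_axiom.AllE]) (auto dest!: ent_wf intro: wf_fm_inst)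

lemma prov_allI: "prov A \<Longrightarrow> prov (All \<rho> A)"
proof -
  assume "prov A"
  \<comment> \<open>The rule \<open>AllI\<close> needs an antecedent; \<open>Imp Bot Bot\<close> is
    derivable and unaffected by lifting.\<close>
  then have "prov (Imp (lift_fm \<rho> (Imp Bot Bot)) A)"
    by (auto intro: prov_K)
  then have "prov (Imp (Imp Bot Bot) (All \<rho> A))"
    by (rule provable.AllI)
  moreover have "prov (Imp Bot Bot)"
    by (rule provable.logical[OF il_axiom.BotE]) simp
  ultimately show ?thesis
    by (rule provable.MP)
qed

text \<open>The rule \<open>AllI\<close> generalizes below a single antecedent. The universal
  assumption and \<open>B\<close> are therefore packed into one conjunction, whose lifting does not
  contain the new variable.\<close>

lemma ent_allI_Imp: 
  assumes "ent \<Gamma> (All \<rho> (Imp (lift_fm \<rho> B) A))"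
  shows "ent \<Gamma> (Imp B (All \<rho> A))"
proof -
  let ?X = "All \<rho> (Imp (lift_fm \<rho> B) A)"
  have wf: "wf_fm L ?X" "wf_fm L B" "wf_fm L A" "wfs \<Gamma>"
    using ent_wf[OF assms] by (auto intro: wf_fm_ren_fmD)
  let ?\<Delta> = "[lift_fm \<rho> (And ?X B)]"
  have wf': "wfs ?\<Delta>" using wf by (auto intro!: wf_fm_ren_fm)
  then have h: "ent ?\<Delta> (And (lift_fm \<rho> ?X) (lift_fm \<rho> B))"
    by (intro ent_assm) auto
  have "ent ?\<Delta> (inst \<rho> (Var \<rho> 0) (ren_fm (up_ren \<rho> (shift \<rho>)) (Imp (lift_fm \<rho> B) A)))"
    using ent_andE1[OF h] by (intro ent_allE has_type.Var) simp
  then have "ent ?\<Delta> (Imp (lift_fm \<rho> B) A)"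
    by (simp only: inst_Var_up_lift)
  then have "ent ?\<Delta> A"
    using ent_andE2[OF h] by (rule ent_MP)
  then have "prov (Imp (And ?X B) (All \<rho> A))"
    by (intro provable.AllI) simp
  then have "ent (B # \<Gamma>) (Imp (And ?X B) (All \<rho> A))"
    using wf by (intro ent_prov) auto
  moreover have "ent (B # \<Gamma>) (And ?X B)"
    using wf by (intro ent_andI ent_weaken[OF assms] ent_assm) auto
  ultimately have "ent (B # \<Gamma>) (All \<rho> A)"
    by (rule ent_MP)
  then show ?thesis by simp
qed

lemma ent_allI: "ent (map (lift_fm \<rho>) \<Gamma>) A \<Longrightarrow> ent \<Gamma> (All \<rho> A)"
  by (induction \<Gamma> arbitrary: A) (auto intro: prov_allI ent_allI_Imp)

lemma ent_exI: "ent \<Gamma> (inst \<rho> t A) \<Longrightarrow> typ t \<rho> \<Longrightarrow> wf_fm L A \<Longrightarrow> ent \<Gamma> (Ex \<rho> A)"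
  by (rule ent_axMP[OF il_axiom.ExI]) auto

text \<open>The rule \<open>ExE\<close> has no side hypotheses. The second premise is first
  generalized to the formula \<open>?X\<close>, in which the variable is bound; \<open>ExE\<close>
  is then applied with the conclusion \<open>Imp ?X C\<close>.\<close>

lemma ent_exE:
  assumes "ent \<Gamma> (Ex \<rho> A)" "ent (A # map (lift_fm \<rho>) \<Gamma>) (lift_fm \<rho> C)"
  shows "ent \<Gamma> C"
proof -
  let ?X = "All \<rho> (Imp A (lift_fm \<rho> C))"
  have X: "ent \<Gamma> ?X"
    using assms(2) by (intro ent_allI) simp
  have wf: "wf_fm L ?X" "wf_fm L C" "wf_fm L A" "wfs \<Gamma>"
    using ent_wf[OF X] by (auto intro: wf_fm_ren_fmD)
  let ?\<Delta> = "[lift_fm \<rho> ?X, A]"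
  have wf': "wfs ?\<Delta>" using wf by (auto intro!: wf_fm_ren_fm)
  have "ent ?\<Delta> (inst \<rho> (Var \<rho> 0) (ren_fm (up_ren \<rho> (shift \<rho>)) (Imp A (lift_fm \<rho> C))))"
    using ent_assm[OF wf', of "lift_fm \<rho> ?X"] by (intro ent_allE has_type.Var) simp
  then have "ent ?\<Delta> (Imp A (lift_fm \<rho> C))"
    by (simp only: inst_Var_up_lift)
  then have "ent ?\<Delta> (lift_fm \<rho> C)"
    by (rule ent_MP) (rule ent_assm[OF wf'], simp)
  then have "prov (Imp (Ex \<rho> A) (Imp ?X C))"
    by (intro provable.ExE) simp
  then have "ent \<Gamma> (Imp (Ex \<rho> A) (Imp ?X C))"
    using wf by (intro ent_prov) auto
  then show ?thesis
    using assms(1) X by (blast intro: ent_MP)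
qed

lemma ent_BAll_iff: "ent \<Gamma> (BAll \<rho> t A) \<longleftrightarrow>
    typ t (Star \<rho>) \<and> ent \<Gamma> (All \<rho> (Imp (In \<rho> (Var \<rho> 0) (lift_tm \<rho> t)) A))"
proof -
  have *: "ent \<Gamma> (Iff (BAll \<rho> t A) (All \<rho> (Imp (In \<rho> (Var \<rho> 0) (lift_tm \<rho> t)) A)))"
    if "typ t (Star \<rho>)" "wf_fm L A" "wfs \<Gamma>"
    using that by (intro ent_axiom il_axiom.BAll) (auto intro: has_type.Var has_type_ren_tm)
  show ?thesis
  proof
    assume a: "ent \<Gamma> (BAll \<rho> t A)"
    then show "typ t (Star \<rho>) \<and> ent \<Gamma> (All \<rho> (Imp (In \<rho> (Var \<rho> 0) (lift_tm \<rho> t)) A))"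
      using ent_wf[OF a] ent_MP[OF ent_andE1[OF *] a] by auto
  next
    assume a: "typ t (Star \<rho>) \<and> ent \<Gamma> (All \<rho> (Imp (In \<rho> (Var \<rho> 0) (lift_tm \<rho> t)) A))"
    then show "ent \<Gamma> (BAll \<rho> t A)"
      using ent_wf[OF a[THEN conjunct2]] ent_MP[OF ent_andE2[OF *] a[THEN conjunct2]] by auto
  qed
qed

lemma ent_BEx_iff: "ent \<Gamma> (BEx \<rho> t A) \<longleftrightarrow>
    typ t (Star \<rho>) \<and> ent \<Gamma> (Ex \<rho> (And (In \<rho> (Var \<rho> 0) (lift_tm \<rho> t)) A))"
proof -
  have *: "ent \<Gamma> (Iff (BEx \<rho> t A) (Ex \<rho> (And (In \<rho> (Var \<rho> 0) (lift_tm \<rho> t)) A)))"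
    if "typ t (Star \<rho>)" "wf_fm L A" "wfs \<Gamma>"
    using that by (intro ent_axiom il_axiom.BEx) (auto intro: has_type.Var has_type_ren_tm)
  show ?thesis
  proof
    assume a: "ent \<Gamma> (BEx \<rho> t A)"
    then show "typ t (Star \<rho>) \<and> ent \<Gamma> (Ex \<rho> (And (In \<rho> (Var \<rho> 0) (lift_tm \<rho> t)) A))"
      using ent_wf[OF a] ent_MP[OF ent_andE1[OF *] a] by auto
  next
    assume a: "typ t (Star \<rho>) \<and> ent \<Gamma> (Ex \<rho> (And (In \<rho> (Var \<rho> 0) (lift_tm \<rho> t)) A))"
    then show "ent \<Gamma> (BEx \<rho> t A)"
      using ent_wf[OF a[THEN conjunct2]] ent_MP[OF ent_andE2[OF *] a[THEN conjunct2]] by auto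
  qed
qed

lemma ent_BAllI:
  assumes "ent (In \<rho> (Var \<rho> 0) (lift_tm \<rho> t) # map (lift_fm \<rho>) \<Gamma>) A"
  shows "ent \<Gamma> (BAll \<rho> t A)"
proof -
  have "typ t (Star \<rho>)"
    using ent_wf[OF assms] by (auto intro: has_type_ren_tmD)
  then show ?thesis
    using assms by (auto simp: ent_BAll_iff intro: ent_allI)
qed

lemma inst_Imp [simp]: "inst \<rho> t (Imp A B) = Imp (inst \<rho> t A) (inst \<rho> t B)"
  and inst_And [simp]: "inst \<rho> t (And A B) = And (inst \<rho> t A) (inst \<rho> t B)"
  and inst_In_bound [simp]: "inst \<rho> t (In \<rho> (Var \<rho> 0) (lift_tm \<rho> q)) = In \<rho> t q"
  by (simp_all add: inst_eq_sub_cons)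

lemma ent_BExI:
  assumes "ent \<Gamma> (In \<rho> q t)" "ent \<Gamma> (inst \<rho> q A)" "wf_fm L A"
  shows "ent \<Gamma> (BEx \<rho> t A)"
proof -
  have "typ q \<rho>" "typ t (Star \<rho>)" using ent_wf[OF assms(1)] by auto
  with assms show ?thesis
    by (auto simp: ent_BEx_iff intro!: ent_exI[of _ _ q] ent_andI has_type.Var has_type_ren_tm)
qed

lemma ent_BExE:
  assumes "ent \<Gamma> (BEx \<rho> t A)"
    and "ent (A # In \<rho> (Var \<rho> 0) (lift_tm \<rho> t) # map (lift_fm \<rho>) \<Gamma>) (lift_fm \<rho> C)"
  shows "ent \<Gamma> C"
proof (rule ent_exE)
  let ?I = "In \<rho> (Var \<rho> 0) (lift_tm \<rho> t)"
  show "ent \<Gamma> (Ex \<rho> (And ?I A))"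
    using assms(1) by (simp add: ent_BEx_iff)
  let ?\<Delta> = "And ?I A # map (lift_fm \<rho>) \<Gamma>"
  from ent_wf[OF assms(2)] have wf: "wfs ?\<Delta>" "wfs (A # ?I # ?\<Delta>)" by auto
  have "ent (A # ?I # ?\<Delta>) (lift_fm \<rho> C)"
    by (rule ent_weaken[OF assms(2)]) (use wf in auto)
  then have "ent ?\<Delta> (Imp ?I (Imp A (lift_fm \<rho> C)))" by simp
  moreover have h: "ent ?\<Delta> (And ?I A)"
    using wf by (intro ent_assm) auto
  ultimately show "ent ?\<Delta> (lift_fm \<rho> C)"
    using ent_andE1[OF h] ent_andE2[OF h] by (blast intro: ent_MP)
qed

section \<open>Blocks of universal quantifiers and closure of derivability under
  substitution\<close>

lemma ent_AllsI: "ent (map (lifts_fm \<rho>s) \<Gamma>) A \<Longrightarrow> ent \<Gamma> (Alls \<rho>s A)"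
proof (induction \<rho>s arbitrary: \<Gamma>)
  case (Cons \<rho> \<rho>s)
  then show ?case
    using Cons.IH[of "map (lift_fm \<rho>) \<Gamma>"] by (auto intro: ent_allI simp: o_def)
qed (simp add: map_idI)

text \<open>The substitution \<open>s\<close> is carried along because instantiating the outermost
  quantifier leaves the rest of the block under a substitution.\<close>

lemma ent_AllsE_sub:
  "ent \<Gamma> (sub_fm s (Alls \<rho>s A)) \<Longrightarrow> list_all2 typ ts \<rho>s \<Longrightarrow> ent \<Gamma> (sub_fm (sub_conss \<rho>s ts s) A)"
proof (induction \<rho>s arbitrary: ts s)
  case (Cons \<rho> \<rho>s)
  from Cons.prems(2) obtain t ts' where ts: "ts = t # ts'" "typ t \<rho>" "list_all2 typ ts' \<rho>s"
    by (auto simp: list_all2_Cons2)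
  from Cons.prems(1) have "ent \<Gamma> (All \<rho> (sub_fm (up_sub \<rho> s) (Alls \<rho>s A)))" by simp
  from ent_allE[OF this ts(2)] have "ent \<Gamma> (sub_fm (sub_cons \<rho> t s) (Alls \<rho>s A))"
    by (simp only: inst_up_sub)
  from Cons.IH[OF this ts(3)] ts show ?case by simp
qed auto

lemma ent_AllsE:
  "ent \<Gamma> (Alls \<rho>s A) \<Longrightarrow> list_all2 typ ts \<rho>s \<Longrightarrow> ent \<Gamma> (sub_fm (sub_conss \<rho>s ts Var) A)"
  using ent_AllsE_sub[of \<Gamma> Var] by simp

text \<open>Below the block \<open>\<rho>s\<close>, the variables of type \<open>\<sigma>\<close>
  with index less than \<open>count_list \<rho>s \<sigma>\<close> are the block's own. On these,
  suitable entries \<open>ts\<close> reproduce any given typed substitution.\<close>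

lemma ex_sub_conss:
  assumes "typed_sub L s"
  shows "\<exists>ts. list_all2 typ ts \<rho>s \<and> (\<forall>u \<sigma> n. sub_conss \<rho>s ts u \<sigma> n =
    (if n < count_list \<rho>s \<sigma> then s \<sigma> n else u \<sigma> (n - count_list \<rho>s \<sigma>)))"
proof (induction \<rho>s)
  case (Cons \<rho> \<rho>s)
  then obtain ts where ts: "list_all2 typ ts \<rho>s"
    and eq: "\<And>u \<sigma> n. sub_conss \<rho>s ts u \<sigma> n =
      (if n < count_list \<rho>s \<sigma> then s \<sigma> n else u \<sigma> (n - count_list \<rho>s \<sigma>))"
    by blast
  \<comment> \<open>The head of the block ends at index \<open>count_list \<rho>s \<rho>\<close>,
    because the later entries of its type are put in front of it.\<close>
  have "sub_conss (\<rho> # \<rho>s) (s \<rho> (count_list \<rho>s \<rho>) # ts) u \<sigma> n =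
    (if n < count_list (\<rho> # \<rho>s) \<sigma> then s \<sigma> n else u \<sigma> (n - count_list (\<rho> # \<rho>s) \<sigma>))" for u \<sigma> n
    by (auto simp: eq sub_cons_def less_Suc_eq diff_Suc not_less split: nat.split)
  moreover have "list_all2 typ (s \<rho> (count_list \<rho>s \<rho>) # ts) (\<rho> # \<rho>s)"
    using ts assms by (simp add: typed_subD)
  ultimately show ?case by blast
qed simp

lemma ex_block_covering:
  assumes "finite V"
  shows "\<exists>\<rho>s. \<forall>(\<sigma>, n)\<in>V. n < count_list \<rho>s \<sigma>"
  using assms
proof induction
  case (insert v V)
  then obtain \<rho>s where \<rho>s: "\<forall>(\<sigma>, n)\<in>V. n < count_list \<rho>s \<sigma>" by blast
  obtain \<tau> m where v: "v = (\<tau>, m)" by fastforce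
  have "count_list (replicate (Suc m) \<tau>) \<tau> = Suc m"
    by (induction m) auto
  then have "\<forall>(\<sigma>, n)\<in>insert v V. n < count_list (replicate (Suc m) \<tau> @ \<rho>s) \<sigma>"
    using \<rho>s by (auto simp: v)
  then show ?case by blast
qed simp

text \<open>
  Formulas of \<open>T\<close> are not closed under substitution, so this does not go by induction on the
  derivation: generalize over a block containing all the free variables of \<open>A\<close>, then instantiate.
\<close>

lemma prov_sub:
  assumes "prov A" "typed_sub L s"
  shows "prov (sub_fm s A)"
proof -
  obtain \<rho>s where \<rho>s: "\<forall>(\<sigma>, n)\<in>fv_fm A. n < count_list \<rho>s \<sigma>"
    using ex_block_covering[OF finite_fv_fm] by blast
  obtain ts where ts: "list_all2 typ ts \<rho>s"
    and eq: "\<forall>u \<sigma> n. sub_conss \<rho>s ts u \<sigma> n =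
      (if n < count_list \<rho>s \<sigma> then s \<sigma> n else u \<sigma> (n - count_list \<rho>s \<sigma>))"
    using ex_sub_conss[OF assms(2)] by blast
  have "ent [] (Alls \<rho>s A)"
    using assms(1) by (intro ent_AllsI) simp
  from ent_AllsE[OF this ts] have "prov (sub_fm (sub_conss \<rho>s ts Var) A)" by simp
  also have "sub_fm (sub_conss \<rho>s ts Var) A = sub_fm s A"
    using \<rho>s by (intro sub_fm_cong) (auto simp: eq)
  finally show ?thesis .
qed

lemma ent_sub: "ent \<Gamma> A \<Longrightarrow> typed_sub L s \<Longrightarrow> ent (map (sub_fm s) \<Gamma>) (sub_fm s A)"
  by (induction \<Gamma> arbitrary: A) (auto intro: prov_sub simp flip: sub_fm.simps)


section \<open>Equality and combinatory completeness\<close>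

text \<open>The non-logical axioms speak of variables only; their instances at terms arise by
  substitution. The position in the list is the index replaced, so the variables of an axiom get
  distinct indices whether or not their types agree.\<close>

definition assign :: "(ty \<times> 'f tm) list \<Rightarrow> 'f sub" where
  "assign xs = (\<lambda>\<sigma> n. if n < length xs \<and> fst (xs ! n) = \<sigma> then snd (xs ! n) else Var \<sigma> n)"

lemma assign_simps [simp]:
  "assign ((\<sigma>, t) # xs) \<sigma> 0 = t"
  "assign (x # (\<sigma>, t) # xs) \<sigma> (Suc 0) = t"
  "assign (x # y # (\<sigma>, t) # xs) \<sigma> (Suc (Suc 0)) = t"
  "assign (x # y # z # (\<sigma>, t) # xs) \<sigma> (Suc (Suc (Suc 0))) = t"
  by (auto simp: assign_def)

lemma ent_assign:
  assumes "prov A" "\<forall>(\<sigma>, t)\<in>set xs. typ t \<sigma>" "wfs \<Gamma>"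
  shows "ent \<Gamma> (sub_fm (assign xs) A)"
proof -
  have "typed_sub L (assign xs)"
    using assms(2) nth_mem[of _ xs] by (fastforce simp: typed_sub_def assign_def intro: has_type.Var)
  then show ?thesis
    using assms by (intro ent_prov prov_sub)
qed

lemma ent_assign_axiom:
  assumes "il_axiom L A" "wf_fm L A" "\<forall>(\<sigma>, t)\<in>set xs. typ t \<sigma>" "wfs \<Gamma>"
  shows "ent \<Gamma> (sub_fm (assign xs) A)"
  using assms by (intro ent_assign provable.logical)

lemmas has_type_intros = has_type.Var has_type.App

lemma has_type_consts [intro]:
  "typ (Con (CPi \<sigma> \<tau>)) (\<sigma> \<rightarrow>\<^sub>t \<tau> \<rightarrow>\<^sub>t \<sigma>)"
  "typ (Con (CSigma \<rho> \<sigma> \<tau>)) ((\<rho> \<rightarrow>\<^sub>t \<sigma> \<rightarrow>\<^sub>t \<tau>) \<rightarrow>\<^sub>t (\<rho> \<rightarrow>\<^sub>t \<sigma>) \<rightarrow>\<^sub>t \<rho> \<rightarrow>\<^sub>t \<tau>)"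
  "typ (Con (CSing \<sigma>)) (\<sigma> \<rightarrow>\<^sub>t Star \<sigma>)"
  "typ (Con (CUn \<sigma>)) (Star \<sigma> \<rightarrow>\<^sub>t Star \<sigma> \<rightarrow>\<^sub>t Star \<sigma>)"
  "typ (Con (CBigUn \<sigma> \<tau>)) (Star \<sigma> \<rightarrow>\<^sub>t (\<sigma> \<rightarrow>\<^sub>t Star \<tau>) \<rightarrow>\<^sub>t Star \<tau>)"
  using has_type.Con[of L "CPi \<sigma> \<tau>"] has_type.Con[of L "CSigma \<rho> \<sigma> \<tau>"]
    has_type.Con[of L "CSing \<sigma>"] has_type.Con[of L "CUn \<sigma>"] has_type.Con[of L "CBigUn \<sigma> \<tau>"]
  by auto

section \<open>Equality rules and term instances of the axioms\<close>

lemma ent_eq_refl: "typ t \<rho> \<Longrightarrow> wfs \<Gamma> \<Longrightarrow> ent \<Gamma> (Eq \<rho> t t)"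
  using ent_assign_axiom[OF il_axiom.eq_refl[OF refl, of L \<rho> 0], of "[(\<rho>, t)]" \<Gamma>]
  by (simp add: has_type.Var)

lemma ent_eq_In:
  assumes "ent \<Gamma> (Eq (Star \<rho>) x y)" "ent \<Gamma> (In \<rho> w x)"
  shows "ent \<Gamma> (In \<rho> w y)"
proof -
  let ?x = "Var (Star \<rho>) 0" let ?y = "Var (Star \<rho>) (Suc 0)" let ?w = "Var \<rho> (Suc (Suc 0))"
  have "il_axiom L (Imp (And (Eq (Star \<rho>) ?x ?y) (In \<rho> ?w ?x)) (In \<rho> ?w ?y))"
    by (rule il_axiom.eq_repl[OF refl refl]) (intro repl_fm.intros repl_tm.keep repl_tm.here)
  from ent_assign_axiom[OF this, of "[(Star \<rho>, x), (Star \<rho>, y), (\<rho>, w)]" \<Gamma>]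
  have "ent \<Gamma> (Imp (And (Eq (Star \<rho>) x y) (In \<rho> w x)) (In \<rho> w y))"
    using ent_wf[OF assms(1)] ent_wf[OF assms(2)] by (simp add: has_type.Var)
  then show ?thesis
    using assms by (blast intro: ent_MP ent_andI)
qed

lemma ent_eq_sym:
  assumes "ent \<Gamma> (Eq \<rho> x y)"
  shows "ent \<Gamma> (Eq \<rho> y x)"
proof -
  let ?x = "Var \<rho> 0" let ?y = "Var \<rho> (Suc 0)"
  \<comment> \<open>In \<open>x = x\<close> only the left occurrence is replaced.\<close>
  have "il_axiom L (Imp (And (Eq \<rho> ?x ?y) (Eq \<rho> ?x ?x)) (Eq \<rho> ?y ?x))"
    by (rule il_axiom.eq_repl[OF refl refl]) (intro repl_fm.intros repl_tm.keep repl_tm.here)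
  from ent_assign_axiom[OF this, of "[(\<rho>, x), (\<rho>, y)]" \<Gamma>]
  have "ent \<Gamma> (Imp (And (Eq \<rho> x y) (Eq \<rho> x x)) (Eq \<rho> y x))"
    using ent_wf[OF assms(1)] by (simp add: has_type.Var)
  moreover have "ent \<Gamma> (Eq \<rho> x x)"
    using ent_wf[OF assms(1)] by (intro ent_eq_refl) auto
  ultimately show ?thesis
    using assms by (blast intro: ent_MP ent_andI)
qed

lemma ent_eq_trans:
  assumes "ent \<Gamma> (Eq \<rho> x y)" "ent \<Gamma> (Eq \<rho> y z)"
  shows "ent \<Gamma> (Eq \<rho> x z)"
proof -
  let ?x = "Var \<rho> 0" let ?y = "Var \<rho> (Suc 0)" let ?z = "Var \<rho> (Suc (Suc 0))"
  have "il_axiom L (Imp (And (Eq \<rho> ?y ?z) (Eq \<rho> ?x ?y)) (Eq \<rho> ?x ?z))"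
    by (rule il_axiom.eq_repl[OF refl refl]) (intro repl_fm.intros repl_tm.keep repl_tm.here)
  from ent_assign_axiom[OF this, of "[(\<rho>, x), (\<rho>, y), (\<rho>, z)]" \<Gamma>]
  have "ent \<Gamma> (Imp (And (Eq \<rho> y z) (Eq \<rho> x y)) (Eq \<rho> x z))"
    using ent_wf[OF assms(1)] ent_wf[OF assms(2)] by (simp add: has_type.Var)
  then show ?thesis
    using assms by (blast intro: ent_MP ent_andI)
qed

text \<open>Two replacements on the right of a reflexivity equation, first of \<open>f\<close> by
  \<open>g\<close> and then of \<open>x\<close> by \<open>y\<close>, joined by transitivity.\<close>

lemma ent_eq_app:
  assumes "ent \<Gamma> (Eq (\<sigma> \<rightarrow>\<^sub>t \<tau>) f g)" "ent \<Gamma> (Eq \<sigma> x y)"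
  shows "ent \<Gamma> (Eq \<tau> (f \<cdot> x) (g \<cdot> y))"
proof -
  let ?f = "Var (\<sigma> \<rightarrow>\<^sub>t \<tau>) 0" let ?g = "Var (\<sigma> \<rightarrow>\<^sub>t \<tau>) (Suc 0)"
  let ?x = "Var \<sigma> (Suc (Suc 0))" let ?y = "Var \<sigma> (Suc (Suc (Suc 0)))"
  let ?xs = "[(\<sigma> \<rightarrow>\<^sub>t \<tau>, f), (\<sigma> \<rightarrow>\<^sub>t \<tau>, g), (\<sigma>, x), (\<sigma>, y)]"
  note wf = ent_wf[OF assms(1)] ent_wf[OF assms(2)]
  have "il_axiom L (Imp (And (Eq (\<sigma> \<rightarrow>\<^sub>t \<tau>) ?f ?g) (Eq \<tau> (?f \<cdot> ?x) (?f \<cdot> ?x))) (Eq \<tau> (?f \<cdot> ?x) (?g \<cdot> ?x)))"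
    by (rule il_axiom.eq_repl[OF refl refl])
      (intro repl_fm.intros repl_tm.keep repl_tm.App repl_tm.here)
  from ent_assign_axiom[OF this, of ?xs \<Gamma>]
  have "ent \<Gamma> (Imp (And (Eq (\<sigma> \<rightarrow>\<^sub>t \<tau>) f g) (Eq \<tau> (f \<cdot> x) (f \<cdot> x))) (Eq \<tau> (f \<cdot> x) (g \<cdot> x)))"
    using wf by (auto intro: has_type_intros)
  moreover have "ent \<Gamma> (Eq \<tau> (f \<cdot> x) (f \<cdot> x))"
    using wf by (intro ent_eq_refl) (auto intro: has_type_intros)
  ultimately have 1: "ent \<Gamma> (Eq \<tau> (f \<cdot> x) (g \<cdot> x))"
    using assms by (blast intro: ent_MP ent_andI)
  have "il_axiom L (Imp (And (Eq \<sigma> ?x ?y) (Eq \<tau> (?g \<cdot> ?x) (?g \<cdot> ?x))) (Eq \<tau> (?g \<cdot> ?x) (?g \<cdot> ?y)))"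
    by (rule il_axiom.eq_repl[OF refl refl])
      (intro repl_fm.intros repl_tm.keep repl_tm.App repl_tm.here)
  from ent_assign_axiom[OF this, of ?xs \<Gamma>]
  have "ent \<Gamma> (Imp (And (Eq \<sigma> x y) (Eq \<tau> (g \<cdot> x) (g \<cdot> x))) (Eq \<tau> (g \<cdot> x) (g \<cdot> y)))"
    using wf by (auto intro: has_type_intros)
  moreover have "ent \<Gamma> (Eq \<tau> (g \<cdot> x) (g \<cdot> x))"
    using wf by (intro ent_eq_refl) (auto intro: has_type_intros)
  ultimately have 2: "ent \<Gamma> (Eq \<tau> (g \<cdot> x) (g \<cdot> y))"
    using assms by (blast intro: ent_MP ent_andI)
  from 1 2 show ?thesis by (rule ent_eq_trans)
qed

lemma ent_eq_app_left:
  assumes "ent \<Gamma> (Eq (\<sigma> \<rightarrow>\<^sub>t \<tau>) f g)" "typ x \<sigma>"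
  shows "ent \<Gamma> (Eq \<tau> (f \<cdot> x) (g \<cdot> x))"
  using assms ent_wf[OF assms(1)] by (blast intro: ent_eq_app ent_eq_refl)

lemma ent_eq_apps:
  "ent \<Gamma> (Eq (arrs \<rho>s \<tau>) x y) \<Longrightarrow> list_all2 typ qs \<rho>s \<Longrightarrow> ent \<Gamma> (Eq \<tau> (apps x qs) (apps y qs))"
proof (induction \<rho>s arbitrary: x y qs)
  case (Cons \<rho> \<rho>s)
  then show ?case
    by (auto simp: list_all2_Cons2 dest: ent_eq_app_left)
qed simp

lemma ent_eq_Pi:
  assumes "typ x \<sigma>" "typ y \<tau>" "wfs \<Gamma>"
  shows "ent \<Gamma> (Eq \<sigma> (Con (CPi \<sigma> \<tau>) \<cdot> x \<cdot> y) x)"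
  using ent_assign_axiom[OF il_axiom.Pi[OF refl refl, of L \<sigma> \<tau> 0 "Suc 0"],
      of "[(\<sigma>, x), (\<tau>, y)]" \<Gamma>] assms
  by (auto intro: has_type_intros)

lemma ent_eq_Sigma:
  assumes "typ x (\<rho> \<rightarrow>\<^sub>t \<sigma> \<rightarrow>\<^sub>t \<tau>)" "typ y (\<rho> \<rightarrow>\<^sub>t \<sigma>)" "typ z \<rho>" "wfs \<Gamma>"
  shows "ent \<Gamma> (Eq \<tau> (Con (CSigma \<rho> \<sigma> \<tau>) \<cdot> x \<cdot> y \<cdot> z) (x \<cdot> z \<cdot> (y \<cdot> z)))"
  using ent_assign_axiom[OF il_axiom.Sigma[OF refl refl refl, of L \<tau> \<rho> \<sigma> 0 "Suc 0" "Suc (Suc 0)"],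
      of "[(\<rho> \<rightarrow>\<^sub>t \<sigma> \<rightarrow>\<^sub>t \<tau>, x), (\<rho> \<rightarrow>\<^sub>t \<sigma>, y), (\<rho>, z)]" \<Gamma>] assms
  by (auto intro!: has_type_consts intro: has_type_intros)

lemma ent_in_sing: "typ x \<sigma> \<Longrightarrow> wfs \<Gamma> \<Longrightarrow> ent \<Gamma> (In \<sigma> x (Con (CSing \<sigma>) \<cdot> x))"
  using ent_andE2[OF ent_assign_axiom[OF il_axiom.in_sing[OF refl refl, of L \<sigma> 0 "Suc 0"],
      of "[(\<sigma>, x), (\<sigma>, x)]" \<Gamma>, simplified]]
  by (auto intro: has_type_intros ent_eq_refl ent_MP)

lemma ent_in_un:
  assumes "typ x (Star \<sigma>)" "typ y (Star \<sigma>)" 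
  shows "ent \<Gamma> (In \<sigma> w x) \<Longrightarrow> ent \<Gamma> (In \<sigma> w (Con (CUn \<sigma>) \<cdot> x \<cdot> y))"
    and "ent \<Gamma> (In \<sigma> w y) \<Longrightarrow> ent \<Gamma> (In \<sigma> w (Con (CUn \<sigma>) \<cdot> x \<cdot> y))"
proof -
  have *: "ent \<Gamma> (Imp (Or (In \<sigma> w x) (In \<sigma> w y)) (In \<sigma> w (Con (CUn \<sigma>) \<cdot> x \<cdot> y)))"
    if "wfs \<Gamma>" "typ w \<sigma>"
    using ent_andE2[OF ent_assign_axiom[OF
        il_axiom.in_un[OF refl refl refl, of L \<sigma> 0 "Suc 0" "Suc (Suc 0)"],
        of "[(\<sigma>, w), (Star \<sigma>, x), (Star \<sigma>, y)]" \<Gamma>, simplified]] assms that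
    by (auto intro: has_type_intros)
  show "ent \<Gamma> (In \<sigma> w (Con (CUn \<sigma>) \<cdot> x \<cdot> y))" if "ent \<Gamma> (In \<sigma> w x)"
    using ent_MP[OF * ent_orI1[OF that]] ent_wf[OF that] assms by auto
  show "ent \<Gamma> (In \<sigma> w (Con (CUn \<sigma>) \<cdot> x \<cdot> y))" if "ent \<Gamma> (In \<sigma> w y)"
    using ent_MP[OF * ent_orI2[OF that]] ent_wf[OF that] assms by auto
qed

lemma ent_in_bigun:
  assumes "typ y (\<sigma> \<rightarrow>\<^sub>t Star \<tau>)" "ent \<Gamma> (In \<sigma> z x)" "ent \<Gamma> (In \<tau> w (y \<cdot> z))"
  shows "ent \<Gamma> (In \<tau> w (Con (CBigUn \<sigma> \<tau>) \<cdot> x \<cdot> y))"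
proof -
  let ?xs = "[(Star \<sigma>, x), (\<sigma> \<rightarrow>\<^sub>t Star \<tau>, y), (\<sigma>, z), (\<tau>, w)]"
  have "ent \<Gamma> (Imp (And (In \<sigma> z x) (In \<tau> w (y \<cdot> z))) (In \<tau> w (Con (CBigUn \<sigma> \<tau>) \<cdot> x \<cdot> y)))"
    using ent_assign_axiom[OF il_axiom.in_bigun[OF refl refl refl refl,
        of L \<sigma> "Suc (Suc 0)" 0 \<tau> "Suc (Suc (Suc 0))" "Suc 0"], of ?xs \<Gamma>, simplified]
      assms(1) ent_wf[OF assms(2)] ent_wf[OF assms(3)]
    by (auto intro: has_type_intros)
  then show ?thesis
    using assms by (blast intro: ent_MP ent_andI)
qed

text \<open>Bracket abstraction: \<open>\<Sigma>\<close> distributes over an application, and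
  \<open>\<Pi>\<close> handles constants and the other variables. The equation is stated at the
  variable itself; other arguments follow by \<open>prov_sub\<close>.\<close>

lemma ex_abstraction:
  "typ t \<tau> \<Longrightarrow> \<exists>u. typ u (\<rho> \<rightarrow>\<^sub>t \<tau>) \<and> fv_tm u \<subseteq> fv_tm t - {(\<rho>, n)} \<and> prov (Eq \<tau> (u \<cdot> Var \<rho> n) t)"
proof (induction rule: has_type.induct)
  case (Con c)
  let ?\<tau> = "const_type L c"
  have c: "typ (Con c) ?\<tau>" using Con by (rule has_type.Con)
  with ent_eq_Pi[OF c has_type.Var, of "[]"] show ?case
    by (intro exI[of _ "Con (CPi ?\<tau> \<rho>) \<cdot> Con c"]) (auto intro: has_type_intros)
next
  case (Var \<sigma> m)
  show ?case
  proof (cases "(\<sigma>, m) = (\<rho>, n)")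
    case True
    \<comment> \<open>The identity is \<open>\<Sigma> \<Pi> \<Pi>\<close>, with \<open>\<Pi>\<close>
      at two different types.\<close>
    let ?K = "Con (CPi \<rho> (\<rho> \<rightarrow>\<^sub>t \<rho>))" and ?K' = "Con (CPi \<rho> \<rho>)"
    let ?u = "Con (CSigma \<rho> (\<rho> \<rightarrow>\<^sub>t \<rho>) \<rho>) \<cdot> ?K \<cdot> ?K'"
    have "ent [] (Eq \<rho> (?u \<cdot> Var \<rho> n) (?K \<cdot> Var \<rho> n \<cdot> (?K' \<cdot> Var \<rho> n)))"
      by (rule ent_eq_Sigma) (auto intro: has_type_intros)
    moreover have "ent [] (Eq \<rho> (?K \<cdot> Var \<rho> n \<cdot> (?K' \<cdot> Var \<rho> n)) (Var \<rho> n))"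
      by (rule ent_eq_Pi) (auto intro: has_type_intros)
    ultimately have "ent [] (Eq \<rho> (?u \<cdot> Var \<rho> n) (Var \<rho> n))"
      by (rule ent_eq_trans)
    moreover have "typ ?u (\<rho> \<rightarrow>\<^sub>t \<rho>)"
      by (blast intro: has_type_intros)
    ultimately show ?thesis
      using True by (intro exI[of _ ?u]) auto
  next
    case False
    have "typ (Var \<sigma> m) \<sigma>" by (rule has_type.Var)
    with False ent_eq_Pi[OF this has_type.Var, of "[]"] show ?thesis
      by (intro exI[of _ "Con (CPi \<sigma> \<rho>) \<cdot> Var \<sigma> m"]) (auto intro: has_type_intros)
  qed
next
  case (App t \<sigma> \<tau> q)
  from App.IH obtain u v where
    u: "typ u (\<rho> \<rightarrow>\<^sub>t \<sigma> \<rightarrow>\<^sub>t \<tau>)" "fv_tm u \<subseteq> fv_tm t - {(\<rho>, n)}"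
       "ent [] (Eq (\<sigma> \<rightarrow>\<^sub>t \<tau>) (u \<cdot> Var \<rho> n) t)" and
    v: "typ v (\<rho> \<rightarrow>\<^sub>t \<sigma>)" "fv_tm v \<subseteq> fv_tm q - {(\<rho>, n)}" "ent [] (Eq \<sigma> (v \<cdot> Var \<rho> n) q)"
    by auto
  have "ent [] (Eq \<tau> (Con (CSigma \<rho> \<sigma> \<tau>) \<cdot> u \<cdot> v \<cdot> Var \<rho> n) (u \<cdot> Var \<rho> n \<cdot> (v \<cdot> Var \<rho> n)))"
    using u v by (intro ent_eq_Sigma) (auto intro: has_type_intros)
  then have "ent [] (Eq \<tau> (Con (CSigma \<rho> \<sigma> \<tau>) \<cdot> u \<cdot> v \<cdot> Var \<rho> n) (t \<cdot> q))"
    by (rule ent_eq_trans) (rule ent_eq_app[OF u(3) v(3)])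
  with u v show ?case
    by (intro exI[of _ "Con (CSigma \<rho> \<sigma> \<tau>) \<cdot> u \<cdot> v"]) (auto intro: has_type_intros)
qed

section \<open>Abstraction over lists and blocks of variables\<close>

abbreviation vars :: "(ty \<times> nat) list \<Rightarrow> 'f tm list" where
  "vars vs \<equiv> map (\<lambda>(\<sigma>, n). Var \<sigma> n) vs"

lemma has_type_vars: "list_all2 typ (vars vs) (map fst vs)"
  by (auto simp: list_all2_conv_all_nth case_prod_beta intro: has_type.Var)

text \<open>The head of the list is abstracted last, since \<open>apps\<close> supplies it as the
  first argument.\<close>

lemma ex_abstractions:
  assumes "typ t \<tau>"
  shows "\<exists>u. typ u (arrs (map fst vs) \<tau>) \<and> fv_tm u \<subseteq> fv_tm t - set vs \<and> prov (Eq \<tau> (apps u (vars vs)) t)"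
proof (induction vs)
  case Nil
  then show ?case using assms ent_eq_refl[OF assms, of "[]"] by auto
next
  case (Cons v vs)
  then obtain u where u: "typ u (arrs (map fst vs) \<tau>)" "fv_tm u \<subseteq> fv_tm t - set vs"
    "ent [] (Eq \<tau> (apps u (vars vs)) t)" by auto
  obtain \<rho> n where v: "v = (\<rho>, n)" by fastforce
  from ex_abstraction[OF u(1), of \<rho> n] obtain u' where u':
    "typ u' (\<rho> \<rightarrow>\<^sub>t arrs (map fst vs) \<tau>)" "fv_tm u' \<subseteq> fv_tm u - {(\<rho>, n)}"
    "ent [] (Eq (arrs (map fst vs) \<tau>) (u' \<cdot> Var \<rho> n) u)" by auto
  have "ent [] (Eq \<tau> (apps (u' \<cdot> Var \<rho> n) (vars vs)) t)"
    using ent_eq_apps[OF u'(3) has_type_vars] u(3) by (rule ent_eq_trans)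
  with u u' show ?case
    by (intro exI[of _ u']) (auto simp: v)
qed

lemma ex_combinator:
  assumes "typ t \<tau>" "fv_tm t \<subseteq> set vs"
  obtains c where "fv_tm c = {}" "typ c (arrs (map fst vs) \<tau>)" "prov (Eq \<tau> (apps c (vars vs)) t)"
  using ex_abstractions[OF assms(1), of vs] assms(2) by blast

text \<open>Here \<open>t\<close> lives below the block and \<open>u\<close> outside it, hence the
  lifting of \<open>u\<close>. This is how a realizer found from generic premises becomes a function
  of them.\<close>

lemma ex_block_abstraction:
  assumes "typ t \<tau>"
  shows "\<exists>u. typ u (arrs \<rho>s \<tau>) \<and> prov (Eq \<tau> (apps (lifts_tm \<rho>s u) (block_vars \<rho>s)) t)"
proof (induction \<rho>s)
  case Nil
  then show ?case using assms ent_eq_refl[OF assms, of "[]"] by auto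
next
  case (Cons \<rho> \<rho>s)
  then obtain u where u: "typ u (arrs \<rho>s \<tau>)"
    "ent [] (Eq \<tau> (apps (lifts_tm \<rho>s u) (block_vars \<rho>s)) t)" by auto
  from ex_abstraction[OF u(1), of \<rho> 0] obtain u' where u':
    "typ u' (\<rho> \<rightarrow>\<^sub>t arrs \<rho>s \<tau>)" "(\<rho>, 0) \<notin> fv_tm u'"
    "prov (Eq (arrs \<rho>s \<tau>) (u' \<cdot> Var \<rho> 0) u)" by auto
  \<comment> \<open>The abstracted variable is gone, so the term comes from outside the
    binder.\<close>
  from ex_lift_tm[OF u'(2)] obtain v where v: "u' = lift_tm \<rho> v" .
  have "ent [] (Eq (arrs \<rho>s \<tau>) (lifts_tm \<rho>s (lift_tm \<rho> v) \<cdot> lifts_tm \<rho>s (Var \<rho> 0)) (lifts_tm \<rho>s u))"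
    using prov_sub[OF u'(3), of "lifts_sub \<rho>s"] by (simp add: v lifts_tm_eq_sub)
  from ent_eq_trans[OF ent_eq_apps[OF this has_type_block_vars] u(2)]
  show ?case
    using u'(1) by (intro exI[of _ v]) (auto simp: v intro: has_type_ren_tmD)
qed


section \<open>Monotonicity and joins of realizers\<close>

definition morph :: "'f sub \<Rightarrow> ('f, 'r) fm list \<Rightarrow> ('f, 'r) fm list \<Rightarrow> bool" where
  "morph s \<Gamma> \<Gamma>' \<longleftrightarrow> typed_sub L s \<and> sub_fm s ` set \<Gamma> \<subseteq> set \<Gamma>' \<and> wfs \<Gamma>'"

lemma morph_typed: "morph s \<Gamma> \<Gamma>' \<Longrightarrow> typed_sub L s"
  and morph_wfs: "morph s \<Gamma> \<Gamma>' \<Longrightarrow> wfs \<Gamma>'"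
  by (simp_all add: morph_def)

lemma morph_has_type: "morph s \<Gamma> \<Gamma>' \<Longrightarrow> typ t \<tau> \<Longrightarrow> typ (sub_tm s t) \<tau>"
  by (auto intro: has_type_sub_tm morph_typed)

lemma ent_morph: "ent \<Gamma> A \<Longrightarrow> morph s \<Gamma> \<Gamma>' \<Longrightarrow> ent \<Gamma>' (sub_fm s A)"
  by (rule ent_weaken[OF ent_sub]) (auto simp: morph_def)

lemma morph_comp:
  "morph s \<Gamma> \<Gamma>' \<Longrightarrow> morph s' \<Gamma>' \<Gamma>'' \<Longrightarrow> morph (\<lambda>\<sigma> n. sub_tm s' (s \<sigma> n)) \<Gamma> \<Gamma>''"
  by (force simp: morph_def typed_sub_comp simp flip: sub_fm_sub_fm)

lemma morph_Var: "wfs \<Gamma>' \<Longrightarrow> set \<Gamma> \<subseteq> set \<Gamma>' \<Longrightarrow> morph Var \<Gamma> \<Gamma>'"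
  by (simp add: morph_def)

lemma morph_shift: "wfs \<Gamma>' \<Longrightarrow> lift_fm \<rho> ` set \<Gamma> \<subseteq> set \<Gamma>' \<Longrightarrow> morph (shift_sub \<rho>) \<Gamma> \<Gamma>'"
  by (simp add: morph_def lift_fm_eq_sub[abs_def])

lemma morph_lifts: "wfs \<Gamma>' \<Longrightarrow> lifts_fm \<rho>s ` set \<Gamma> \<subseteq> set \<Gamma>' \<Longrightarrow> morph (lifts_sub \<rho>s) \<Gamma> \<Gamma>'"
  by (simp add: morph_def lifts_fm_eq_sub)

text \<open>
  Pointwise inclusion of realizers, as a Kripke-style relation on the meta-level; \<open>le G\<close> is a junk
  case, because no realizer has a type ending in \<open>G\<close>.
\<close>

primrec le :: "ty \<Rightarrow> ('f, 'r) fm list \<Rightarrow> 'f tm \<Rightarrow> 'f tm \<Rightarrow> bool" where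
  "le G = (\<lambda>\<Gamma> x y. False)"
| "le (\<rho> \<rightarrow>\<^sub>t \<tau>) = (\<lambda>\<Gamma> x y. \<forall>s \<Gamma>' q. morph s \<Gamma> \<Gamma>' \<longrightarrow> typ q \<rho> \<longrightarrow>
     le \<tau> \<Gamma>' (sub_tm s x \<cdot> q) (sub_tm s y \<cdot> q))"
| "le (Star \<sigma>) = (\<lambda>\<Gamma> x y. \<forall>s \<Gamma>' w. morph s \<Gamma> \<Gamma>' \<longrightarrow>
     ent \<Gamma>' (In \<sigma> w (sub_tm s x)) \<longrightarrow> ent \<Gamma>' (In \<sigma> w (sub_tm s y)))"

primrec star_ended :: "ty \<Rightarrow> bool" where
  "star_ended G \<longleftrightarrow> False"
| "star_ended (\<rho> \<rightarrow>\<^sub>t \<tau>) \<longleftrightarrow> star_ended \<tau>"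
| "star_ended (Star \<sigma>) \<longleftrightarrow> True"

lemma star_ended_arrs [simp]: "star_ended (arrs \<rho>s \<tau>) = star_ended \<tau>"
  by (induction \<rho>s) auto

text \<open>Only \<open>Ex\<close> creates a realizer, of type \<open>Star \<rho>\<close>;
  implications and universal quantifiers merely prefix arguments.\<close>

lemma star_ended_hr_types: "\<tau> \<in> set (hr_types A) \<Longrightarrow> star_ended \<tau>"
  by (induction A arbitrary: \<tau>) auto

lemma star_ended_hr_types_nth [simp]: "i < length (hr_types A) \<Longrightarrow> star_ended (hr_types A ! i)"
  by (rule star_ended_hr_types) (rule nth_mem)

lemma le_morph: "le \<tau> \<Gamma> x y \<Longrightarrow> morph s \<Gamma> \<Gamma>' \<Longrightarrow> le \<tau> \<Gamma>' (sub_tm s x) (sub_tm s y)"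
  using morph_comp[of s \<Gamma> \<Gamma>'] by (cases \<tau>) (fastforce simp: sub_tm_sub_tm)+

lemma le_trans: "le \<tau> \<Gamma> x y \<Longrightarrow> le \<tau> \<Gamma> y z \<Longrightarrow> le \<tau> \<Gamma> x z"
  by (induction \<tau> arbitrary: \<Gamma> x y z) (simp, simp, blast, simp)

lemma le_eq: "ent \<Gamma> (Eq \<tau> x y) \<Longrightarrow> star_ended \<tau> \<Longrightarrow> le \<tau> \<Gamma> x y"
proof (induction \<tau> arbitrary: \<Gamma> x y)
  case (Arr \<rho> \<tau>)
  show ?case
    unfolding le.simps
  proof (intro allI impI)
    fix s \<Gamma>' q assume "morph s \<Gamma> \<Gamma>'" "typ q \<rho>"
    with ent_morph[OF Arr.prems(1), of s \<Gamma>']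
    have "ent \<Gamma>' (Eq \<tau> (sub_tm s x \<cdot> q) (sub_tm s y \<cdot> q))"
      by (auto intro: ent_eq_app_left)
    then show "le \<tau> \<Gamma>' (sub_tm s x \<cdot> q) (sub_tm s y \<cdot> q)"
      using Arr by simp
  qed
next
  case (Star \<sigma>)
  show ?case
    using ent_morph[OF Star.prems(1)] by (auto intro: ent_eq_In)
qed auto

lemma le_app:
  assumes "le (\<rho> \<rightarrow>\<^sub>t \<tau>) \<Gamma> x y" "typ q \<rho>" "wfs \<Gamma>"
  shows "le \<tau> \<Gamma> (x \<cdot> q) (y \<cdot> q)"
  using assms morph_Var[of \<Gamma> \<Gamma>] unfolding le.simps by (metis sub_tm_Var subset_refl)

lemma le_apps:
  "le (arrs \<rho>s \<tau>) \<Gamma> x y \<Longrightarrow> list_all2 typ qs \<rho>s \<Longrightarrow> wfs \<Gamma> \<Longrightarrow> le \<tau> \<Gamma> (apps x qs) (apps y qs)"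
proof (induction \<rho>s arbitrary: x y qs)
  case (Cons \<rho> \<rho>s)
  then show ?case
    by (auto simp: list_all2_Cons2 simp del: le.simps dest: le_app)
qed simp

lemma le_Star: "le (Star \<sigma>) \<Gamma> x y \<Longrightarrow> ent \<Gamma> (In \<sigma> w x) \<Longrightarrow> ent \<Gamma> (In \<sigma> w y)"
  using morph_Var[of \<Gamma> \<Gamma>] ent_wf[of \<Gamma>] unfolding le.simps by (metis sub_tm_Var subset_refl)

text \<open>At a function type, \<open>U x y q = U' (x q) (y q)\<close>.\<close>

lemma ex_join:
  assumes "star_ended \<tau>"
  shows "\<exists>U. fv_tm U = {} \<and> typ U (\<tau> \<rightarrow>\<^sub>t \<tau> \<rightarrow>\<^sub>t \<tau>) \<and>
    (\<forall>\<Gamma> x y. wfs \<Gamma> \<longrightarrow> typ x \<tau> \<longrightarrow> typ y \<tau> \<longrightarrow> le \<tau> \<Gamma> x (U \<cdot> x \<cdot> y) \<and> le \<tau> \<Gamma> y (U \<cdot> x \<cdot> y))"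
  using assms
proof (induction \<tau>)
  case (Arr \<rho> \<tau>)
  then obtain U where U: "fv_tm U = {}" "typ U (\<tau> \<rightarrow>\<^sub>t \<tau> \<rightarrow>\<^sub>t \<tau>)"
    "\<And>\<Gamma> x y. wfs \<Gamma> \<Longrightarrow> typ x \<tau> \<Longrightarrow> typ y \<tau> \<Longrightarrow> le \<tau> \<Gamma> x (U \<cdot> x \<cdot> y)"
    "\<And>\<Gamma> x y. wfs \<Gamma> \<Longrightarrow> typ x \<tau> \<Longrightarrow> typ y \<tau> \<Longrightarrow> le \<tau> \<Gamma> y (U \<cdot> x \<cdot> y)"
    by auto
  let ?\<tau> = "\<rho> \<rightarrow>\<^sub>t \<tau>"
  let ?x = "Var ?\<tau> 0" let ?y = "Var ?\<tau> (Suc 0)" let ?q = "Var \<rho> (Suc (Suc 0))"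
  let ?vs = "[(?\<tau>, 0), (?\<tau>, Suc 0), (\<rho>, Suc (Suc 0))]"
  obtain V where V: "fv_tm V = {}" "typ V (arrs (map fst ?vs) \<tau>)"
    "prov (Eq \<tau> (apps V (vars ?vs)) (U \<cdot> (?x \<cdot> ?q) \<cdot> (?y \<cdot> ?q)))"
    by (rule ex_combinator[of "U \<cdot> (?x \<cdot> ?q) \<cdot> (?y \<cdot> ?q)" \<tau> ?vs])
      (use U in \<open>auto intro: has_type_intros\<close>)
  have eq: "le \<tau> \<Gamma> (U \<cdot> (x \<cdot> q) \<cdot> (y \<cdot> q)) (V \<cdot> x \<cdot> y \<cdot> q)"
    if "wfs \<Gamma>" "typ x ?\<tau>" "typ y ?\<tau>" "typ q \<rho>" for \<Gamma> x y q
    using ent_assign[OF V(3), of "[(?\<tau>, x), (?\<tau>, y), (\<rho>, q)]" \<Gamma>] that U(1) V(1) Arr.prems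
    by (auto simp: sub_tm_closed intro: le_eq ent_eq_sym)
  have "le ?\<tau> \<Gamma> x (V \<cdot> x \<cdot> y) \<and> le ?\<tau> \<Gamma> y (V \<cdot> x \<cdot> y)"
    if "wfs \<Gamma>" "typ x ?\<tau>" "typ y ?\<tau>" for \<Gamma> x y
    using that U(1) V(1)
    by (auto simp: sub_tm_closed intro!: le_trans[OF U(3) eq] le_trans[OF U(4) eq]
        intro: has_type_intros morph_has_type dest: morph_wfs)
  with V show ?case by (intro exI[of _ V]) auto
next
  case (Star \<sigma>)
  show ?case
    by (intro exI[of _ "Con (CUn \<sigma>)"]) (auto intro: ent_in_un morph_has_type)
qed auto

text \<open>At a function type, \<open>B t u q = B' t (\<lambda>z. u z q)\<close>, with the abstraction \<open>C u q\<close> for \<open>\<lambda>z. u z q\<close>.\<close>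

lemma ex_big_join:
  assumes "star_ended \<tau>"
  shows "\<exists>B. fv_tm B = {} \<and> typ B (Star \<rho> \<rightarrow>\<^sub>t (\<rho> \<rightarrow>\<^sub>t \<tau>) \<rightarrow>\<^sub>t \<tau>) \<and>
    (\<forall>\<Gamma> t u z. typ u (\<rho> \<rightarrow>\<^sub>t \<tau>) \<longrightarrow> ent \<Gamma> (In \<rho> z t) \<longrightarrow> le \<tau> \<Gamma> (u \<cdot> z) (B \<cdot> t \<cdot> u))"
  using assms
proof (induction \<tau>)
  case (Arr \<rho>' \<tau>)
  then obtain B where B: "fv_tm B = {}" "typ B (Star \<rho> \<rightarrow>\<^sub>t (\<rho> \<rightarrow>\<^sub>t \<tau>) \<rightarrow>\<^sub>t \<tau>)"
    "\<And>\<Gamma> t u z. typ u (\<rho> \<rightarrow>\<^sub>t \<tau>) \<Longrightarrow> ent \<Gamma> (In \<rho> z t) \<Longrightarrow> le \<tau> \<Gamma> (u \<cdot> z) (B \<cdot> t \<cdot> u)"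
    by auto
  let ?\<tau> = "\<rho> \<rightarrow>\<^sub>t \<rho>' \<rightarrow>\<^sub>t \<tau>"
  let ?vs = "[(?\<tau>, 0), (\<rho>', Suc 0), (\<rho>, Suc (Suc 0))]"
  let ?r = "Var ?\<tau> 0 \<cdot> Var \<rho> (Suc (Suc 0)) \<cdot> Var \<rho>' (Suc 0)"
  obtain C where C: "fv_tm C = {}" "typ C (arrs (map fst ?vs) \<tau>)"
    "prov (Eq \<tau> (apps C (vars ?vs)) ?r)"
    by (rule ex_combinator[of ?r \<tau> ?vs]) (auto intro: has_type_intros)
  let ?ws = "[(Star \<rho>, 0), (?\<tau>, Suc 0), (\<rho>', Suc (Suc 0))]"
  let ?r' = "B \<cdot> Var (Star \<rho>) 0 \<cdot> (C \<cdot> Var ?\<tau> (Suc 0) \<cdot> Var \<rho>' (Suc (Suc 0)))"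
  have C_typ: "typ (C \<cdot> u \<cdot> q) (\<rho> \<rightarrow>\<^sub>t \<tau>)" if "typ u ?\<tau>" "typ q \<rho>'" for u q
    using C(2) that by (auto intro: has_type_intros)
  obtain D where D: "fv_tm D = {}" "typ D (arrs (map fst ?ws) \<tau>)"
    "prov (Eq \<tau> (apps D (vars ?ws)) ?r')"
    by (rule ex_combinator[of ?r' \<tau> ?ws])
      (use B(1,2) C(1) in \<open>auto intro: has_type_intros C_typ\<close>)
  have eqC: "le \<tau> \<Gamma> (u \<cdot> z \<cdot> q) (C \<cdot> u \<cdot> q \<cdot> z)"
    if "wfs \<Gamma>" "typ u ?\<tau>" "typ q \<rho>'" "typ z \<rho>" for \<Gamma> u z q
    using ent_assign[OF C(3), of "[(?\<tau>, u), (\<rho>', q), (\<rho>, z)]" \<Gamma>] that C(1) Arr.prems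
    by (auto simp: sub_tm_closed intro: le_eq ent_eq_sym)
  have eqD: "le \<tau> \<Gamma> (B \<cdot> t \<cdot> (C \<cdot> u \<cdot> q)) (D \<cdot> t \<cdot> u \<cdot> q)"
    if "wfs \<Gamma>" "typ t (Star \<rho>)" "typ u ?\<tau>" "typ q \<rho>'" for \<Gamma> t u q
    using ent_assign[OF D(3), of "[(Star \<rho>, t), (?\<tau>, u), (\<rho>', q)]" \<Gamma>] that B(1) C(1) D(1) Arr.prems
    by (auto simp: sub_tm_closed intro: le_eq ent_eq_sym)
  have main: "le \<tau> \<Gamma> (u \<cdot> z \<cdot> q) (D \<cdot> t \<cdot> u \<cdot> q)"
    if "typ u ?\<tau>" "ent \<Gamma> (In \<rho> z t)" "typ q \<rho>'" for \<Gamma> t u z q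
    using le_trans[OF eqC le_trans[OF B(3)[OF C_typ] eqD], of \<Gamma> u q z t] that ent_wf[OF that(2)]
    by auto
  have "le (\<rho>' \<rightarrow>\<^sub>t \<tau>) \<Gamma> (u \<cdot> z) (D \<cdot> t \<cdot> u)"
    if "typ u ?\<tau>" "ent \<Gamma> (In \<rho> z t)" for \<Gamma> t u z
    using that D(1) ent_morph[OF that(2)]
    by (auto simp: sub_tm_closed intro!: main intro: morph_has_type)
  with D show ?case by (intro exI[of _ D]) auto
next
  case (Star \<sigma>)
  show ?case
  proof (intro exI[of _ "Con (CBigUn \<rho> \<sigma>)"] conjI allI impI)
    fix \<Gamma> t u z assume *: "typ u (\<rho> \<rightarrow>\<^sub>t Star \<sigma>)" "ent \<Gamma> (In \<rho> z t)"
    show "le (Star \<sigma>) \<Gamma> (u \<cdot> z) (Con (CBigUn \<rho> \<sigma>) \<cdot> t \<cdot> u)"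
      using * ent_morph[OF *(2)] by (auto intro: ent_in_bigun morph_has_type)
  qed auto
qed auto


section \<open>Derivation rules for the realizability matrix\<close>

lemma hr_matrix_ImpI:
  assumes "ent (hr_matrix (lifts_fm (hr_types A) A) (block_vars (hr_types A)) #
      map (lifts_fm (hr_types A)) \<Gamma>) (hr_matrix (lifts_fm (hr_types A) B)
      (map (\<lambda>u. apps (lifts_tm (hr_types A) u) (block_vars (hr_types A))) us))"
  shows "ent \<Gamma> (hr_matrix (Imp A B) us)"
  using assms by (auto simp: Let_def intro!: ent_AllsI)

lemma hr_matrix_ImpE:
  assumes "ent \<Gamma> (hr_matrix (Imp A B) us)" "length us = length (hr_types B)"
    and "list_all2 typ xs (hr_types A)" "ent \<Gamma> (hr_matrix A xs)"
  shows "ent \<Gamma> (hr_matrix B (map (\<lambda>u. apps u xs) us))"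
proof -
  let ?\<rho>s = "hr_types A"
  have len: "length xs = length ?\<rho>s"
    using assms(3) by (rule list_all2_lengthD)
  \<comment> \<open>Instantiating the block at \<open>xs\<close> turns the block variables into
    \<open>xs\<close> and cancels the lifting of \<open>A\<close>, \<open>B\<close> and
    \<open>us\<close>.\<close>
  have "ent \<Gamma> (sub_fm (sub_conss ?\<rho>s xs Var) (Imp (hr_matrix (lifts_fm ?\<rho>s A) (block_vars ?\<rho>s))
      (hr_matrix (lifts_fm ?\<rho>s B) (map (\<lambda>u. apps (lifts_tm ?\<rho>s u) (block_vars ?\<rho>s)) us))))"
    using assms(1,3) by (intro ent_AllsE) (auto simp: Let_def)
  then have "ent \<Gamma> (Imp (hr_matrix A xs) (hr_matrix B (map (\<lambda>u. apps u xs) us)))"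
    using len assms(2)
    by (simp add: hr_matrix_sub_fm sub_fm_conss_lifts sub_conss_block_vars sub_tm_conss_lifts o_def)
  then show ?thesis
    using assms(4) by (rule ent_MP)
qed

text \<open>Converse of \<open>ent_allI\<close>: the quantified formula is moved below the binder
  and instantiated with the bound variable.\<close>

lemma ent_all_generic: "ent \<Gamma> (All \<rho> A) \<Longrightarrow> ent (map (lift_fm \<rho>) \<Gamma>) A"
proof -
  assume a: "ent \<Gamma> (All \<rho> A)"
  have "ent (map (lift_fm \<rho>) \<Gamma>) (sub_fm (shift_sub \<rho>) (All \<rho> A))"
    using a ent_wf[OF a] by (intro ent_morph[OF a] morph_shift) (auto intro: wf_fm_ren_fm)
  then have "ent (map (lift_fm \<rho>) \<Gamma>) (inst \<rho> (Var \<rho> 0) (sub_fm (up_sub \<rho> (shift_sub \<rho>)) A))"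
    by (intro ent_allE has_type.Var) simp
  then show ?thesis
    by (simp add: inst_up_sub)
qed

text \<open>The witness is kept; its membership in the new bound and the new body may both be
  derived from the old ones.\<close>

lemma ent_BEx_mono:
  assumes "ent \<Gamma> (BEx \<rho> t A)"
    and "ent (A # In \<rho> (Var \<rho> 0) (lift_tm \<rho> t) # map (lift_fm \<rho>) \<Gamma>) (In \<rho> (Var \<rho> 0) (lift_tm \<rho> t'))"
    and "ent (A # In \<rho> (Var \<rho> 0) (lift_tm \<rho> t) # map (lift_fm \<rho>) \<Gamma>) B"
  shows "ent \<Gamma> (BEx \<rho> t' B)"
proof (rule ent_BExE[OF assms(1)])
  show "ent (A # In \<rho> (Var \<rho> 0) (lift_tm \<rho> t) # map (lift_fm \<rho>) \<Gamma>) (lift_fm \<rho> (BEx \<rho> t' B))"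
    unfolding ren_fm.simps
    by (rule ent_BExI[OF assms(2)]) (use assms(3) ent_wf[OF assms(3)] in \<open>auto intro: wf_fm_ren_fm\<close>)
qed

section \<open>Monotonicity of the matrix\<close>

definition les :: "ty list \<Rightarrow> ('f, 'r) fm list \<Rightarrow> 'f tm list \<Rightarrow> 'f tm list \<Rightarrow> bool" where
  "les \<tau>s \<Gamma> xs ys \<longleftrightarrow> length xs = length \<tau>s \<and> length ys = length \<tau>s \<and>
     (\<forall>i<length \<tau>s. typ (xs ! i) (\<tau>s ! i) \<and> typ (ys ! i) (\<tau>s ! i) \<and> le (\<tau>s ! i) \<Gamma> (xs ! i) (ys ! i))"

lemma les_morph: "les \<tau>s \<Gamma> xs ys \<Longrightarrow> morph s \<Gamma> \<Gamma>' \<Longrightarrow> les \<tau>s \<Gamma>' (map (sub_tm s) xs) (map (sub_tm s) ys)"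
  by (auto simp: les_def intro: le_morph morph_has_type)

lemma les_apps:
  "les (map (arrs \<rho>s) \<tau>s) \<Gamma> xs ys \<Longrightarrow> list_all2 typ qs \<rho>s \<Longrightarrow> wfs \<Gamma> \<Longrightarrow>
   les \<tau>s \<Gamma> (map (\<lambda>x. apps x qs) xs) (map (\<lambda>x. apps x qs) ys)"
  by (auto simp: les_def intro: le_apps has_type_apps)

lemma les_append_left:
  "les (\<rho>s @ \<tau>s) \<Gamma> xs ys \<Longrightarrow> les \<rho>s \<Gamma> (take (length \<rho>s) xs) (take (length \<rho>s) ys)"
  unfolding les_def
proof (elim conjE, intro conjI allI impI)
  fix i assume "i < length \<rho>s" and *: "\<forall>i<length (\<rho>s @ \<tau>s). typ (xs ! i) ((\<rho>s @ \<tau>s) ! i) \<and>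
    typ (ys ! i) ((\<rho>s @ \<tau>s) ! i) \<and> le ((\<rho>s @ \<tau>s) ! i) \<Gamma> (xs ! i) (ys ! i)"
  with *[rule_format, of i]
  show "typ (take (length \<rho>s) xs ! i) (\<rho>s ! i)" "typ (take (length \<rho>s) ys ! i) (\<rho>s ! i)"
    "le (\<rho>s ! i) \<Gamma> (take (length \<rho>s) xs ! i) (take (length \<rho>s) ys ! i)"
    by (simp_all add: nth_append)
qed simp_all

lemma les_append_right:
  "les (\<rho>s @ \<tau>s) \<Gamma> xs ys \<Longrightarrow> les \<tau>s \<Gamma> (drop (length \<rho>s) xs) (drop (length \<rho>s) ys)"
  unfolding les_def
proof (elim conjE, intro conjI allI impI)
  fix i assume "i < length \<tau>s" and *: "\<forall>i<length (\<rho>s @ \<tau>s). typ (xs ! i) ((\<rho>s @ \<tau>s) ! i) \<and>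
    typ (ys ! i) ((\<rho>s @ \<tau>s) ! i) \<and> le ((\<rho>s @ \<tau>s) ! i) \<Gamma> (xs ! i) (ys ! i)"
    and "length xs = length (\<rho>s @ \<tau>s)" "length ys = length (\<rho>s @ \<tau>s)"
  with *[rule_format, of "length \<rho>s + i"]
  show "typ (drop (length \<rho>s) xs ! i) (\<tau>s ! i)" "typ (drop (length \<rho>s) ys ! i) (\<tau>s ! i)"
    "le (\<tau>s ! i) \<Gamma> (drop (length \<rho>s) xs ! i) (drop (length \<rho>s) ys ! i)"
    by simp_all
qed simp_all

lemma les_typed: "les \<tau>s \<Gamma> xs ys \<Longrightarrow> list_all2 typ xs \<tau>s" "les \<tau>s \<Gamma> xs ys \<Longrightarrow> list_all2 typ ys \<tau>s"
  by (auto simp: les_def list_all2_conv_all_nth)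

lemma arrs_single: "arrs [\<rho>] = Arr \<rho>"
  by (rule ext) simp

text \<open>No contravariance arises for implications: the matrix quantifies over all realizers of
  the premise, so only those of the conclusion are compared. Induction is on the height because that
  clause passes to lifted subformulas.\<close>

lemma hr_matrix_mono:
  "wf_fm L A \<Longrightarrow> les (hr_types A) \<Gamma> xs ys \<Longrightarrow> ent \<Gamma> (hr_matrix A xs) \<Longrightarrow> ent \<Gamma> (hr_matrix A ys)"
proof (induction "height A" arbitrary: A \<Gamma> xs ys rule: less_induct)
  case less
  note IH = less.hyps and les = less.prems(2) and ent = less.prems(3)
  note wf = ent_wf[OF ent]
  have wf': "wf_fm L (hr_matrix A ys)"
    using less.prems(1) les_typed(2)[OF les] by (rule wf_fm_hr_matrix)
  show ?case
  proof (cases A)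
    case (Or B C)
    let ?k = "length (hr_types B)"
    note l = les_append_left[OF les[unfolded Or hr_types.simps]]
      and r = les_append_right[OF les[unfolded Or hr_types.simps]]
    let ?B = "hr_matrix B (take ?k xs)" and ?C = "hr_matrix C (drop ?k xs)"
    have ws: "wfs (?B # \<Gamma>)" "wfs (?C # \<Gamma>)"
      using wf by (auto simp: Or)
    have "ent (?B # \<Gamma>) (hr_matrix B (take ?k ys))"
      using less.prems(1) les_morph[OF l morph_Var[OF ws(1)]] ws
      by (intro IH[OF _ _ _ ent_assm]) (auto simp: Or map_idI)
    moreover have "ent (?C # \<Gamma>) (hr_matrix C (drop ?k ys))"
      using less.prems(1) les_morph[OF r morph_Var[OF ws(2)]] ws
      by (intro IH[OF _ _ _ ent_assm]) (auto simp: Or map_idI)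
    ultimately have "ent (?B # \<Gamma>) (hr_matrix A ys)" "ent (?C # \<Gamma>) (hr_matrix A ys)"
      using wf' unfolding Or hr_matrix.simps wf_fm.simps by (blast intro: ent_orI1 ent_orI2)+
    moreover have "ent \<Gamma> (Or ?B ?C)"
      using ent by (simp add: Or)
    ultimately show ?thesis
      by (blast intro: ent_orE)
  next
    case (And B C)
    note l = les_append_left[OF les[unfolded And hr_types.simps]]
      and r = les_append_right[OF les[unfolded And hr_types.simps]]
    show ?thesis
      using less.prems(1) ent IH[OF _ _ l] IH[OF _ _ r] unfolding And hr_matrix.simps
      by (auto intro!: ent_andI dest: ent_andE1 ent_andE2)
  next
    case (Imp B C)
    let ?\<rho>s = "hr_types B"
    let ?\<Gamma> = "hr_matrix (lifts_fm ?\<rho>s B) (block_vars ?\<rho>s) # map (lifts_fm ?\<rho>s) \<Gamma>"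
    have ws: "wfs ?\<Gamma>"
      using less.prems(1) wf wf_fm_hr_matrix[of L "lifts_fm ?\<rho>s B" "block_vars ?\<rho>s"]
      by (auto simp: Imp has_type_block_vars wf_fm_lifts_fm)
    then have m: "morph (lifts_sub ?\<rho>s) \<Gamma> ?\<Gamma>"
      by (intro morph_lifts) auto
    have len: "length xs = length (hr_types C)" "length ys = length (hr_types C)"
      using les by (auto simp: les_def Imp)
    \<comment> \<open>The given realizers are moved to the context with a generic realizer of the
      premise, and are then applied to the block variables.\<close>
    have "ent ?\<Gamma> (hr_matrix (Imp (lifts_fm ?\<rho>s B) (lifts_fm ?\<rho>s C)) (map (lifts_tm ?\<rho>s) xs))"
      using ent_morph[OF ent m] hr_matrix_sub_fm[of xs "Imp B C" "lifts_sub ?\<rho>s"] len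
      unfolding Imp lifts_fm_eq_sub lifts_tm_eq_sub[abs_def] by simp
    then have e: "ent ?\<Gamma> (hr_matrix (lifts_fm ?\<rho>s C)
        (map (\<lambda>u. apps u (block_vars ?\<rho>s)) (map (lifts_tm ?\<rho>s) xs)))"
      by (rule hr_matrix_ImpE) (use len ent_assm[OF ws] in \<open>auto simp: has_type_block_vars\<close>)
    have l: "les (hr_types C) ?\<Gamma> (map (\<lambda>u. apps u (block_vars ?\<rho>s)) (map (lifts_tm ?\<rho>s) xs))
       (map (\<lambda>u. apps u (block_vars ?\<rho>s)) (map (lifts_tm ?\<rho>s) ys))"
      by (rule les_apps[OF _ has_type_block_vars ws])
        (use les_morph[OF les m] in \<open>simp add: Imp lifts_tm_eq_sub\<close>)
    have "ent ?\<Gamma> (hr_matrix (lifts_fm ?\<rho>s C)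
       (map (\<lambda>u. apps u (block_vars ?\<rho>s)) (map (lifts_tm ?\<rho>s) ys)))"
      by (rule IH[OF _ _ _ e]) (use l less.prems(1) in \<open>simp_all add: Imp wf_fm_lifts_fm\<close>)
    then show ?thesis
      unfolding Imp by (intro hr_matrix_ImpI) (simp only: map_map o_def)
  next
    case (All \<rho> B)
    let ?\<Gamma> = "map (lift_fm \<rho>) \<Gamma>"
    have ws: "wfs ?\<Gamma>" using wf by (auto intro: wf_fm_ren_fm)
    have m: "morph (shift_sub \<rho>) \<Gamma> ?\<Gamma>" using ws by (intro morph_shift) auto
    \<comment> \<open>A universal quantifier is a block of length one, so \<open>les_apps\<close>
      can be used with the bound variable as argument.\<close>
    have "les (map (arrs [\<rho>]) (hr_types B)) ?\<Gamma> (map (lift_tm \<rho>) xs) (map (lift_tm \<rho>) ys)"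
      using les_morph[OF les m] by (simp add: All lift_tm_eq_sub[abs_def] arrs_single)
    from les_apps[OF this, of "[Var \<rho> 0]"] ws
    have "les (hr_types B) ?\<Gamma> (map (\<lambda>x. lift_tm \<rho> x \<cdot> Var \<rho> 0) xs) (map (\<lambda>x. lift_tm \<rho> x \<cdot> Var \<rho> 0) ys)"
      by (simp add: o_def has_type.Var)
    from IH[OF _ _ this ent_all_generic] less.prems(1) ent show ?thesis
      by (auto simp: All intro: ent_allI)
  next
    case (Ex \<rho> B)
    from les obtain x xs' where xs: "xs = x # xs'" by (cases xs) (auto simp: les_def Ex)
    from les obtain y ys' where ys: "ys = y # ys'" by (cases ys) (auto simp: les_def Ex)
    have le: "le (Star \<rho>) \<Gamma> x y"
      using les by (auto simp: les_def Ex xs ys simp del: le.simps)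
    have les': "les (hr_types B) \<Gamma> xs' ys'"
      using les_append_right[of "[Star \<rho>]" "hr_types B" \<Gamma> xs ys] les by (simp add: Ex xs ys)
    let ?\<Gamma> = "hr_matrix B (map (lift_tm \<rho>) xs') # In \<rho> (Var \<rho> 0) (lift_tm \<rho> x) # map (lift_fm \<rho>) \<Gamma>"
    have ws: "wfs ?\<Gamma>"
      using wf by (auto simp: Ex xs intro: wf_fm_ren_fm has_type_ren_tm has_type.Var)
    have m: "morph (shift_sub \<rho>) \<Gamma> ?\<Gamma>" using ws by (intro morph_shift) auto
    \<comment> \<open>The inclusion of \<open>x\<close> in \<open>y\<close> carries the witness into
      the larger set.\<close>
    have "ent ?\<Gamma> (In \<rho> (Var \<rho> 0) (lift_tm \<rho> y))"
      using le_Star[OF le_morph[OF le m] ent_assm[OF ws]] by (auto simp: lift_tm_eq_sub simp del: ent.simps)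
    moreover have "ent ?\<Gamma> (hr_matrix B (map (lift_tm \<rho>) ys'))"
      using les_morph[OF les' m] less.prems(1) ws
      by (intro IH[OF _ _ _ ent_assm]) (auto simp: Ex lift_tm_eq_sub[abs_def])
    ultimately show ?thesis
      using ent by (auto simp: Ex xs ys intro: ent_BEx_mono simp del: ent.simps)
  next
    case (BAll \<rho> t B)
    let ?\<Gamma> = "In \<rho> (Var \<rho> 0) (lift_tm \<rho> t) # map (lift_fm \<rho>) \<Gamma>"
    have ws: "wfs ?\<Gamma>"
      using wf by (auto simp: BAll intro: wf_fm_ren_fm has_type_ren_tm has_type.Var)
    have m: "morph (shift_sub \<rho>) \<Gamma> ?\<Gamma>" using ws by (intro morph_shift) auto
    have "ent \<Gamma> (All \<rho> (Imp (In \<rho> (Var \<rho> 0) (lift_tm \<rho> t)) (hr_matrix B (map (lift_tm \<rho>) xs))))"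
      using ent by (simp add: BAll ent_BAll_iff)
    from ent_all_generic[OF this] have "ent ?\<Gamma> (hr_matrix B (map (lift_tm \<rho>) xs))"
      by simp
    then have "ent ?\<Gamma> (hr_matrix B (map (lift_tm \<rho>) ys))"
      by (rule IH[rotated 3]) (use les_morph[OF les m] less.prems(1) in \<open>auto simp: BAll lift_tm_eq_sub[abs_def]\<close>)
    then show ?thesis
      unfolding BAll hr_matrix.simps by (rule ent_BAllI)
  next
    case (BEx \<rho> t B)
    let ?\<Gamma> = "hr_matrix B (map (lift_tm \<rho>) xs) # In \<rho> (Var \<rho> 0) (lift_tm \<rho> t) # map (lift_fm \<rho>) \<Gamma>"
    have ws: "wfs ?\<Gamma>"
      using wf by (auto simp: BEx intro: wf_fm_ren_fm has_type_ren_tm has_type.Var)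
    have m: "morph (shift_sub \<rho>) \<Gamma> ?\<Gamma>" using ws by (intro morph_shift) auto
    have "ent ?\<Gamma> (hr_matrix B (map (lift_tm \<rho>) ys))"
      using les_morph[OF les m] less.prems(1) ws
      by (intro IH[OF _ _ _ ent_assm]) (auto simp: BEx lift_tm_eq_sub[abs_def])
    moreover have "ent ?\<Gamma> (In \<rho> (Var \<rho> 0) (lift_tm \<rho> t))"
      using ws by (intro ent_assm) auto
    ultimately show ?thesis
      using ent by (auto simp: BEx intro: ent_BEx_mono simp del: ent.simps)
  qed (use ent in auto)
qed

end

section \<open>Soundness\<close>

lemma ex_free_sub_fm [simp]: "ex_free (sub_fm s A) = ex_free A"
  by (induction A arbitrary: s) auto

lemma repl_fm_ex_free: "repl_fm x y A A' \<Longrightarrow> ex_free A \<and> ex_free A'"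
  by (induction rule: repl_fm.induct) auto

locale ex_free_theory = theory_ctxt L T
  for L :: "('f, 'r) language" and T :: "('f, 'r) fm set" +
  assumes ex_const: "\<exists>c\<in>funs L. fun_arity L c = 0"
    and T_ex_free: "\<forall>B\<in>T. wf_fm L B \<and> ex_free B"
begin

lemma ex_closed: "\<exists>t. fv_tm t = {} \<and> typ t \<tau>"
proof (induction \<tau>)
  case G
  from ex_const obtain c where "c \<in> funs L" "fun_arity L c = 0" by blast
  then show ?case
    using has_type.Con[of L "CFun c"] by (intro exI[of _ "Con (CFun c)"]) auto
next
  case (Arr \<sigma> \<tau>)
  then obtain t where "fv_tm t = {}" "typ t \<tau>" by blast
  then show ?case
    by (intro exI[of _ "Con (CPi \<tau> \<sigma>) \<cdot> t"]) (auto intro: has_type_intros)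
next
  case (Star \<sigma>)
  then obtain t where "fv_tm t = {}" "typ t \<sigma>" by blast
  then show ?case
    by (intro exI[of _ "Con (CSing \<sigma>) \<cdot> t"]) (auto intro: has_type_intros)
qed

lemma ex_typed_list: "\<exists>ts. list_all2 typ ts \<tau>s"
proof (induction \<tau>s)
  case (Cons \<tau> \<tau>s)
  then obtain ts where "list_all2 typ ts \<tau>s" by blast
  moreover obtain t where "typ t \<tau>" using ex_closed by blast
  ultimately have "list_all2 typ (t # ts) (\<tau> # \<tau>s)" by simp
  then show ?case by blast
qed simp

lemma le_prov_eq: "prov (Eq \<tau> y x) \<Longrightarrow> star_ended \<tau> \<Longrightarrow> wfs \<Gamma> \<Longrightarrow> le \<tau> \<Gamma> x y"
  by (rule le_eq[OF ent_eq_sym[OF ent_prov]])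

section \<open>Validity and its Kripke clauses\<close>

definition valid :: "('f, 'r) fm list \<Rightarrow> ('f, 'r) fm \<Rightarrow> bool" where
  "valid \<Gamma> A \<longleftrightarrow> wf_fm L A \<and> (\<exists>xs. list_all2 typ xs (hr_types A) \<and> ent \<Gamma> (hr_matrix A xs))"

lemma validI: "wf_fm L A \<Longrightarrow> list_all2 typ xs (hr_types A) \<Longrightarrow> ent \<Gamma> (hr_matrix A xs) \<Longrightarrow> valid \<Gamma> A"
  by (auto simp: valid_def)

lemma validE:
  assumes "valid \<Gamma> A"
  obtains xs where "wf_fm L A" "list_all2 typ xs (hr_types A)" "length xs = length (hr_types A)"
    "ent \<Gamma> (hr_matrix A xs)" "wfs \<Gamma>"
  using assms by (auto simp: valid_def dest: ent_wf list_all2_lengthD)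

lemma valid_wf: "valid \<Gamma> A \<Longrightarrow> wf_fm L A" and valid_wfs: "valid \<Gamma> A \<Longrightarrow> wfs \<Gamma>"
  by (auto elim: validE)

text \<open>An existential-free formula has the empty tuple of realizers and is its own matrix. The
  members of \<open>T\<close> and the existential-free axioms are treated through this
  equivalence.\<close>

lemma valid_ex_free: "ex_free A \<Longrightarrow> valid \<Gamma> A \<longleftrightarrow> ent \<Gamma> A"
  by (auto simp: valid_def hr_types_ex_free hr_matrix_ex_free dest: ent_wf)

lemma valid_morph:
  assumes "valid \<Gamma> A" "morph s \<Gamma> \<Gamma>'"
  shows "valid \<Gamma>' (sub_fm s A)"
  using assms(1)
proof (rule validE)
  fix xs assume xs: "wf_fm L A" "list_all2 typ xs (hr_types A)" "length xs = length (hr_types A)"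
    "ent \<Gamma> (hr_matrix A xs)"
  show ?thesis
  proof (rule validI)
    show "list_all2 typ (map (sub_tm s) xs) (hr_types (sub_fm s A))"
      using xs(2) morph_has_type[OF assms(2)] by (auto simp: list_all2_conv_all_nth)
    show "ent \<Gamma>' (hr_matrix (sub_fm s A) (map (sub_tm s) xs))"
      using ent_morph[OF xs(4) assms(2)] xs(3) by (simp add: hr_matrix_sub_fm)
  qed (use xs(1) assms(2) in \<open>auto intro: wf_fm_sub_fm morph_typed\<close>)
qed

lemma valid_weaken: "valid \<Gamma> A \<Longrightarrow> set \<Gamma> \<subseteq> set \<Gamma>' \<Longrightarrow> wfs \<Gamma>' \<Longrightarrow> valid \<Gamma>' A"
  using valid_morph[of \<Gamma> A Var \<Gamma>'] morph_Var[of \<Gamma>' \<Gamma>] by simp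

lemma valid_ImpE:
  assumes "valid \<Gamma> (Imp A B)" "valid \<Gamma> A"
  shows "valid \<Gamma> B"
proof -
  from assms(1) obtain us where us: "wf_fm L B" "list_all2 typ us (map (arrs (hr_types A)) (hr_types B))"
    "length us = length (hr_types B)" "ent \<Gamma> (hr_matrix (Imp A B) us)"
    by (elim validE) auto
  from assms(2) obtain xs where xs: "list_all2 typ xs (hr_types A)" "ent \<Gamma> (hr_matrix A xs)"
    by (elim validE) auto
  show ?thesis
  proof (rule validI[OF us(1)])
    show "list_all2 typ (map (\<lambda>u. apps u xs) us) (hr_types B)"
      using us(2) has_type_apps[OF _ xs(1)] by (auto simp: list_all2_conv_all_nth)
  qed (rule hr_matrix_ImpE[OF us(4,3) xs])
qed

text \<open>The abstractions applied to the block variables are only provably equal to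
  \<open>bs\<close>. Equality implies inclusion by \<open>le_eq\<close>, so monotonicity plays the
  role of a congruence rule for the matrix.\<close>

lemma ex_abstracted_realizers:
  assumes "wf_fm L A" "list_all2 typ bs (hr_types A)" "ent \<Gamma> (hr_matrix A bs)"
  shows "\<exists>us. list_all2 typ us (map (arrs \<rho>s) (hr_types A)) \<and>
    ent \<Gamma> (hr_matrix A (map (\<lambda>u. apps (lifts_tm \<rho>s u) (block_vars \<rho>s)) us))"
proof -
  let ?\<tau>s = "hr_types A" and ?f = "\<lambda>u. apps (lifts_tm \<rho>s u) (block_vars \<rho>s)"
  have "\<forall>i<length ?\<tau>s. \<exists>u. typ u (arrs \<rho>s (?\<tau>s ! i)) \<and> prov (Eq (?\<tau>s ! i) (?f u) (bs ! i))"
    using assms(2) by (auto simp: list_all2_conv_all_nth intro: ex_block_abstraction)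
  then obtain us where us: "length us = length ?\<tau>s"
    "\<And>i. i < length ?\<tau>s \<Longrightarrow> typ (us ! i) (arrs \<rho>s (?\<tau>s ! i))"
    "\<And>i. i < length ?\<tau>s \<Longrightarrow> prov (Eq (?\<tau>s ! i) (?f (us ! i)) (bs ! i))"
    unfolding Skolem_list_nth by blast
  have wfs: "wfs \<Gamma>" using ent_wf[OF assms(3)] by blast
  have "les ?\<tau>s \<Gamma> bs (map ?f us)"
    using assms(2) us wfs unfolding les_def
    by (auto simp: list_all2_conv_all_nth
        intro!: has_type_apps[OF has_type_lifts_tm has_type_block_vars] le_prov_eq)
  then have "ent \<Gamma> (hr_matrix A (map ?f us))"
    using assms by (blast intro: hr_matrix_mono)
  then show ?thesis
    using us by (intro exI[of _ us]) (auto simp: list_all2_conv_all_nth)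
qed

text \<open>The block variables serve as a generic realizer of the premise.\<close>

lemma valid_ImpI_generic:
  assumes "wf_fm L A" "wf_fm L B"
    and "valid (hr_matrix (lifts_fm (hr_types A) A) (block_vars (hr_types A)) #
      map (lifts_fm (hr_types A)) \<Gamma>) (lifts_fm (hr_types A) B)"
  shows "valid \<Gamma> (Imp A B)"
  using assms(3)
proof (rule validE)
  fix bs assume "wf_fm L (lifts_fm (hr_types A) B)" "list_all2 typ bs (hr_types (lifts_fm (hr_types A) B))"
    "ent (hr_matrix (lifts_fm (hr_types A) A) (block_vars (hr_types A)) #
      map (lifts_fm (hr_types A)) \<Gamma>) (hr_matrix (lifts_fm (hr_types A) B) bs)"
  from ex_abstracted_realizers[OF this, of "hr_types A"] assms(1,2) show ?thesis
    by (auto intro!: validI hr_matrix_ImpI simp del: hr_matrix.simps ent.simps)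
qed

lemma valid_ImpI:
  assumes "wf_fm L A" "wf_fm L B" "wfs \<Gamma>"
    and "\<And>s \<Gamma>'. morph s \<Gamma> \<Gamma>' \<Longrightarrow> valid \<Gamma>' (sub_fm s A) \<Longrightarrow> valid \<Gamma>' (sub_fm s B)"
  shows "valid \<Gamma> (Imp A B)"
proof (rule valid_ImpI_generic[OF assms(1,2)])
  let ?\<rho>s = "hr_types A"
  let ?\<Gamma> = "hr_matrix (lifts_fm ?\<rho>s A) (block_vars ?\<rho>s) # map (lifts_fm ?\<rho>s) \<Gamma>"
  have ws: "wfs ?\<Gamma>"
    using assms(1,3) by (auto simp: has_type_block_vars intro: wf_fm_lifts_fm intro!: wf_fm_hr_matrix)
  have "morph (lifts_sub ?\<rho>s) \<Gamma> ?\<Gamma>"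
    using ws by (intro morph_lifts) auto
  moreover have "valid ?\<Gamma> (lifts_fm ?\<rho>s A)"
    by (rule validI[of _ "block_vars ?\<rho>s"])
      (use assms(1) ent_assm[OF ws] in \<open>auto simp: has_type_block_vars intro: wf_fm_lifts_fm\<close>)
  ultimately show "valid ?\<Gamma> (lifts_fm ?\<rho>s B)"
    using assms(4) by (simp add: lifts_fm_eq_sub)
qed

text \<open>The block of realizers of \<open>A\<close> is empty, so the generic world is just
  \<open>A # \<Gamma>\<close>.\<close>

lemma valid_Imp_ex_free:
  assumes "ex_free A"
  shows "valid \<Gamma> (Imp A B) \<longleftrightarrow> valid (A # \<Gamma>) B"
proof
  assume a: "valid \<Gamma> (Imp A B)"
  have ws: "wfs (A # \<Gamma>)" using valid_wf[OF a] valid_wfs[OF a] by auto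
  show "valid (A # \<Gamma>) B"
    by (rule valid_ImpE[OF valid_weaken[OF a]]) (use ws ent_assm[OF ws] assms in \<open>auto simp: valid_ex_free\<close>)
next
  assume a: "valid (A # \<Gamma>) B"
  then show "valid \<Gamma> (Imp A B)"
    using valid_wf[OF a] valid_wfs[OF a] assms
    by (intro valid_ImpI_generic) (auto simp: hr_types_ex_free hr_matrix_ex_free map_idI)
qed

lemma valid_All_iff: "valid \<Gamma> (All \<rho> A) \<longleftrightarrow> valid (map (lift_fm \<rho>) \<Gamma>) A"
proof
  assume "valid \<Gamma> (All \<rho> A)"
  then obtain xs where xs: "wf_fm L A" "list_all2 typ xs (map (Arr \<rho>) (hr_types A))"
    "ent \<Gamma> (All \<rho> (hr_matrix A (map (\<lambda>x. lift_tm \<rho> x \<cdot> Var \<rho> 0) xs)))"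
    by (elim validE) auto
  show "valid (map (lift_fm \<rho>) \<Gamma>) A"
    by (rule validI[OF xs(1) _ ent_all_generic[OF xs(3)]])
      (use xs(2) in \<open>auto simp: list_all2_conv_all_nth intro!: has_type.App[OF has_type_ren_tm has_type.Var]\<close>)
next
  assume "valid (map (lift_fm \<rho>) \<Gamma>) A"
  then show "valid \<Gamma> (All \<rho> A)"
  proof (rule validE)
    fix bs assume *: "wf_fm L A" "list_all2 typ bs (hr_types A)" "ent (map (lift_fm \<rho>) \<Gamma>) (hr_matrix A bs)"
    from ex_abstracted_realizers[OF this, of "[\<rho>]"] *(1) show ?thesis
      by (auto intro!: validI ent_allI simp: arrs_single)
  qed
qed

lemma valid_AllE:
  assumes "valid \<Gamma> (All \<rho> A)" "typ t \<rho>"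
  shows "valid \<Gamma> (inst \<rho> t A)"
proof -
  \<comment> \<open>Instantiation cancels the lifting, so it leads from the world below the binder
    back to \<open>\<Gamma>\<close>.\<close>
  have "morph (sub_cons \<rho> t Var) (map (lift_fm \<rho>) \<Gamma>) \<Gamma>"
    using assms valid_wfs[OF assms(1)] by (auto simp: morph_def typed_sub_cons)
  then show ?thesis
    using assms(1) by (auto simp: valid_All_iff inst_eq_sub_cons intro: valid_morph)
qed

section \<open>Closure of validity under the rules for the remaining connectives and
  quantifiers\<close>

lemma valid_AndI: "valid \<Gamma> A \<Longrightarrow> valid \<Gamma> B \<Longrightarrow> valid \<Gamma> (And A B)"
proof (elim validE)
  fix xs ys assume "wf_fm L A" "list_all2 typ xs (hr_types A)" "length xs = length (hr_types A)"
    "ent \<Gamma> (hr_matrix A xs)" "wf_fm L B" "list_all2 typ ys (hr_types B)" "ent \<Gamma> (hr_matrix B ys)"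
  then show ?thesis
    by (intro validI[of _ "xs @ ys"]) (auto intro: list_all2_appendI ent_andI)
qed

lemma valid_AndE:
  assumes "valid \<Gamma> (And A B)"
  shows "valid \<Gamma> A" "valid \<Gamma> B"
proof -
  from assms obtain xs ys where "wf_fm L A" "wf_fm L B"
    and "list_all2 typ xs (hr_types A)" "list_all2 typ ys (hr_types B)"
    and "ent \<Gamma> (And (hr_matrix A xs) (hr_matrix B ys))"
    by (auto elim!: validE simp: list_all2_append2 list_all2_lengthD)
  then show "valid \<Gamma> A" "valid \<Gamma> B"
    by (blast intro: validI ent_andE1 ent_andE2)+
qed

text \<open>The matrix of a disjunction takes realizers for both sides, so the other disjunct
  receives arbitrary terms of the right types.\<close>

lemma valid_OrI1: 
  assumes "valid \<Gamma> A" "wf_fm L B"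
  shows "valid \<Gamma> (Or A B)"
  using assms(1)
proof (rule validE)
  obtain ys where ys: "list_all2 typ ys (hr_types B)"
    using ex_typed_list by blast
  fix xs assume "wf_fm L A" "list_all2 typ xs (hr_types A)" "length xs = length (hr_types A)"
    "ent \<Gamma> (hr_matrix A xs)"
  with ys assms(2) show ?thesis
    by (intro validI[of _ "xs @ ys"]) (auto intro: list_all2_appendI ent_orI1 wf_fm_hr_matrix)
qed

lemma valid_OrI2: 
  assumes "valid \<Gamma> B" "wf_fm L A"
  shows "valid \<Gamma> (Or A B)"
  using assms(1)
proof (rule validE)
  obtain ys where ys: "list_all2 typ ys (hr_types A)"
    using ex_typed_list by blast
  fix xs assume "wf_fm L B" "list_all2 typ xs (hr_types B)"
    "ent \<Gamma> (hr_matrix B xs)"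
  with ys assms(2) show ?thesis
    by (intro validI[of _ "ys @ xs"])
      (auto simp: list_all2_lengthD intro: list_all2_appendI ent_orI2 wf_fm_hr_matrix)
qed

lemma valid_OrE:
  assumes AC: "valid \<Gamma> (Imp A C)" and BC: "valid \<Gamma> (Imp B C)" and "valid \<Gamma> (Or A B)"
  shows "valid \<Gamma> C"
proof -
  let ?\<tau>s = "hr_types C"
  have wfC: "wf_fm L C" using valid_wf[OF AC] by simp
  from assms(3) obtain xs ys where wf: "wf_fm L A" "wf_fm L B" "wfs \<Gamma>"
    and xs: "list_all2 typ xs (hr_types A)" and ys: "list_all2 typ ys (hr_types B)"
    and ent: "ent \<Gamma> (Or (hr_matrix A xs) (hr_matrix B ys))"
    by (auto elim!: validE simp: list_all2_append2 list_all2_lengthD)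
  let ?\<Gamma>1 = "hr_matrix A xs # \<Gamma>" and ?\<Gamma>2 = "hr_matrix B ys # \<Gamma>"
  have ws: "wfs ?\<Gamma>1" "wfs ?\<Gamma>2"
    using ent_wf[OF ent] by auto
  have "valid ?\<Gamma>1 A" "valid ?\<Gamma>2 B"
    using ent_assm[OF ws(1)] ent_assm[OF ws(2)] wf xs ys by (auto intro!: validI simp del: ent.simps)
  then have "valid ?\<Gamma>1 C" "valid ?\<Gamma>2 C"
    using valid_weaken[OF AC, of ?\<Gamma>1] valid_weaken[OF BC, of ?\<Gamma>2] ws by (auto intro: valid_ImpE)
  then obtain cs ds where cs: "list_all2 typ cs ?\<tau>s" "ent ?\<Gamma>1 (hr_matrix C cs)"
    and ds: "list_all2 typ ds ?\<tau>s" "ent ?\<Gamma>2 (hr_matrix C ds)"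
    by (auto elim!: validE simp del: ent.simps)
  \<comment> \<open>The conclusion needs one tuple for both branches. Each join lies above the
    realizer of either branch, in the context of that branch.\<close>
  have "\<forall>i<length ?\<tau>s. \<exists>e. typ e (?\<tau>s ! i) \<and>
      le (?\<tau>s ! i) ?\<Gamma>1 (cs ! i) e \<and> le (?\<tau>s ! i) ?\<Gamma>2 (ds ! i) e"
  proof (intro allI impI)
    fix i assume i: "i < length ?\<tau>s"
    with ex_join[of "?\<tau>s ! i"] obtain U where U: "typ U (?\<tau>s ! i \<rightarrow>\<^sub>t ?\<tau>s ! i \<rightarrow>\<^sub>t ?\<tau>s ! i)"
      "\<And>\<Gamma> x y. wfs \<Gamma> \<Longrightarrow> typ x (?\<tau>s ! i) \<Longrightarrow> typ y (?\<tau>s ! i) \<Longrightarrow>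
        le (?\<tau>s ! i) \<Gamma> x (U \<cdot> x \<cdot> y) \<and> le (?\<tau>s ! i) \<Gamma> y (U \<cdot> x \<cdot> y)"
      by auto
    have "typ (cs ! i) (?\<tau>s ! i)" "typ (ds ! i) (?\<tau>s ! i)"
      using cs(1) ds(1) i by (auto simp: list_all2_conv_all_nth)
    then show "\<exists>e. typ e (?\<tau>s ! i) \<and> le (?\<tau>s ! i) ?\<Gamma>1 (cs ! i) e \<and> le (?\<tau>s ! i) ?\<Gamma>2 (ds ! i) e"
      using U ws by (intro exI[of _ "U \<cdot> cs ! i \<cdot> ds ! i"] conjI) (blast intro: has_type.App)+
  qed
  then obtain es where es: "length es = length ?\<tau>s"
    "\<And>i. i < length ?\<tau>s \<Longrightarrow> typ (es ! i) (?\<tau>s ! i)"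
    "\<And>i. i < length ?\<tau>s \<Longrightarrow> le (?\<tau>s ! i) ?\<Gamma>1 (cs ! i) (es ! i)"
    "\<And>i. i < length ?\<tau>s \<Longrightarrow> le (?\<tau>s ! i) ?\<Gamma>2 (ds ! i) (es ! i)"
    unfolding Skolem_list_nth by blast
  have "les ?\<tau>s ?\<Gamma>1 cs es" "les ?\<tau>s ?\<Gamma>2 ds es"
    using es cs(1) ds(1) by (auto simp: les_def list_all2_conv_all_nth)
  then have "ent ?\<Gamma>1 (hr_matrix C es)" "ent ?\<Gamma>2 (hr_matrix C es)"
    using cs(2) ds(2) wfC by (blast intro: hr_matrix_mono)+
  with ent have "ent \<Gamma> (hr_matrix C es)" by (rule ent_orE)
  then show ?thesis
    using es wfC by (intro validI[of _ es]) (auto simp: list_all2_conv_all_nth)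
qed

lemma valid_BotE:
  assumes "ent \<Gamma> Bot" "wf_fm L A"
  shows "valid \<Gamma> A"
proof -
  obtain ys where ys: "list_all2 typ ys (hr_types A)"
    using ex_typed_list by blast
  then show ?thesis
    using assms by (intro validI[of _ ys]) (auto intro: ent_botE wf_fm_hr_matrix)
qed

text \<open>The terms \<open>cs\<close> may depend on the bound variable, which must not occur in
  the final realizers. Abstracting it and taking the union over \<open>Z\<close> gives terms
  independent of it; they lie above \<open>cs\<close> since the variable is assumed to be in
  \<open>Z\<close>.\<close>

lemma ex_bounded_realizers:
  assumes "wf_fm L C" "list_all2 typ cs (hr_types C)" "ent \<Gamma> (hr_matrix C cs)"
    and "typ Z (Star \<rho>)" "ent \<Gamma> (In \<rho> (Var \<rho> 0) (lift_tm \<rho> Z))"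
  shows "\<exists>ds. list_all2 typ ds (hr_types C) \<and> ent \<Gamma> (hr_matrix C (map (lift_tm \<rho>) ds))"
proof -
  let ?\<tau>s = "hr_types C"
  have wfs: "wfs \<Gamma>" using ent_wf[OF assms(3)] by simp
  have "\<forall>i<length ?\<tau>s. \<exists>d. typ d (?\<tau>s ! i) \<and> le (?\<tau>s ! i) \<Gamma> (cs ! i) (lift_tm \<rho> d)"
  proof (intro allI impI)
    fix i assume i: "i < length ?\<tau>s"
    then have \<tau>: "star_ended (?\<tau>s ! i)" by simp
    with ex_big_join[of "?\<tau>s ! i" \<rho>] obtain B where
      B: "fv_tm B = {}" "typ B (Star \<rho> \<rightarrow>\<^sub>t (\<rho> \<rightarrow>\<^sub>t ?\<tau>s ! i) \<rightarrow>\<^sub>t ?\<tau>s ! i)"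
      "\<And>\<Gamma> t u z. typ u (\<rho> \<rightarrow>\<^sub>t ?\<tau>s ! i) \<Longrightarrow> ent \<Gamma> (In \<rho> z t) \<Longrightarrow> le (?\<tau>s ! i) \<Gamma> (u \<cdot> z) (B \<cdot> t \<cdot> u)"
      by blast
    have "typ (cs ! i) (?\<tau>s ! i)"
      using assms(2) i by (auto simp: list_all2_conv_all_nth)
    from ex_block_abstraction[OF this, of "[\<rho>]"] obtain u where u: "typ u (\<rho> \<rightarrow>\<^sub>t ?\<tau>s ! i)"
      "prov (Eq (?\<tau>s ! i) (lift_tm \<rho> u \<cdot> Var \<rho> 0) (cs ! i))"
      by auto
    have "le (?\<tau>s ! i) \<Gamma> (cs ! i) (lift_tm \<rho> u \<cdot> Var \<rho> 0)"
      using u(2) \<tau> wfs by (intro le_prov_eq)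
    moreover have "le (?\<tau>s ! i) \<Gamma> (lift_tm \<rho> u \<cdot> Var \<rho> 0) (lift_tm \<rho> (B \<cdot> Z \<cdot> u))"
      using B(3)[OF has_type_ren_tm[OF u(1), of "shift \<rho>"] assms(5)] sub_tm_closed[OF B(1)]
      by (simp add: lift_tm_eq_sub)
    ultimately have "le (?\<tau>s ! i) \<Gamma> (cs ! i) (lift_tm \<rho> (B \<cdot> Z \<cdot> u))"
      by (rule le_trans)
    then show "\<exists>d. typ d (?\<tau>s ! i) \<and> le (?\<tau>s ! i) \<Gamma> (cs ! i) (lift_tm \<rho> d)"
      using B(2) u(1) assms(4) by (intro exI[of _ "B \<cdot> Z \<cdot> u"]) (blast intro: has_type.App)
  qed
  then obtain ds where ds: "length ds = length ?\<tau>s"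
    "\<And>i. i < length ?\<tau>s \<Longrightarrow> typ (ds ! i) (?\<tau>s ! i)"
    "\<And>i. i < length ?\<tau>s \<Longrightarrow> le (?\<tau>s ! i) \<Gamma> (cs ! i) (lift_tm \<rho> (ds ! i))"
    unfolding Skolem_list_nth by blast
  have "les ?\<tau>s \<Gamma> cs (map (lift_tm \<rho>) ds)"
    using ds assms(2) by (auto simp: les_def list_all2_conv_all_nth intro: has_type_ren_tm)
  then have "ent \<Gamma> (hr_matrix C (map (lift_tm \<rho>) ds))"
    using assms by (blast intro: hr_matrix_mono)
  then show ?thesis
    using ds by (auto simp: list_all2_conv_all_nth)
qed

lemma valid_ExI:
  assumes "valid \<Gamma> (inst \<rho> t A)" "typ t \<rho>" "wf_fm L A"
  shows "valid \<Gamma> (Ex \<rho> A)"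
  using assms(1)
proof (rule validE)
  fix xs assume xs: "list_all2 typ xs (hr_types (inst \<rho> t A))" "length xs = length (hr_types (inst \<rho> t A))"
    "ent \<Gamma> (hr_matrix (inst \<rho> t A) xs)" "wfs \<Gamma>"
  \<comment> \<open>The bounding set is the singleton of the witness.\<close>
  let ?Z = "Con (CSing \<rho>) \<cdot> t"
  have typed: "list_all2 typ (?Z # xs) (hr_types (Ex \<rho> A))"
    using xs(1) assms(2) by (auto simp: inst_eq_sub_cons intro: has_type.App)
  from wf_fm_hr_matrix[OF _ this] assms(3) have wf: "wf_fm L (hr_matrix A (map (lift_tm \<rho>) xs))"
    by simp
  have "inst \<rho> t (hr_matrix A (map (lift_tm \<rho>) xs)) = hr_matrix (inst \<rho> t A) xs"
    using xs(2) by (simp add: inst_eq_sub_cons hr_matrix_sub_fm o_def map_idI)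
  with xs wf assms(2) have "ent \<Gamma> (BEx \<rho> ?Z (hr_matrix A (map (lift_tm \<rho>) xs)))"
    by (intro ent_BExI[of _ _ t]) (auto intro: ent_in_sing)
  then show ?thesis
    using typed assms(3) by (intro validI[of _ "?Z # xs"]) auto
qed

text \<open>The matrix of the premise provides a set \<open>Z\<close> containing the witness.
  Realizers of \<open>C\<close> found for a generic element of \<open>Z\<close> are made independent
  of it by \<open>ex_bounded_realizers\<close>, after which the bounded quantifier can be
  eliminated.\<close>

lemma valid_ExE:
  assumes "valid \<Gamma> (Ex \<rho> A)" "wf_fm L C"
    and "\<And>\<Gamma>'. morph (shift_sub \<rho>) \<Gamma> \<Gamma>' \<Longrightarrow> valid \<Gamma>' A \<Longrightarrow> valid \<Gamma>' (lift_fm \<rho> C)"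
  shows "valid \<Gamma> C"
proof -
  from assms(1) obtain Z xs where xs: "wf_fm L A" "typ Z (Star \<rho>)" "list_all2 typ xs (hr_types A)"
    "ent \<Gamma> (BEx \<rho> Z (hr_matrix A (map (lift_tm \<rho>) xs)))" "wfs \<Gamma>"
    by (auto elim!: validE simp: list_all2_Cons2)
  let ?\<Gamma> = "hr_matrix A (map (lift_tm \<rho>) xs) # In \<rho> (Var \<rho> 0) (lift_tm \<rho> Z) # map (lift_fm \<rho>) \<Gamma>"
  have ws: "wfs ?\<Gamma>"
    using ent_wf[OF xs(4)] by (auto intro: wf_fm_ren_fm has_type_ren_tm has_type.Var)
  have "valid ?\<Gamma> (lift_fm \<rho> C)"
  proof (rule assms(3))
    show "morph (shift_sub \<rho>) \<Gamma> ?\<Gamma>" using ws by (intro morph_shift) auto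
    show "valid ?\<Gamma> A"
      by (rule validI[OF xs(1) has_type_map_ren_tm[OF xs(3), of "shift \<rho>"] ent_assm[OF ws]]) simp
  qed
  then obtain cs where cs: "wf_fm L (lift_fm \<rho> C)" "list_all2 typ cs (hr_types (lift_fm \<rho> C))"
    "ent ?\<Gamma> (hr_matrix (lift_fm \<rho> C) cs)"
    by (rule validE)
  have "ent ?\<Gamma> (In \<rho> (Var \<rho> 0) (lift_tm \<rho> Z))"
    by (rule ent_assm[OF ws]) simp
  from ex_bounded_realizers[OF cs xs(2) this] obtain ds where ds: "list_all2 typ ds (hr_types C)"
    "ent ?\<Gamma> (hr_matrix (lift_fm \<rho> C) (map (lift_tm \<rho>) ds))"
    by (auto simp del: ent.simps)
  have "hr_matrix (lift_fm \<rho> C) (map (lift_tm \<rho>) ds) = lift_fm \<rho> (hr_matrix C ds)"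
    using list_all2_lengthD[OF ds(1)] by (simp add: lift_fm_eq_sub lift_tm_eq_sub[abs_def] hr_matrix_sub_fm)
  with ds(2) xs(4) have "ent \<Gamma> (hr_matrix C ds)"
    by (auto intro: ent_BExE simp del: ent.simps)
  with ds(1) assms(2) show ?thesis by (intro validI)
qed

text \<open>From right to left, the realizers found for a generic \<open>z\<close> may mention
  \<open>z\<close>, whereas those of the bounded quantifier may not; they are united over
  \<open>t\<close>. The condition obtained is also that for the unfolded universal formula.\<close>

lemma valid_BAll_iff:
  "valid \<Gamma> (BAll \<rho> t A) \<longleftrightarrow> valid (In \<rho> (Var \<rho> 0) (lift_tm \<rho> t) # map (lift_fm \<rho>) \<Gamma>) A"
proof
  assume "valid \<Gamma> (BAll \<rho> t A)"
  then obtain xs where xs: "wf_fm L A" "list_all2 typ xs (hr_types A)"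
    "ent \<Gamma> (All \<rho> (Imp (In \<rho> (Var \<rho> 0) (lift_tm \<rho> t)) (hr_matrix A (map (lift_tm \<rho>) xs))))"
    by (auto elim!: validE simp: ent_BAll_iff)
  from ent_all_generic[OF this(3)]
  have "ent (In \<rho> (Var \<rho> 0) (lift_tm \<rho> t) # map (lift_fm \<rho>) \<Gamma>) (hr_matrix A (map (lift_tm \<rho>) xs))"
    by simp
  then show "valid (In \<rho> (Var \<rho> 0) (lift_tm \<rho> t) # map (lift_fm \<rho>) \<Gamma>) A"
    by (rule validI[OF xs(1) has_type_map_ren_tm[OF xs(2)]])
next
  let ?\<Gamma> = "In \<rho> (Var \<rho> 0) (lift_tm \<rho> t) # map (lift_fm \<rho>) \<Gamma>"
  assume "valid ?\<Gamma> A"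
  then obtain xs where xs: "wf_fm L A" "list_all2 typ xs (hr_types A)" "ent ?\<Gamma> (hr_matrix A xs)" and ws: "wfs ?\<Gamma>"
    by (rule validE)
  have t: "typ t (Star \<rho>)" using ws by (auto intro: has_type_ren_tmD)
  have "ent ?\<Gamma> (In \<rho> (Var \<rho> 0) (lift_tm \<rho> t))"
    by (rule ent_assm[OF ws]) simp
  from ex_bounded_realizers[OF xs t this] obtain ys where "list_all2 typ ys (hr_types A)"
    "ent ?\<Gamma> (hr_matrix A (map (lift_tm \<rho>) ys))" by blast
  then show "valid \<Gamma> (BAll \<rho> t A)"
    using t xs(1) by (intro validI[of _ ys]) (auto intro!: ent_BAllI simp del: ent.simps)
qed

text \<open>Forwards, \<open>t\<close> itself serves as the set realizing the existential
  quantifier. Backwards, that set is dropped, as the matrix still records membership in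
  \<open>t\<close>.\<close>

lemma valid_BEx_iff:
  "valid \<Gamma> (BEx \<rho> t A) \<longleftrightarrow>
    typ t (Star \<rho>) \<and> valid \<Gamma> (Ex \<rho> (And (In \<rho> (Var \<rho> 0) (lift_tm \<rho> t)) A))"
proof (intro iffI conjI)
  let ?I = "In \<rho> (Var \<rho> 0) (lift_tm \<rho> t)"
  assume a: "valid \<Gamma> (BEx \<rho> t A)"
  then obtain xs where xs: "wf_fm L A" "list_all2 typ xs (hr_types A)"
    "ent \<Gamma> (BEx \<rho> t (hr_matrix A (map (lift_tm \<rho>) xs)))"
    by (auto elim!: validE)
  show t: "typ t (Star \<rho>)" using valid_wf[OF a] by simp
  let ?\<Gamma> = "hr_matrix A (map (lift_tm \<rho>) xs) # ?I # map (lift_fm \<rho>) \<Gamma>"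
  have ws: "wfs ?\<Gamma>"
    using ent_wf[OF xs(3)] by (auto intro: wf_fm_ren_fm has_type_ren_tm has_type.Var)
  have "ent \<Gamma> (BEx \<rho> t (And ?I (hr_matrix A (map (lift_tm \<rho>) xs))))"
    by (rule ent_BEx_mono[OF xs(3) _ ent_andI]) (rule ent_assm[OF ws], simp)+
  then show "valid \<Gamma> (Ex \<rho> (And ?I A))"
    using xs t by (intro validI[of _ "t # xs"]) (auto intro: has_type_ren_tm has_type.Var)
next
  let ?I = "In \<rho> (Var \<rho> 0) (lift_tm \<rho> t)"
  assume a: "typ t (Star \<rho>) \<and> valid \<Gamma> (Ex \<rho> (And ?I A))"
  then obtain Z xs where xs: "wf_fm L A" "typ Z (Star \<rho>)" "list_all2 typ xs (hr_types A)"
    "ent \<Gamma> (BEx \<rho> Z (And ?I (hr_matrix A (map (lift_tm \<rho>) xs))))"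
    by (auto elim!: validE simp: list_all2_Cons2)
  let ?\<Gamma> = "And ?I (hr_matrix A (map (lift_tm \<rho>) xs)) # In \<rho> (Var \<rho> 0) (lift_tm \<rho> Z) # map (lift_fm \<rho>) \<Gamma>"
  have ws: "wfs ?\<Gamma>"
    using ent_wf[OF xs(4)] by (auto intro: wf_fm_ren_fm has_type_ren_tm has_type.Var)
  have h: "ent ?\<Gamma> (And ?I (hr_matrix A (map (lift_tm \<rho>) xs)))"
    by (rule ent_assm[OF ws]) simp
  have "ent \<Gamma> (BEx \<rho> t (hr_matrix A (map (lift_tm \<rho>) xs)))"
    by (rule ent_BEx_mono[OF xs(4) ent_andE1[OF h] ent_andE2[OF h]])
  then show "valid \<Gamma> (BEx \<rho> t A)"
    using xs a by (intro validI[of _ xs]) auto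
qed

section \<open>Validity of \<open>AC\<close>, \<open>IP\<close> and the logical axioms\<close>

lemma sub_fm_lift_commute_AC:
  "sub_fm (up_sub \<sigma> (up_sub \<rho> (sub_cons \<tau> Z s))) (ren_fm (up_ren \<sigma> (up_ren \<rho> (shift \<tau>))) A) =
   sub_fm (up_sub \<sigma> (up_sub \<rho> s)) A"
  by (simp add: sub_fm_ren_fm up_sub_up_ren)

lemma sub_fm_lift_commute_IP:
  "sub_fm (up_sub \<sigma> (sub_cons \<tau> Z s)) (ren_fm (up_ren \<sigma> (shift \<tau>)) A) = sub_fm (up_sub \<sigma> s) A"
  by (simp add: sub_fm_ren_fm up_sub_up_ren)

lemma valid_AC:
  assumes "F \<in> AC" "wf_fm L F"
  shows "valid [] F"
proof -
  from assms(1) obtain \<rho> \<sigma> A where F: "F = Imp (All \<rho> (Ex \<sigma> A))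
             (Ex (\<rho> \<rightarrow>\<^sub>t Star \<sigma>) (All \<rho>
               (BEx \<sigma> (lift_tm \<rho> (Var (\<rho> \<rightarrow>\<^sub>t Star \<sigma>) 0) \<cdot> Var \<rho> 0)
                 (ren_fm (up_ren \<sigma> (up_ren \<rho> (shift (\<rho> \<rightarrow>\<^sub>t Star \<sigma>)))) A))))"
    (is "F = Imp _ (Ex ?\<tau> ?C)") by (auto simp: AC_def)
  have wfC: "wf_fm L ?C" using assms(2) by (simp add: F)
  show ?thesis
    unfolding F
  proof (rule valid_ImpI)
    fix s \<Gamma> assume m: "morph s [] \<Gamma>" and v: "valid \<Gamma> (sub_fm s (All \<rho> (Ex \<sigma> A)))"
    let ?A = "sub_fm (up_sub \<sigma> (up_sub \<rho> s)) A"
    \<comment> \<open>By the clauses for \<open>All\<close> and \<open>Ex\<close>, the first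
      realizer of the premise has type \<open>\<rho> \<rightarrow>\<^sub>t Star \<sigma>\<close>: it
      is already the function required by the conclusion. The other realizers are reused
      unchanged.\<close>
    from v obtain Z xs where xs: "wf_fm L ?A" "typ Z ?\<tau>" "list_all2 typ xs (map (Arr \<rho>) (hr_types A))"
      "ent \<Gamma> (All \<rho> (BEx \<sigma> (lift_tm \<rho> Z \<cdot> Var \<rho> 0)
        (hr_matrix ?A (map (lift_tm \<sigma>) (map (\<lambda>x. lift_tm \<rho> x \<cdot> Var \<rho> 0) xs)))))"
      by (auto elim!: validE simp: list_all2_Cons2 simp del: map_map)
    have "typ (lift_tm \<rho> Z \<cdot> Var \<rho> 0) (Star \<sigma>)"
      using xs(2) by (auto intro: has_type.App has_type.Var has_type_ren_tm)
    then have "valid \<Gamma> (All \<rho> (BEx \<sigma> (lift_tm \<rho> Z \<cdot> Var \<rho> 0) ?A))"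
      using xs by (intro validI[of _ xs]) auto
    \<comment> \<open>The renaming in the scheme moved \<open>A\<close> past the quantifier over the
      function; substituting \<open>Z\<close> there cancels it.\<close>
    moreover have "inst ?\<tau> Z (sub_fm (up_sub ?\<tau> s) ?C) = All \<rho> (BEx \<sigma> (lift_tm \<rho> Z \<cdot> Var \<rho> 0) ?A)"
      unfolding inst_up_sub by (simp add: sub_fm_lift_commute_AC)
    ultimately have "valid \<Gamma> (Ex ?\<tau> (sub_fm (up_sub ?\<tau> s) ?C))"
      using xs(2) wfC m by (intro valid_ExI[of _ _ Z]) (auto simp del: sub_fm.simps intro!: wf_fm_sub_fm typed_sub_up morph_typed[OF m])
    then show "valid \<Gamma> (sub_fm s (Ex ?\<tau> ?C))" by simp
  qed (use assms(2) in \<open>auto simp: F\<close>)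
qed

lemma valid_IP:
  assumes "F \<in> IP" "wf_fm L F"
  shows "valid [] F"
proof -
  from assms(1) obtain B \<sigma> A where B: "ex_free B" and F: "F = Imp (Imp B (Ex \<sigma> A))
             (Ex (Star \<sigma>) (Imp (lift_fm (Star \<sigma>) B)
               (BEx \<sigma> (Var (Star \<sigma>) 0) (ren_fm (up_ren \<sigma> (shift (Star \<sigma>))) A))))"
    (is "F = Imp _ (Ex ?\<tau> ?C)") by (auto simp: IP_def)
  have wfC: "wf_fm L ?C" using assms(2) by (simp add: F)
  show ?thesis
    unfolding F
  proof (rule valid_ImpI)
    fix s \<Gamma> assume m: "morph s [] \<Gamma>" and v: "valid \<Gamma> (sub_fm s (Imp B (Ex \<sigma> A)))"
    let ?A = "sub_fm (up_sub \<sigma> s) A" and ?B = "sub_fm s B"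
    \<comment> \<open>As \<open>B\<close> is existential-free, it has no realizers on which the set
      \<open>Z\<close> found below could depend. Hence \<open>Z\<close> can be pulled in front of
      the implication.\<close>
    from v have "valid (?B # \<Gamma>) (Ex \<sigma> ?A)"
      using B by (simp add: valid_Imp_ex_free)
    then obtain Z xs where xs: "wf_fm L ?A" "typ Z ?\<tau>" "list_all2 typ xs (hr_types A)"
      "ent (?B # \<Gamma>) (BEx \<sigma> Z (hr_matrix ?A (map (lift_tm \<sigma>) xs)))"
      by (auto elim!: validE simp: list_all2_Cons2 simp del: ent.simps)
    then have "valid (?B # \<Gamma>) (BEx \<sigma> Z ?A)"
      by (intro validI[of _ xs]) (auto simp del: ent.simps)
    then have "valid \<Gamma> (Imp ?B (BEx \<sigma> Z ?A))"
      using B by (simp add: valid_Imp_ex_free)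
    moreover have "inst ?\<tau> Z (sub_fm (up_sub ?\<tau> s) ?C) = Imp ?B (BEx \<sigma> Z ?A)"
      unfolding inst_up_sub by (simp add: sub_fm_lift_commute_IP)
    ultimately have "valid \<Gamma> (Ex ?\<tau> (sub_fm (up_sub ?\<tau> s) ?C))"
      using xs(2) wfC m by (intro valid_ExI[of _ _ Z]) (auto simp del: sub_fm.simps intro!: wf_fm_sub_fm typed_sub_up morph_typed[OF m])
    then show "valid \<Gamma> (sub_fm s (Ex ?\<tau> ?C))" by simp
  qed (use assms(2) in \<open>auto simp: F\<close>)
qed


text \<open>Propositional and quantifier axioms are checked by the Kripke clauses, entering one
  world per premise. The axioms for bounded quantifiers reduce to the characterizations of their
  validity.\<close>

lemma valid_axiom:
  assumes "il_axiom L F" "wf_fm L F"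
  shows "valid [] F"
  using assms(1)
proof cases
  case (K A B)
  have wf: "wf_fm L A" "wf_fm L B" using assms(2) by (auto simp: K)
  show ?thesis
    unfolding K
  proof (rule valid_ImpI)
    fix s1 \<Gamma>1 assume m1: "morph s1 [] \<Gamma>1" and 1: "valid \<Gamma>1 (sub_fm s1 A)"
    show "valid \<Gamma>1 (sub_fm s1 (Imp B A))"
      unfolding sub_fm.simps
      by (rule valid_ImpI) (use wf m1 valid_morph[OF 1] in \<open>auto intro: wf_fm_sub_fm dest: morph_typed morph_wfs\<close>)
  qed (use wf in auto)
next
  case (S A B C)
  have wf: "wf_fm L A" "wf_fm L B" "wf_fm L C" using assms(2) by (auto simp: S)
  show ?thesis
    unfolding S
  proof (rule valid_ImpI)
    fix s1 \<Gamma>1 assume m1: "morph s1 [] \<Gamma>1" and 1: "valid \<Gamma>1 (sub_fm s1 (Imp A (Imp B C)))"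
    show "valid \<Gamma>1 (sub_fm s1 (Imp (Imp A B) (Imp A C)))"
      unfolding sub_fm.simps
    proof (rule valid_ImpI)
      fix s2 \<Gamma>2 assume m2: "morph s2 \<Gamma>1 \<Gamma>2"
        and 2: "valid \<Gamma>2 (sub_fm s2 (Imp (sub_fm s1 A) (sub_fm s1 B)))"
      show "valid \<Gamma>2 (sub_fm s2 (Imp (sub_fm s1 A) (sub_fm s1 C)))"
        unfolding sub_fm.simps
      proof (rule valid_ImpI)
        fix s3 \<Gamma>3 assume m3: "morph s3 \<Gamma>2 \<Gamma>3"
          and 3: "valid \<Gamma>3 (sub_fm s3 (sub_fm s2 (sub_fm s1 A)))"
        \<comment> \<open>The earlier assumptions are transported along the later steps to the
          current world, where modus ponens applies.\<close>
        from valid_morph[OF valid_morph[OF 1 m2] m3] valid_morph[OF 2 m3] 3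
        show "valid \<Gamma>3 (sub_fm s3 (sub_fm s2 (sub_fm s1 C)))"
          by (auto intro: valid_ImpE)
      qed (use wf m1 m2 in \<open>auto intro: wf_fm_sub_fm dest: morph_typed morph_wfs\<close>)
    qed (use wf m1 in \<open>auto intro: wf_fm_sub_fm dest: morph_typed morph_wfs\<close>)
  qed (use wf in auto)
next
  case (AndI A B)
  have wf: "wf_fm L A" "wf_fm L B" using assms(2) by (auto simp: AndI)
  show ?thesis
    unfolding AndI
  proof (rule valid_ImpI)
    fix s1 \<Gamma>1 assume m1: "morph s1 [] \<Gamma>1" and 1: "valid \<Gamma>1 (sub_fm s1 A)"
    show "valid \<Gamma>1 (sub_fm s1 (Imp B (And A B)))"
      unfolding sub_fm.simps
    proof (rule valid_ImpI)
      fix s2 \<Gamma>2 assume "morph s2 \<Gamma>1 \<Gamma>2" "valid \<Gamma>2 (sub_fm s2 (sub_fm s1 B))"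
      then show "valid \<Gamma>2 (sub_fm s2 (And (sub_fm s1 A) (sub_fm s1 B)))"
        using valid_morph[OF 1] by (auto intro: valid_AndI)
    qed (use wf m1 in \<open>auto intro: wf_fm_sub_fm dest: morph_typed morph_wfs\<close>)
  qed (use wf in auto)
next
  case (AndE1 A B)
  then show ?thesis
    using assms(2) by (auto intro!: valid_ImpI intro: valid_AndE)
next
  case (AndE2 A B)
  then show ?thesis
    using assms(2) by (auto intro!: valid_ImpI intro: valid_AndE)
next
  case (OrI1 A B)
  then show ?thesis
    using assms(2) by (auto intro!: valid_ImpI valid_OrI1 wf_fm_sub_fm dest: morph_typed)
next
  case (OrI2 A B)
  then show ?thesis
    using assms(2) by (auto intro!: valid_ImpI valid_OrI2 wf_fm_sub_fm dest: morph_typed)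
next
  case (OrE A C B)
  have wf: "wf_fm L A" "wf_fm L B" "wf_fm L C" using assms(2) by (auto simp: OrE)
  show ?thesis
    unfolding OrE
  proof (rule valid_ImpI)
    fix s1 \<Gamma>1 assume m1: "morph s1 [] \<Gamma>1" and 1: "valid \<Gamma>1 (sub_fm s1 (Imp A C))"
    show "valid \<Gamma>1 (sub_fm s1 (Imp (Imp B C) (Imp (Or A B) C)))"
      unfolding sub_fm.simps
    proof (rule valid_ImpI)
      fix s2 \<Gamma>2 assume m2: "morph s2 \<Gamma>1 \<Gamma>2"
        and 2: "valid \<Gamma>2 (sub_fm s2 (Imp (sub_fm s1 B) (sub_fm s1 C)))"
      show "valid \<Gamma>2 (sub_fm s2 (Imp (Or (sub_fm s1 A) (sub_fm s1 B)) (sub_fm s1 C)))"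
        unfolding sub_fm.simps
      proof (rule valid_ImpI)
        fix s3 \<Gamma>3 assume m3: "morph s3 \<Gamma>2 \<Gamma>3"
          and 3: "valid \<Gamma>3 (sub_fm s3 (Or (sub_fm s2 (sub_fm s1 A)) (sub_fm s2 (sub_fm s1 B))))"
        from valid_morph[OF valid_morph[OF 1 m2] m3] valid_morph[OF 2 m3] 3
        show "valid \<Gamma>3 (sub_fm s3 (sub_fm s2 (sub_fm s1 C)))"
          by (auto intro: valid_OrE)
      qed (use wf m1 m2 in \<open>auto intro: wf_fm_sub_fm dest: morph_typed morph_wfs\<close>)
    qed (use wf m1 in \<open>auto intro: wf_fm_sub_fm dest: morph_typed morph_wfs\<close>)
  qed (use wf in auto)
next
  case (BotE A)
  show ?thesis
    unfolding BotE
    by (rule valid_ImpI)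
      (use assms(2) in \<open>auto simp: BotE valid_ex_free intro!: valid_BotE wf_fm_sub_fm dest: morph_typed\<close>)
next
  case (AllE t \<rho> A)
  then show ?thesis
    using assms(2)
    by (auto intro!: valid_ImpI valid_AllE simp: sub_inst_up intro: morph_has_type)
next
  case (ExI t \<rho> A)
  have wf: "wf_fm L A" using assms(2) by (auto simp: ExI)
  show ?thesis
    unfolding ExI
  proof (rule valid_ImpI)
    fix s \<Gamma> assume m: "morph s [] \<Gamma>" and "valid \<Gamma> (sub_fm s (inst \<rho> t A))"
    then have "valid \<Gamma> (inst \<rho> (sub_tm s t) (sub_fm (up_sub \<rho> s) A))"
      by (simp add: sub_inst_up)
    then show "valid \<Gamma> (sub_fm s (Ex \<rho> A))"
      unfolding sub_fm.simps
      by (rule valid_ExI) (use ExI wf morph_typed[OF m] in \<open>auto intro: has_type_sub_tm wf_fm_sub_fm typed_sub_up\<close>)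
  qed (use assms(2) in \<open>auto simp: ExI\<close>)
next
  case (eq_repl x \<rho> i y j A A')
  \<comment> \<open>Replacement is confined to atomic formulas, so the whole axiom is
    existential-free.\<close>
  then show ?thesis
    using assms repl_fm_ex_free[OF eq_repl(4)] by (simp add: valid_ex_free provable.logical)
next
  case (BAll \<rho> t A)
  have "valid \<Gamma> (BAll \<rho> t' A') = valid \<Gamma> (All \<rho> (Imp (In \<rho> (Var \<rho> 0) (lift_tm \<rho> t')) A'))" for \<Gamma> t' A'
    by (simp add: valid_BAll_iff valid_All_iff valid_Imp_ex_free)
  then show ?thesis
    using assms(2) unfolding BAll
    by (auto intro!: valid_AndI valid_ImpI simp: sub_tm_up_lift)
next
  case (BEx \<rho> t A)
  then show ?thesis
    using assms(2)
    by (auto intro!: valid_AndI valid_ImpI simp: sub_tm_up_lift valid_BEx_iff intro: morph_has_type)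
\<comment> \<open>The remaining axioms, on equality, the combinators and star types, contain no
  unbounded existential quantifier and hold as they stand.\<close>
qed (use assms in \<open>simp_all add: valid_ex_free provable.logical\<close>)

text \<open>Validity refers to derivability from \<open>T\<close> alone, so \<open>AC\<close> and
  \<open>IP\<close> are eliminated here. The context is empty in the induction; the rules
  \<open>AllI\<close> and \<open>ExE\<close> are checked in arbitrary later worlds.\<close>

theorem soundness: "provable L (AC \<union> IP \<union> T) A \<Longrightarrow> valid [] A"
proof (induction rule: provable.induct)
  case (logical A)
  then show ?case by (rule valid_axiom)
next
  case (nonlogical A)
  then show ?case
    using T_ex_free by (auto intro: valid_AC valid_IP simp: valid_ex_free provable.nonlogical)
next
  case (MP A B)
  then show ?case by (blast intro: valid_ImpE)
next
  case (AllI \<rho> B A)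
  show ?case
  proof (rule valid_ImpI)
    fix s \<Gamma> assume m: "morph s [] \<Gamma>" and v: "valid \<Gamma> (sub_fm s B)"
    let ?\<Gamma> = "map (lift_fm \<rho>) \<Gamma>"
    have ws: "wfs ?\<Gamma>" using morph_wfs[OF m] by (auto intro: wf_fm_ren_fm)
    \<comment> \<open>\<open>up_sub \<rho> s\<close> is \<open>s\<close> read below the binder. It
      starts from the empty context, so the induction hypothesis becomes available in
      \<open>?\<Gamma>\<close>.\<close>
    then have "morph (up_sub \<rho> s) [] ?\<Gamma>"
      using m by (auto simp: morph_def typed_sub_up)
    from valid_morph[OF AllI.IH this]
    have "valid ?\<Gamma> (Imp (lift_fm \<rho> (sub_fm s B)) (sub_fm (up_sub \<rho> s) A))"
      by (simp add: sub_fm_up_lift)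
    moreover have "valid ?\<Gamma> (lift_fm \<rho> (sub_fm s B))"
      using valid_morph[OF v morph_shift[OF ws]] by (simp add: lift_fm_eq_sub)
    ultimately show "valid \<Gamma> (sub_fm s (All \<rho> A))"
      by (simp add: valid_All_iff) (rule valid_ImpE)
  qed (use valid_wf[OF AllI.IH] in \<open>auto intro: wf_fm_ren_fmD\<close>)
next
  case (ExE A \<rho> B)
  have wf: "wf_fm L A" "wf_fm L B"
    using valid_wf[OF ExE.IH] by (auto intro: wf_fm_ren_fmD)
  show ?case
  proof (rule valid_ImpI)
    fix s \<Gamma> assume m: "morph s [] \<Gamma>" and v: "valid \<Gamma> (sub_fm s (Ex \<rho> A))"
    show "valid \<Gamma> (sub_fm s B)"
    proof (rule valid_ExE[OF v[unfolded sub_fm.simps]])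
      fix \<Gamma>' assume m': "morph (shift_sub \<rho>) \<Gamma> \<Gamma>'" and v': "valid \<Gamma>' (sub_fm (up_sub \<rho> s) A)"
      have "morph (up_sub \<rho> s) [] \<Gamma>'"
        using m m' by (auto simp: morph_def typed_sub_up)
      from valid_morph[OF ExE.IH this]
      have "valid \<Gamma>' (Imp (sub_fm (up_sub \<rho> s) A) (lift_fm \<rho> (sub_fm s B)))"
        by (simp add: sub_fm_up_lift)
      then show "valid \<Gamma>' (lift_fm \<rho> (sub_fm s B))"
        using v' by (rule valid_ImpE)
    qed (use wf m in \<open>auto intro: wf_fm_sub_fm morph_typed\<close>)
  qed (use wf in auto)
qed

section \<open>Extraction of closed realizers\<close>

lemma valid_closed_realizers:
  assumes "valid [] A" "set a = fv_fm A"
  shows "\<exists>ts. list_all2 (\<lambda>t \<tau>. fv_tm t = {} \<and> typ t (arrs (map fst a) \<tau>)) ts (hr_types A)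
    \<and> prov (hr_matrix A (map (\<lambda>t. apps t (vars a)) ts))"
  using assms(1)
proof (rule validE)
  fix us assume us: "wf_fm L A" "list_all2 typ us (hr_types A)" "length us = length (hr_types A)"
    "ent [] (hr_matrix A us)"
  let ?\<tau>s = "hr_types A"
  from ex_closed obtain d where d: "\<And>\<tau>. fv_tm (d \<tau>) = {}" "\<And>\<tau>. typ (d \<tau>) \<tau>"
    by metis
  \<comment> \<open>This substitution leaves \<open>A\<close> unchanged and closes all other
    variables that the realizers may contain, so that only the listed parameters remain to be
    abstracted.\<close>
  define s where "s = (\<lambda>\<sigma> n. if (\<sigma>, n) \<in> fv_fm A then Var \<sigma> n else d \<sigma>)"
  have s: "typed_sub L s"
    by (auto simp: s_def typed_sub_def d has_type.Var)
  have A: "sub_fm s A = A"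
    using sub_fm_cong[of A s Var] by (simp add: s_def)
  let ?us = "map (sub_tm s) us"
  have ent: "ent [] (hr_matrix A ?us)"
    using ent_sub[OF us(4) s] us(3) by (simp add: hr_matrix_sub_fm A)
  have typ_us: "typ (?us ! i) (?\<tau>s ! i)" if "i < length ?\<tau>s" for i
    using that us(2) s by (auto simp: list_all2_conv_all_nth intro: has_type_sub_tm)
  have "\<forall>i<length ?\<tau>s. \<exists>t. fv_tm t = {} \<and> typ t (arrs (map fst a) (?\<tau>s ! i)) \<and>
      prov (Eq (?\<tau>s ! i) (apps t (vars a)) (?us ! i))"
  proof (intro allI impI)
    fix i assume i: "i < length ?\<tau>s"
    have "fv_tm (?us ! i) \<subseteq> set a"
      using i us(3) by (auto simp: fv_sub_tm s_def d assms(2) split: if_splits)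
    from ex_combinator[OF typ_us[OF i] this]
    show "\<exists>t. fv_tm t = {} \<and> typ t (arrs (map fst a) (?\<tau>s ! i)) \<and>
      prov (Eq (?\<tau>s ! i) (apps t (vars a)) (?us ! i))" by blast
  qed
  then obtain ts where ts: "length ts = length ?\<tau>s"
    "\<And>i. i < length ?\<tau>s \<Longrightarrow> fv_tm (ts ! i) = {} \<and> typ (ts ! i) (arrs (map fst a) (?\<tau>s ! i))"
    "\<And>i. i < length ?\<tau>s \<Longrightarrow> prov (Eq (?\<tau>s ! i) (apps (ts ! i) (vars a)) (?us ! i))"
    unfolding Skolem_list_nth by blast
  \<comment> \<open>The closed combinators applied to the parameters are provably equal to the
    realizers; monotonicity transfers the matrix to them.\<close>
  have "les ?\<tau>s [] ?us (map (\<lambda>t. apps t (vars a)) ts)"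
    unfolding les_def
  proof (intro conjI allI impI)
    fix i assume i: "i < length ?\<tau>s"
    show "typ (map (\<lambda>t. apps t (vars a)) ts ! i) (?\<tau>s ! i)"
      using ts(1) ts(2)[OF i] i has_type_apps[OF _ has_type_vars] by simp
    show "le (?\<tau>s ! i) [] (?us ! i) (map (\<lambda>t. apps t (vars a)) ts ! i)"
      using le_prov_eq[OF ts(3)[OF i]] i ts(1) by simp
  qed (use ts(1) us(3) typ_us in auto)
  from hr_matrix_mono[OF us(1) this ent] show ?thesis
    using ts(1,2) by (intro exI[of _ ts]) (auto simp: list_all2_conv_all_nth)
qed

end

theorem theorem6:
  fixes L :: "('f, 'r) language"
    and A :: "('f, 'r) fm"
    and T :: "('f, 'r) fm set"
    and a :: "(ty \<times> nat) list"
  assumes "\<exists>c\<in>funs L. fun_arity L c = 0"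
    and "wf_fm L A"
    and "distinct a" and "set a = fv_fm A"
    and "\<forall>B\<in>T. wf_fm L B \<and> ex_free B"
    and "provable L (AC \<union> IP \<union> T) A"
  shows "\<exists>ts. list_all2 (\<lambda>t \<tau>. fv_tm t = {} \<and> has_type L t (arrs (map fst a) \<tau>)) ts (hr_types A)
    \<and> provable L T (hr_matrix A (map (\<lambda>t. apps t (map (\<lambda>(\<sigma>, n). Var \<sigma> n) a)) ts))"
proof -
  interpret ex_free_theory L T
    by unfold_locales (use assms in auto)
  show ?thesis
    using soundness[OF assms(6)] assms(4) by (rule valid_closed_realizers)
qed

end
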